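(* Let $p,q\in\mathbb{N}$ with $p,q\ge2$, let $f:\overline{\mathbb D}\times\overline{\mathbb D}\to\mathbb{C}$ be continuous, where $\overline{\mathbb D}=\{z\in\mathbb{C}:|z|\le1\}$, and define $F:U(q)\times U(p)\to\mathbb{C}$ by $F(A,B)=f(Ae_1\cdot e_1,Be_1\cdot e_1)$. Then $F$ is a continuous positive definite function on the group $U(q)\times U(p)$ which is bi-invariant with respect to $U(q-1)\times U(p-1)$ if and only if there exists $c:\mathbb{N}_0^4\to[0,\infty)$ with $\sum_{(m,n,k,l)\in\mathbb{N}_0^4}c(m,n,k,l)<\infty$ such that $$f(z,w)=\sum_{(m,n,k,l)\in\mathbb{N}_0^4}c(m,n,k,l)R^{q-2}_{m,n}(z)R^{p-2}_{k,l}(w),\qquad z,w\in\overline{\mathbb D}.$$ This series converges uniformly on $\overline{\mathbb D}^2$.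
   Context: $U(q)$ is the group of unitary $q\times q$ complex matrices, $e_1$ the first standard basis vector, $z\cdot w=\sum_k z_k\overline{w_k}$ (so $Ae_1\cdot e_1$ is the upper left entry of $A$). $U(q-1)$ is identified with the subgroup of $U(q)$ of matrices $\begin{pmatrix}1&0\\0&\tilde A\end{pmatrix}$, $\tilde A\in U(q-1)$ (the stabilizer of $e_1$); similarly for $U(p-1)\subset U(p)$. A function $g$ on a group $G$ is bi-invariant with respect to a subgroup $K$ if $g(kxl)=g(x)$ for $k,l\in K$. A continuous $g$ on a group $H$ is positive definite if $\sum_{j,k=1}^n g(x_j^{-1}x_k)c_j\overline{c_k}\ge0$ for all $n$, $x_j\in H$, $c_j\in\mathbb{C}$. For $\alpha,\beta>-1$, $R^{(\alpha,\beta)}_k=P^{(\alpha,\beta)}_k/P^{(\alpha,\beta)}_k(1)$ with $P^{(\alpha,\beta)}_k$ the Jacobi polynomial, and the disc polynomials are $R^{\alpha}_{m,n}(re^{i\theta})=r^{|m-n|}e^{i(m-n)\theta}R^{(\alpha,|m-n|)}_{\min(m,n)}(2r^2-1)$ for $0\le r\le1$, $\theta\in[0,2\pi)$. *)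

theory Defs
  imports "HOL-Analysis.Analysis"
begin

definition cadj :: "complex^'n^'n \<Rightarrow> complex^'n^'n" where
  "cadj A = (\<chi> i j. cnj (A $ j $ i))"

definition unitary_group :: "(complex^'n^'n) set" where
  "unitary_group = {A. A ** cadj A = mat 1 \<and> cadj A ** A = mat 1}"

text \<open>The stabilizer of the basis vector indexed by i0 (the copy of U(n-1) inside U(n)).\<close>
definition stab_group :: "'n \<Rightarrow> (complex^'n^'n) set" where
  "stab_group i0 = {A \<in> unitary_group. A $ i0 $ i0 = 1 \<and>
      (\<forall>j. j \<noteq> i0 \<longrightarrow> A $ i0 $ j = 0 \<and> A $ j $ i0 = 0)}"

definition pos_def_prod ::
  "((complex^'q^'q) \<times> (complex^'p^'p) \<Rightarrow> complex) \<Rightarrow> bool" where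
  "pos_def_prod g \<longleftrightarrow>
     (\<forall>(n::nat) (x :: nat \<Rightarrow> (complex^'q^'q) \<times> (complex^'p^'p)) (c :: nat \<Rightarrow> complex).
        (\<forall>j<n. x j \<in> unitary_group \<times> unitary_group) \<longrightarrow>
        (let S = (\<Sum>j<n. \<Sum>k<n.
             g (cadj (fst (x j)) ** fst (x k), cadj (snd (x j)) ** snd (x k)) * c j * cnj (c k))
         in S \<in> \<real> \<and> 0 \<le> Re S))"

definition biinv_prod ::
  "'q \<Rightarrow> 'p \<Rightarrow> ((complex^'q^'q) \<times> (complex^'p^'p) \<Rightarrow> complex) \<Rightarrow> bool" where
  "biinv_prod i0 j0 g \<longleftrightarrow>
     (\<forall>A\<in>unitary_group. \<forall>B\<in>unitary_group.
      \<forall>K1\<in>stab_group i0. \<forall>L1\<in>stab_group i0. \<forall>K2\<in>stab_group j0. \<forall>L2\<in>stab_group j0.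
        g (K1 ** A ** L1, K2 ** B ** L2) = g (A, B))"

definition jacobiP :: "real \<Rightarrow> real \<Rightarrow> nat \<Rightarrow> real \<Rightarrow> real" where
  "jacobiP a b k x = (\<Sum>s\<le>k. ((real k + a) gchoose (k - s)) * ((real k + b) gchoose s)
        * ((x - 1) / 2) ^ s * ((x + 1) / 2) ^ (k - s))"

definition jacobiR :: "real \<Rightarrow> real \<Rightarrow> nat \<Rightarrow> real \<Rightarrow> real" where
  "jacobiR a b k x = jacobiP a b k x / jacobiP a b k 1"

definition disc_poly :: "real \<Rightarrow> nat \<Rightarrow> nat \<Rightarrow> complex \<Rightarrow> complex" where
  "disc_poly a m n z =
     complex_of_real (cmod z ^ (if m \<ge> n then m - n else n - m))
     * cis ((real m - real n) * Arg z)
     * complex_of_real (jacobiR a (real (if m \<ge> n then m - n else n - m)) (min m n)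
                          (2 * cmod z ^ 2 - 1))"

end

theory Submission
  imports Defs "HOL-Probability.Probability"
begin

text \<open>Since \<open>(A\<^sup>* B) e \<cdot> e\<close> is the inner product of the first columns of \<open>B\<close> and \<open>A\<close>, and every unit
  vector is a first column, \<open>F\<close> is positive definite iff \<open>f(\<langle>\<xi>, \<xi>'\<rangle>, \<langle>\<eta>, \<eta>'\<rangle>)\<close> is a positive definite
  kernel on the product of the two unit spheres.  Each disc polynomial gives such a kernel: up to a
  positive factor it is the average over the unit vectors \<open>v\<close> of a product of powers of rank one
  kernels and of inner products of projections to the complement of \<open>v\<close>.  This settles one
  direction and shows that the disc polynomials are bounded by 1.

  Conversely, integrating a continuous positive definite kernel over the spheres gives a number
  \<open>\<ge> 0\<close>; applied to \<open>f\<close> times a conjugate disc polynomial this yields Fourier coefficients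
  \<open>c \<ge> 0\<close>.  Testing \<open>f\<close> minus a partial sum against the powers of
  \<open>(1 + Re z)(1 + Re w)/4\<close>, which are positive definite and concentrate at \<open>(1, 1)\<close>, bounds
  the partial sums of \<open>c\<close> by \<open>f(1, 1)\<close>.  Hence the series converges uniformly, and its sum is \<open>f\<close>
  because the disc polynomials span a dense subspace and the measure has full support.\<close>

section \<open>Unitary matrices\<close>

text \<open>Every spherical integral needed is forced by unitary invariance: a function that picks
  up a nontrivial character under a phase rotation integrates to 0, and an absolute moment of
  \<open>hip u v\<close> depends on \<open>u\<close> only through its norm. The second fact fixes
  the ratios of coordinate moments, and these ratios produce the denominators
  \<open>(a + s) choose s\<close> of the disc polynomials.

  The hard point of the converse is pointwise control at (1, 1), since integrals do not see a single
  point. The peak functions repair this because their powers are polynomials, hence finite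
  combinations of disc polynomials, and positive definiteness makes the coefficients nonnegative. A
  remainder of \<open>f\<close> has the coefficients of \<open>f\<close> outside a finite set and 0
  inside it, so integrating it against such a power gives a finite sum of nonnegative terms. Density
  makes the remainders small in mean square; continuity and full support turn this back into a
  pointwise statement.\<close>

definition hip :: "complex^'n \<Rightarrow> complex^'n \<Rightarrow> complex"
  where "hip x y = (\<Sum>i\<in>UNIV. cnj (x $ i) * y $ i)"

lemma hip_add_left: "hip (x + y) z = hip x z + hip y z"
  by (simp add: hip_def algebra_simps sum.distrib)

lemma hip_add_right: "hip x (y + z) = hip x y + hip x z"
  by (simp add: hip_def algebra_simps sum.distrib)

lemma hip_diff_left: "hip (x - y) z = hip x z - hip y z"
  by (simp add: hip_def algebra_simps sum_subtractf)

lemma hip_diff_right: "hip x (y - z) = hip x y - hip x z"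
  by (simp add: hip_def algebra_simps sum_subtractf)

lemma hip_scale_left: "hip (c *s x) y = cnj c * hip x y"
  by (simp add: hip_def sum_distrib_left mult_ac)

lemma hip_scale_right: "hip x (c *s y) = c * hip x y"
  by (simp add: hip_def sum_distrib_left mult_ac)

lemmas hip_linear = hip_add_left hip_add_right hip_diff_left hip_diff_right
  hip_scale_left hip_scale_right

lemma hip_commute: "hip y x = cnj (hip x y)"
  by (simp add: hip_def mult_ac)

lemma hip_axis_left [simp]: "hip (axis i 1) x = x $ i"
proof -
  have "hip (axis i 1) x = (\<Sum>j\<in>UNIV. if j = i then x $ j else 0)"
    unfolding hip_def by (intro sum.cong) (auto simp: axis_def)
  then show ?thesis by simp
qed

lemma hip_axis_right [simp]: "hip x (axis i 1) = cnj (x $ i)"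
  by (subst hip_commute) simp

lemma hip_self: "hip x x = complex_of_real ((norm x)\<^sup>2)"
proof -
  have "(norm x)\<^sup>2 = (\<Sum>i\<in>UNIV. (cmod (x $ i))\<^sup>2)"
    by (simp add: norm_vec_def L2_set_def sum_nonneg)
  then show ?thesis
    unfolding hip_def by (simp only: complex_norm_square of_real_sum mult.commute)
qed

lemma norm_sq_hip: "(norm x)\<^sup>2 = Re (hip x x)"
  by (simp add: hip_self)

lemma sum_cmod_sq: "(\<Sum>i\<in>UNIV. (cmod (x $ i))\<^sup>2) = (norm (x :: complex^'n))\<^sup>2"
  by (simp add: norm_vec_def L2_set_def sum_nonneg)

lemma continuous_on_hip [continuous_intros]:
  assumes "continuous_on S f" "continuous_on S g"
  shows "continuous_on S (\<lambda>x. hip (f x) (g x))"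
  unfolding hip_def by (intro continuous_intros assms)

text \<open>The reason for making \<open>hip\<close> conjugate-linear in its first argument: the
  inverse of a unitary matrix is its adjoint, so the group kernel becomes \<open>hip\<close> of
  columns in the same order.\<close>

lemma cadj_matrix_mult_nth: "(cadj A ** B) $ i $ j = hip (column i A) (column j B)"
  by (simp add: cadj_def matrix_matrix_mult_def hip_def column_def)

lemma hip_cadj: "hip (cadj A *v x) y = hip x (A *v y)"
proof -
  have "hip (cadj A *v x) y = (\<Sum>i\<in>UNIV. \<Sum>j\<in>UNIV. cnj (x $ j) * (A $ j $ i * y $ i))"
    by (simp add: hip_def matrix_vector_mult_def cadj_def sum_distrib_left sum_distrib_right mult_ac)
  also have "\<dots> = (\<Sum>j\<in>UNIV. \<Sum>i\<in>UNIV. cnj (x $ j) * (A $ j $ i * y $ i))"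
    by (rule sum.swap)
  also have "\<dots> = hip x (A *v y)"
    by (simp add: hip_def matrix_vector_mult_def sum_distrib_left)
  finally show ?thesis .
qed

lemma hip_unitary:
  assumes "A \<in> unitary_group"
  shows "hip (A *v x) (A *v y) = hip x y"
proof -
  have "hip (cadj A *v (A *v x)) y = hip (A *v x) (A *v y)"
    by (rule hip_cadj)
  moreover have "cadj A *v (A *v x) = x"
    using assms by (simp add: unitary_group_def matrix_vector_mul_assoc)
  ultimately show ?thesis by simp
qed

lemma norm_unitary:
  assumes "A \<in> unitary_group"
  shows "norm (A *v x) = norm (x :: complex^'n)"
proof -
  have "(norm (A *v x))\<^sup>2 = (norm x)\<^sup>2"
    by (simp only: norm_sq_hip hip_unitary[OF assms])
  then show ?thesis by simp
qed

lemma cadj_unitary: "A \<in> unitary_group \<Longrightarrow> cadj A \<in> unitary_group"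
proof -
  have "cadj (cadj A) = A" by (simp add: cadj_def vec_eq_iff)
  then show "A \<in> unitary_group \<Longrightarrow> cadj A \<in> unitary_group"
    by (simp add: unitary_group_def)
qed

lemma norm_column_unitary:
  assumes "A \<in> unitary_group"
  shows "norm (column i A) = 1"
proof -
  have "hip (column i A) (column i A) = 1"
    using assms by (simp add: cadj_matrix_mult_nth[symmetric] unitary_group_def mat_def)
  then show ?thesis by (simp add: hip_self of_real_eq_1_iff[symmetric] del: of_real_eq_1_iff)
      (metis norm_ge_zero of_real_1 of_real_eq_iff of_real_power power2_eq_1_iff abs_of_nonneg real_sqrt_abs real_sqrt_one)
qed

lemma unitary_scale:
  assumes "A \<in> unitary_group" "cmod c = 1"
  shows "(\<chi> i j. c * A $ i $ j) \<in> unitary_group"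
proof -
  have c: "c * cnj c = 1" "cnj c * c = 1"
    using assms(2) by (simp_all add: complex_norm_square[symmetric] mult.commute[of "cnj c"])
  have s: "(c * a) * (cnj c * b) = a * b" "(cnj c * a) * (c * b) = a * b" for a b
    using c by (metis mult.assoc mult.left_commute mult_1)+
  have "(\<chi> i j. c * A $ i $ j) ** cadj (\<chi> i j. c * A $ i $ j) = A ** cadj A"
    "cadj (\<chi> i j. c * A $ i $ j) ** (\<chi> i j. c * A $ i $ j) = cadj A ** A"
    by (simp_all add: matrix_matrix_mult_def cadj_def vec_eq_iff s)
  then show ?thesis using assms(1) by (simp add: unitary_group_def)
qed

text \<open>The matrices \<open>I + t d d\<^sup>*\<close> cover Householder reflections as well as rotations of the
  phase of a single component.\<close>

definition rank1_pert :: "complex \<Rightarrow> complex^'n \<Rightarrow> complex^'n^'n"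
  where "rank1_pert t d = (\<chi> i j. (if i = j then 1 else 0) + t * (d $ i * cnj (d $ j)))"

lemma rank1_pert_mult: "rank1_pert t d *v x = x + (t * hip d x) *s d"
proof -
  have "(rank1_pert t d *v x) $ i = (x + (t * hip d x) *s d) $ i" for i
  proof -
    have "(rank1_pert t d *v x) $ i =
      (\<Sum>j\<in>UNIV. (if i = j then x $ j else 0) + t * d $ i * (cnj (d $ j) * x $ j))"
      unfolding matrix_vector_mult_def rank1_pert_def
      by (auto intro!: sum.cong simp: algebra_simps)
    also have "\<dots> = x $ i + t * d $ i * hip d x"
      by (simp add: sum.distrib sum_distrib_left hip_def)
    finally show ?thesis by (simp add: mult_ac)
  qed
  then show ?thesis by (simp add: vec_eq_iff)
qed

text \<open>The factors with parameters \<open>s\<close> and \<open>r\<close> multiply to the one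
  with parameter \<open>r + s + r * s * hip d d\<close>, and the adjoint conjugates the parameter.
  The hypothesis makes this parameter 0 in both orders.\<close>

lemma rank1_pert_unitary:
  assumes "t + cnj t + t * cnj t * hip d d = 0"
  shows "rank1_pert t d \<in> unitary_group"
proof -
  have adj: "cadj (rank1_pert t d) = rank1_pert (cnj t) d"
    by (auto simp: cadj_def rank1_pert_def vec_eq_iff mult_ac)
  have *: "rank1_pert s d ** rank1_pert r d = mat 1" if "r + s + r * s * hip d d = 0" for r s
  proof -
    have "(rank1_pert s d ** rank1_pert r d) *v x = mat 1 *v x" for x
    proof -
      have "(rank1_pert s d ** rank1_pert r d) *v x
        = x + ((r + s + r * s * hip d d) * hip d x) *s d"
        by (simp add: matrix_vector_mul_assoc[symmetric] rank1_pert_mult hip_linear vec_eq_iff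
            algebra_simps)
      then show ?thesis using that by simp
    qed
    then show ?thesis by (simp add: matrix_eq)
  qed
  show ?thesis
    using *[of t "cnj t"] *[of "cnj t" t] assms
    by (simp add: unitary_group_def adj mult.commute add.commute)
qed

text \<open>Householder reflection in \<open>d = u - c *s w\<close>. Over the complex numbers it
  exchanges the two vectors only if their inner product is real, which the phase \<open>c\<close>
  arranges. The phase stays in the conclusion so that the vectors orthogonal to \<open>u\<close> and
  \<open>w\<close> remain fixed, as \<open>integral_hip_power\<close> requires.\<close>

lemma unitary_move:
  fixes u w :: "complex^'n"
  assumes "norm u = norm w"
  obtains A c where "A \<in> unitary_group" "cmod c = 1" "A *v u = c *s w"
    "\<And>x. hip u x = 0 \<Longrightarrow> hip w x = 0 \<Longrightarrow> A *v x = x"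
proof -
  obtain c where c: "cmod c = 1" and re: "hip u (c *s w) \<in> \<real>"
  proof (cases "hip u w = 0")
    case True
    then show ?thesis using that[of 1] by (simp add: hip_linear)
  next
    case False
    have "hip u ((cnj (hip u w) / cmod (hip u w)) *s w) = cmod (hip u w)"
    proof -
      have "cnj (hip u w) * hip u w = cmod (hip u w) * complex_of_real (cmod (hip u w))"
        by (metis complex_norm_square mult.commute of_real_mult power2_eq_square)
      then show ?thesis using False by (simp add: hip_linear)
    qed
    then show ?thesis using False that[of "cnj (hip u w) / cmod (hip u w)"]
      by (simp add: norm_divide)
  qed
  define d where "d = u - c *s w"
  have cc: "cnj c * c = 1" using c by (simp add: complex_norm_square[symmetric] mult.commute[of "cnj c"])
  have sym: "hip (c *s w) u = hip u (c *s w)"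
    using re by (metis hip_commute Reals_cnj_iff)
  have ww: "hip (c *s w) (c *s w) = hip u u"
  proof -
    have "hip (c *s w) (c *s w) = (cnj c * c) * hip w w"
      by (simp add: hip_scale_left hip_scale_right)
    then show ?thesis by (simp add: cc hip_self assms)
  qed
  \<comment> \<open>By equal norms and the real inner product; hence
    \<open>t = - 2 / hip d d\<close> moves \<open>u\<close> by exactly \<open>- d\<close>.\<close>
  have dd: "hip d d = 2 * hip d u"
    using sym ww unfolding d_def hip_diff_left hip_diff_right by simp
  show ?thesis
  proof (cases "d = 0")
    case True
    have "mat 1 \<in> (unitary_group :: (complex^'n^'n) set)"
    proof -
      have "cadj (mat 1) = (mat 1 :: complex^'n^'n)"
        by (auto simp: cadj_def mat_def vec_eq_iff)
      then show ?thesis by (simp add: unitary_group_def)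
    qed
    moreover have "mat 1 *v u = c *s w" using True by (simp add: d_def)
    ultimately show ?thesis using that[of "mat 1" c] c by simp
  next
    case False
    then have nz: "hip d d \<noteq> 0" by (simp add: hip_self)
    define t where "t = - 2 / hip d d"
    have tr: "cnj t = t" by (simp add: t_def hip_self)
    have "rank1_pert t d \<in> unitary_group"
    proof (rule rank1_pert_unitary)
      have "t * hip d d = - 2" using nz by (simp add: t_def)
      then show "t + cnj t + t * cnj t * hip d d = 0" by (simp add: tr mult.assoc)
    qed
    moreover have "rank1_pert t d *v u = c *s w"
    proof -
      have "t * hip d u = -1" using nz dd by (simp add: t_def field_simps)
      then show ?thesis by (simp add: rank1_pert_mult d_def)
    qed
    moreover have "rank1_pert t d *v x = x" if "hip u x = 0" "hip w x = 0" for x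
      using that by (simp add: rank1_pert_mult d_def hip_linear)
    ultimately show ?thesis using that[of "rank1_pert t d" c] c by blast
  qed
qed

text \<open>The phase left by \<open>unitary_move\<close> is removed by scaling the whole matrix, at
  the price of no longer fixing the vectors orthogonal to \<open>u\<close> and
  \<open>w\<close>.\<close>

lemma unitary_transitive:
  fixes u w :: "complex^'n"
  assumes "norm u = norm w"
  obtains A where "A \<in> unitary_group" "A *v u = w"
proof -
  obtain A c where A: "A \<in> unitary_group" "cmod c = 1" "A *v u = c *s w"
    using unitary_move[OF assms] by metis
  have "cnj c * c = 1" using A(2) by (simp add: complex_norm_square[symmetric] mult.commute[of "cnj c"])
  moreover have "(\<chi> i j. cnj c * A $ i $ j) *v u = cnj c *s (A *v u)"
    by (simp add: matrix_vector_mult_def vec_eq_iff sum_distrib_left mult.assoc)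
  ultimately have "(\<chi> i j. cnj c * A $ i $ j) *v u = w"
    by (simp add: A(3))
  then show ?thesis using that unitary_scale[of A "cnj c"] A by simp
qed

lemma unitary_column:
  fixes x :: "complex^'n"
  assumes "norm x = 1"
  obtains A where "A \<in> unitary_group" "column i A = x"
proof -
  obtain A where A: "A \<in> unitary_group" "A *v axis i 1 = x"
    using unitary_transitive[of "axis i 1" x] assms by (auto simp: norm_axis_1)
  have "(A *v axis i 1) $ k = column i A $ k" for k
  proof -
    have "(A *v axis i 1) $ k = (\<Sum>j\<in>UNIV. if j = i then A $ k $ j else 0)"
      unfolding matrix_vector_mult_def vec_lambda_beta
      by (rule sum.cong) (auto simp: axis_def)
    then show ?thesis by (simp add: column_def)
  qed
  then have "column i A = x" using A(2) by (simp add: vec_eq_iff)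
  then show ?thesis using that A by blast
qed

section \<open>Disc polynomials\<close>

text \<open>The disc polynomial for a natural parameter, as a polynomial in \<open>z\<close> and
  \<open>cnj z\<close>: continuity is evident without polar coordinates, and averaging over the
  sphere in \<open>zonal_axis\<close> yields precisely this form.\<close>

definition zpoly :: "nat \<Rightarrow> nat \<Rightarrow> nat \<Rightarrow> complex \<Rightarrow> complex" where
  "zpoly a m n z = (\<Sum>s\<le>min m n.
     complex_of_real ((-1) ^ s * real (m choose s) * real (n choose s) / real ((a + s) choose s))
       * (1 - z * cnj z) ^ s * z ^ (m - s) * cnj z ^ (n - s))"

text \<open>Effect of the normalisation on a Jacobi coefficient: \<open>(k + a) choose k\<close> is
  the value of the Jacobi polynomial at 1.\<close>

lemma choose_ratio:
  assumes "s \<le> k"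
  shows "real ((k + a) choose (k - s)) / real ((k + a) choose k)
       = real (k choose s) / real ((a + s) choose s)"
proof -
  have "k + a - (k - s) = a + s" using assms by simp
  then have 1: "real ((k + a) choose (k - s)) = fact (k + a) / (fact (k - s) * fact (a + s))"
    using binomial_fact[of "k - s" "k + a", where 'a = real] by simp
  have 2: "real ((k + a) choose k) = fact (k + a) / (fact k * fact a)"
    using binomial_fact[of k "k + a", where 'a = real] by simp
  have 3: "real (k choose s) = fact k / (fact s * fact (k - s))"
    using binomial_fact[OF assms, where 'a = real] by simp
  have 4: "real ((a + s) choose s) = fact (a + s) / (fact s * fact a)"
    using binomial_fact[of s "a + s", where 'a = real] by simp
  show ?thesis unfolding 1 2 3 4 by simp
qed

lemma jacobiR_nat:
  "jacobiR (real a) (real b) k x = (\<Sum>s\<le>k. real ((k + b) choose s) * real (k choose s)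
     / real ((a + s) choose s) * ((x - 1) / 2) ^ s * ((x + 1) / 2) ^ (k - s))"
proof -
  have P: "jacobiP (real a) (real b) k x = (\<Sum>s\<le>k. real ((k + a) choose (k - s))
      * real ((k + b) choose s) * ((x - 1) / 2) ^ s * ((x + 1) / 2) ^ (k - s))" for x
    by (simp add: jacobiP_def binomial_gbinomial)
  have "jacobiP (real a) (real b) k 1 = (\<Sum>s\<le>k. if s = 0 then real ((k + a) choose k) else 0)"
    unfolding P by (intro sum.cong) auto
  then have P1: "jacobiP (real a) (real b) k 1 = real ((k + a) choose k)"
    by simp
  show ?thesis
    unfolding jacobiR_def P1 unfolding P sum_divide_distrib
  proof (rule sum.cong)
    fix s assume "s \<in> {..k}"
    then have r: "real ((k + a) choose (k - s)) / real ((k + a) choose k)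
       = real (k choose s) / real ((a + s) choose s)"
      by (intro choose_ratio) simp
    have "real ((k + a) choose (k - s)) * real ((k + b) choose s) * ((x - 1) / 2) ^ s
        * ((x + 1) / 2) ^ (k - s) / real ((k + a) choose k)
      = real ((k + a) choose (k - s)) / real ((k + a) choose k)
        * (real ((k + b) choose s) * ((x - 1) / 2) ^ s * ((x + 1) / 2) ^ (k - s))"
      by simp
    then show "real ((k + a) choose (k - s)) * real ((k + b) choose s) * ((x - 1) / 2) ^ s
        * ((x + 1) / 2) ^ (k - s) / real ((k + a) choose k)
      = real ((k + b) choose s) * real (k choose s) / real ((a + s) choose s)
        * ((x - 1) / 2) ^ s * ((x + 1) / 2) ^ (k - s)"
      unfolding r by simp
  qed simp
qed

lemma cmod_power_cis_Arg:
  "complex_of_real (cmod z ^ (if m \<ge> n then m - n else n - m)) * cis ((real m - real n) * Arg z)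
   = z ^ (m - min m n) * cnj z ^ (n - min m n)"
proof -
  have pow: "complex_of_real (cmod z ^ k) * cis (real k * Arg z) = z ^ k" for k
  proof (cases "z = 0")
    case True
    then show ?thesis by (cases k) auto
  next
    case False
    have "z ^ k = rcis (cmod z) (Arg z) ^ k" by (simp only: rcis_cmod_Arg)
    then show ?thesis unfolding DeMoivre2 by (simp add: rcis_def)
  qed
  show ?thesis
  proof (cases "m \<ge> n")
    case True
    then show ?thesis using pow[of "m - n"] by (simp add: of_nat_diff)
  next
    case False
    have "cis ((real m - real n) * Arg z) = cnj (cis (real (n - m) * Arg z))"
      using False by (simp add: cis_cnj of_nat_diff algebra_simps)
    then have "complex_of_real (cmod z ^ (n - m)) * cis ((real m - real n) * Arg z)
      = cnj (complex_of_real (cmod z ^ (n - m)) * cis (real (n - m) * Arg z))"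
      by simp
    also have "\<dots> = cnj z ^ (n - m)" by (simp only: pow complex_cnj_power)
    finally show ?thesis using False by simp
  qed
qed

lemma disc_poly_eq_zpoly: "disc_poly (real a) m n z = zpoly a m n z"
proof -
  define k b where "k = min m n" and "b = (if m \<ge> n then m - n else n - m)"
  \<comment> \<open>\<open>k + b\<close> is the larger of \<open>m\<close> and \<open>n\<close>, and
    \<open>k\<close> the smaller, so one formula covers both cases of the definition.\<close>
  have sym: "real ((k + b) choose s) * real (k choose s) = real (m choose s) * real (n choose s)" for s
    by (auto simp: k_def b_def)
  have J: "complex_of_real (jacobiR (real a) (real b) k (2 * cmod z ^ 2 - 1))
    = (\<Sum>s\<le>k. complex_of_real ((-1) ^ s * real (m choose s) * real (n choose s) / real ((a + s) choose s))
       * (1 - z * cnj z) ^ s * (z * cnj z) ^ (k - s))"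
  proof -
    have x: "(2 * cmod z ^ 2 - 1 - 1) / 2 = - (1 - cmod z ^ 2)" "(2 * cmod z ^ 2 - 1 + 1) / 2 = cmod z ^ 2"
      by simp_all
    have zz: "complex_of_real (cmod z ^ 2) = z * cnj z" by (rule complex_norm_square)
    show ?thesis
      unfolding jacobiR_nat x sym of_real_sum
    proof (rule sum.cong)
      fix s
      show "complex_of_real (real (m choose s) * real (n choose s) / real ((a + s) choose s)
          * (- (1 - cmod z ^ 2)) ^ s * (cmod z ^ 2) ^ (k - s))
        = complex_of_real ((-1) ^ s * real (m choose s) * real (n choose s) / real ((a + s) choose s))
          * (1 - z * cnj z) ^ s * (z * cnj z) ^ (k - s)"
      proof -
        have 1: "(- (1 - cmod z ^ 2)) ^ s = (-1) ^ s * (1 - cmod z ^ 2) ^ s" by (rule power_minus)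
        have 2: "complex_of_real ((1 - cmod z ^ 2) ^ s) = (1 - z * cnj z) ^ s"
          unfolding zz[symmetric] by simp
        have 3: "complex_of_real ((cmod z ^ 2) ^ (k - s)) = (z * cnj z) ^ (k - s)"
          unfolding zz[symmetric] by simp
        show ?thesis unfolding 1 2[symmetric] 3[symmetric] of_real_mult[symmetric]
          by (simp only: mult_ac times_divide_eq_right times_divide_eq_left)
      qed
    qed simp
  qed
  have "z ^ (m - k) * cnj z ^ (n - k) * (z * cnj z) ^ (k - s) = z ^ (m - s) * cnj z ^ (n - s)"
    if "s \<le> k" for s
  proof -
    have 1: "m - s = (m - k) + (k - s)" and 2: "n - s = (n - k) + (k - s)"
      using that by (auto simp: k_def)
    show ?thesis unfolding 1 2 power_add power_mult_distrib by (simp only: mult_ac)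
  qed
  note eq = this
  have "disc_poly (real a) m n z
    = z ^ (m - k) * cnj z ^ (n - k) * complex_of_real (jacobiR (real a) (real b) k (2 * cmod z ^ 2 - 1))"
    unfolding disc_poly_def cmod_power_cis_Arg by (simp only: k_def b_def)
  also have "\<dots> = zpoly a m n z"
    unfolding J zpoly_def sum_distrib_left k_def[symmetric]
  proof (rule sum.cong, rule refl)
    fix s assume "s \<in> {..k}"
    then have "z ^ (m - s) * cnj z ^ (n - s) = z ^ (m - k) * cnj z ^ (n - k) * (z * cnj z) ^ (k - s)"
      using eq[of s] by simp
    then show "z ^ (m - k) * cnj z ^ (n - k) * (complex_of_real ((-1) ^ s * real (m choose s)
        * real (n choose s) / real ((a + s) choose s)) * (1 - z * cnj z) ^ s * (z * cnj z) ^ (k - s))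
      = complex_of_real ((-1) ^ s * real (m choose s) * real (n choose s) / real ((a + s) choose s))
        * (1 - z * cnj z) ^ s * z ^ (m - s) * cnj z ^ (n - s)"
      unfolding mult.assoc[of _ "z ^ (m - s)"] by (simp only: mult_ac)
  qed
  finally show ?thesis .
qed

lemma zpoly_cnj: "zpoly a m n (cnj z) = cnj (zpoly a m n z)"
  unfolding zpoly_def cnj_sum complex_cnj_mult complex_cnj_power complex_cnj_diff
    complex_cnj_one complex_cnj_cnj complex_cnj_complex_of_real ..

lemma cnj_zpoly: "cnj (zpoly a m n z) = zpoly a n m z"
  unfolding zpoly_def cnj_sum complex_cnj_mult complex_cnj_power complex_cnj_diff
    complex_cnj_one complex_cnj_cnj complex_cnj_complex_of_real min.commute[of n m]
  by (simp only: mult_ac)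

lemma zpoly_1 [simp]: "zpoly a m n 1 = 1"
proof -
  have "zpoly a m n 1 = (\<Sum>s\<le>min m n. if s = 0 then 1 else 0)"
    unfolding zpoly_def by (intro sum.cong) auto
  then show ?thesis by simp
qed

lemma continuous_on_zpoly [continuous_intros]:
  "continuous_on S f \<Longrightarrow> continuous_on S (\<lambda>x. zpoly a m n (f x))"
  unfolding zpoly_def by (intro continuous_intros)

section \<open>Unitarily invariant measure on the sphere\<close>

text \<open>The measure lives on the whole space and is only concentrated on \<open>C\<close>, so
  continuous functions on \<open>UNIV\<close> are integrable without any subspace sigma-algebra. The
  locale is instantiated with a sphere, products of spheres and the closed bidisc.\<close>

locale supported_prob = prob_space M for M :: "'a::euclidean_space measure" +
  fixes C :: "'a set"
  assumes sets_M [measurable_cong, simp]: "sets M = sets borel"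
    and compact_C: "compact C"
    and AE_C: "AE x in M. x \<in> C"
    and full_support: "open W \<Longrightarrow> x \<in> W \<Longrightarrow> x \<in> C \<Longrightarrow> measure M W > 0"
begin

lemma space_M [simp]: "space M = UNIV"
  using sets_eq_imp_space_eq[OF sets_M] by simp

lemma measurable_continuous:
  "continuous_on UNIV (g :: 'a \<Rightarrow> 'b::topological_space) \<Longrightarrow> g \<in> borel_measurable M"
  by (simp add: measurable_cong_sets[OF sets_M refl] borel_measurable_continuous_onI)

lemma integrable_continuous:
  fixes g :: "'a \<Rightarrow> 'b::{banach, second_countable_topology}"
  assumes "continuous_on UNIV g"
  shows "integrable M g"
proof -
  have "bounded (g ` C)"
    using assms compact_C by (intro compact_imp_bounded compact_continuous_image)
      (auto intro: continuous_on_subset)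
  then obtain B where "\<And>x. x \<in> C \<Longrightarrow> norm (g x) \<le> B" by (auto simp: bounded_iff)
  then have "AE x in M. norm (g x) \<le> B" using AE_C by auto
  then show ?thesis
    by (rule integrable_const_bound) (rule measurable_continuous[OF assms])
qed

lemma integral_cong_C:
  fixes g h :: "'a \<Rightarrow> 'b::{banach, second_countable_topology}"
  assumes "continuous_on UNIV g" "continuous_on UNIV h" "\<And>x. x \<in> C \<Longrightarrow> g x = h x"
  shows "integral\<^sup>L M g = integral\<^sup>L M h"
  using AE_C assms by (intro integral_cong_AE measurable_continuous) auto

lemma norm_integral_le:
  fixes g :: "'a \<Rightarrow> 'b::{banach, second_countable_topology}"
  assumes "continuous_on UNIV g" "\<And>x. x \<in> C \<Longrightarrow> norm (g x) \<le> B"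
  shows "norm (integral\<^sup>L M g) \<le> B"
proof -
  have "norm (integral\<^sup>L M g) \<le> (\<integral>x. norm (g x) \<partial>M)" by (rule integral_norm_bound)
  also have "\<dots> \<le> (\<integral>x. B \<partial>M)"
    using AE_C assms by (intro integral_mono_AE integrable_continuous continuous_intros) auto
  finally show ?thesis by (simp add: prob_space[unfolded space_M])
qed

lemma integral_pos:
  fixes h :: "'a \<Rightarrow> real"
  assumes h: "continuous_on UNIV h" "\<And>x. x \<in> C \<Longrightarrow> 0 \<le> h x" and x: "x \<in> C" "0 < h x"
  shows "0 < integral\<^sup>L M h"
proof -
  have nn: "AE x in M. 0 \<le> h x" using AE_C h(2) by auto
  have "integral\<^sup>L M h \<noteq> 0"
  proof
    assume "integral\<^sup>L M h = 0"
    then have "AE x in M. h x = 0"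
      using integral_nonneg_eq_0_iff_AE[OF integrable_continuous[OF h(1)] nn] by simp
    then have 0: "AE x in M. x \<notin> {x. 0 < h x}" by auto
    have op: "open {x. 0 < h x}" using h(1) by (intro open_Collect_less continuous_intros)
    then have "{x. 0 < h x} \<in> sets M" by simp
    then have "measure M {x. 0 < h x} = 0"
      using 0 by (subst (asm) AE_iff_measurable[of "{x. 0 < h x}"]) (auto simp: measure_def)
    then show False using full_support[OF op, of x] x by simp
  qed
  then show ?thesis using integral_nonneg_AE[OF nn] by simp
qed

end

lemma supported_prob_pair:
  assumes "supported_prob M C" "supported_prob N D"
  shows "supported_prob (M \<Otimes>\<^sub>M N) (C \<times> D)"
proof -
  interpret M: supported_prob M C by fact
  interpret N: supported_prob N D by fact
  interpret P: pair_prob_space M N ..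
  have CD: "C \<in> sets M" "D \<in> sets N"
    using M.compact_C N.compact_C by (auto intro: borel_compact)
  have "emeasure (M \<Otimes>\<^sub>M N) (C \<times> D) = 1"
    using CD M.AE_C N.AE_C
    by (simp add: N.emeasure_pair_measure_Times M.emeasure_eq_measure N.emeasure_eq_measure
        M.AE_in_set_eq_1 N.AE_in_set_eq_1)
  then have "AE x in M \<Otimes>\<^sub>M N. x \<in> C \<times> D"
    using CD by (subst P.AE_in_set_eq_1) (auto simp: P.emeasure_eq_measure)
  moreover have "sets (M \<Otimes>\<^sub>M N) = sets borel"
    unfolding borel_prod[symmetric] by (intro sets_pair_measure_cong) simp_all
  moreover have "measure (M \<Otimes>\<^sub>M N) W > 0" if W: "open W" "x \<in> W" "x \<in> C \<times> D" for W x
  proof -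
    obtain A B where AB: "open A" "open B" "x \<in> A \<times> B" "A \<times> B \<subseteq> W"
      using open_prod_elim[OF W(1,2)] by metis
    have "0 < measure M A * measure N B"
      using M.full_support[OF AB(1), of "fst x"] N.full_support[OF AB(2), of "snd x"] AB W by auto
    also have "\<dots> = measure (M \<Otimes>\<^sub>M N) (A \<times> B)"
      using AB by (simp add: measure_def N.emeasure_pair_measure_Times enn2real_mult)
    also have "\<dots> \<le> measure (M \<Otimes>\<^sub>M N) W"
      using AB W \<open>sets (M \<Otimes>\<^sub>M N) = sets borel\<close> by (intro P.finite_measure_mono) auto
    finally show ?thesis .
  qed
  ultimately show ?thesis
    by unfold_locales (auto intro: compact_Times M.compact_C N.compact_C)
qed

locale unitary_measure = supported_prob \<sigma> "sphere 0 1" for \<sigma> :: "(complex^'n) measure" +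
  assumes unitary_invariant: "A \<in> unitary_group \<Longrightarrow> distr \<sigma> borel (\<lambda>x. A *v x) = \<sigma>"

lemma linear_matrix_vector_mult_complex: "linear (\<lambda>x. (A :: complex^'n^'m) *v x)"
  by (intro linearI)
    (simp_all add: matrix_vector_mult_def vec_eq_iff algebra_simps sum.distrib scaleR_sum_right)

lemma continuous_on_matrix_vector_mult_complex [continuous_intros]:
  "continuous_on S g \<Longrightarrow> continuous_on S (\<lambda>x. (A :: complex^'n^'m) *v g x)"
  by (rule bounded_linear.continuous_on[OF linear_matrix_vector_mult_complex[unfolded
      linear_conv_bounded_linear]])

text \<open>Radial projection of Lebesgue measure on the unit ball of \<open>\<real>\<^bsup>2n\<^esup>\<close>.  The index type \<open>'n bit0\<close>
  has \<open>2n\<close> elements and is well-ordered, which the library needs for the invariance of Lebesgue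
  measure under orthogonal maps.\<close>

lemma unitary_measure_exists: "\<exists>\<sigma> :: (complex^'n) measure. unitary_measure \<sigma>"
proof -
  obtain f :: "real^('n bit0) \<Rightarrow> complex^'n" and g where fg: "linear f" "linear g"
    "\<And>x. norm (f x) = norm x" "\<And>y. norm (g y) = norm y" "\<And>x. g (f x) = x" "\<And>y. f (g y) = y"
    by (rule isometries_subspaces[of "UNIV :: (real^('n bit0)) set" "UNIV :: (complex^'n) set"])
      (auto simp: dim_UNIV)
  define B where "B = ball (0 :: real^('n bit0)) 1"
  \<comment> \<open>\<open>s 0 = 0\<close> by division by zero; the origin is a null set, so almost
    all values lie on the sphere.\<close>
  define s where "s x = f x /\<^sub>R norm x" for x
  define \<sigma> where "\<sigma> = distr (uniform_measure lborel B) borel s"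
  have contf: "continuous_on S f" for S
    using fg(1) by (simp add: linear_continuous_on linear_linear)
  have contg: "continuous_on S g" for S
    using fg(2) by (simp add: linear_continuous_on linear_linear)
  have [measurable]: "f \<in> borel_measurable borel"
    using contf by (rule borel_measurable_continuous_onI)
  have s_meas [measurable]: "s \<in> borel_measurable borel" unfolding s_def by measurable
  have B [measurable]: "B \<in> sets borel" by (simp add: B_def)
  have Bfin: "emeasure lborel B \<noteq> \<infinity>"
    using emeasure_bounded_finite[of B] by (simp add: B_def)
  have pos: "emeasure lborel W \<noteq> 0" if "open W" "W \<noteq> {}" for W :: "(real^('n bit0)) set"
  proof
    assume "emeasure lborel W = 0"
    then have "W \<in> null_sets lebesgue"
      using that by (intro null_sets_completionI) auto
    then show False using open_not_negligible[OF that] by (simp add: negligible_iff_null_sets)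
  qed
  have Bpos: "emeasure lborel B \<noteq> 0" by (rule pos) (auto simp: B_def)
  interpret U: prob_space "uniform_measure lborel B"
    by (rule prob_space_uniform_measure[OF Bpos Bfin])
  interpret \<sigma>: prob_space \<sigma> unfolding \<sigma>_def by (rule U.prob_space_distr) simp
  have em: "emeasure \<sigma> X = emeasure lborel (B \<inter> s -` X) / emeasure lborel B"
    if "X \<in> sets borel" for X
    using that measurable_sets[OF s_meas that] unfolding \<sigma>_def by (simp add: emeasure_distr)
  have "supported_prob \<sigma> (sphere 0 1)"
  proof
    show "sets \<sigma> = sets borel" by (simp add: \<sigma>_def)
    have "norm (s x) = 1" if "x \<noteq> 0" for x using that by (simp add: s_def fg)
    then have "AE x in uniform_measure lborel B. s x \<in> sphere 0 1"
      using AE_lborel_singleton[of "0 :: real^('n bit0)"]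
      by (intro AE_uniform_measureI) (auto simp: B)
    then show "AE x in \<sigma>. x \<in> sphere 0 1"
      unfolding \<sigma>_def by (subst AE_distr_iff) auto
    fix W :: "(complex^'n) set" and x assume "open W" "x \<in> W" "x \<in> sphere 0 1"
    then have W: "open W" "x \<in> W" "norm x = 1" by auto
    define V where "V = {y \<in> B - {0}. s y \<in> W}"
    have "continuous_on (B - {0}) s" unfolding s_def by (intro continuous_intros contf) auto
    then have "open V"
      unfolding V_def using W(1) continuous_open_preimage[of "B - {0}" s W]
      by (simp add: B_def open_Diff vimage_def Int_def conj_commute)
    \<comment> \<open>A point of the open ball in the direction of \<open>x\<close>, away from the
      origin; it shows that \<open>V\<close> is nonempty.\<close>
    moreover have "g x /\<^sub>R 2 \<in> V"
    proof -
      have "f (g x /\<^sub>R 2) = x /\<^sub>R 2" using fg by (simp add: linear_scale)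
      then have "s (g x /\<^sub>R 2) = x" using W(3) fg by (simp add: s_def)
      moreover have "g x \<noteq> 0" using W(3) fg(4)[of x] by auto
      ultimately show ?thesis using W fg(4)[of x] by (auto simp: V_def B_def)
    qed
    ultimately have "emeasure lborel V \<noteq> 0" using pos[of V] by auto
    moreover have "emeasure lborel V \<le> emeasure lborel (B \<inter> s -` W)"
      using measurable_sets[OF s_meas borel_open[OF W(1)]] by (intro emeasure_mono) (auto simp: V_def)
    ultimately have "emeasure lborel (B \<inter> s -` W) \<noteq> 0" by auto
    then have "emeasure \<sigma> W \<noteq> 0"
      using W(1) Bfin by (simp add: em ennreal_divide_eq_0_iff)
    then show "measure \<sigma> W > 0"
      by (simp add: \<sigma>.emeasure_eq_measure zero_less_measure_iff)
  qed simp
  then interpret \<sigma>: supported_prob \<sigma> "sphere 0 1" .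
  have "unitary_measure \<sigma>"
  proof
    fix A :: "complex^'n^'n" assume A: "A \<in> unitary_group"
    have [measurable]: "(\<lambda>x. A *v x) \<in> borel_measurable borel"
      by (intro borel_measurable_continuous_onI continuous_intros)
    \<comment> \<open>\<open>T\<close> and \<open>T'\<close> are mutually inverse real forms of
      \<open>A\<close> and its adjoint. Since \<open>s\<close> intertwines \<open>T\<close> with
      \<open>A\<close>, a preimage under \<open>A\<close> corresponds to an image under the
      orthogonal map \<open>T'\<close>, whose Lebesgue measure is known.\<close>
    define T where "T x = g (A *v f x)" for x
    define T' where "T' x = g (cadj A *v f x)" for x
    have linT': "linear T'"
      unfolding T'_def using linear_compose[OF linear_compose[OF fg(1)
        linear_matrix_vector_mult_complex[of "cadj A"]] fg(2)] by (simp add: o_def)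
    have orth: "orthogonal_transformation T'"
      unfolding orthogonal_transformation using linT'
      by (simp add: T'_def fg norm_unitary[OF cadj_unitary[OF A]])
    have inv: "T (T' x) = x" "T' (T x) = x" for x
      using A by (simp_all add: T_def T'_def fg matrix_vector_mul_assoc unitary_group_def)
    have normT: "norm (T x) = norm x" for x by (simp add: T_def fg norm_unitary[OF A])
    have sT: "s (T x) = A *v s x" for x
      by (simp add: s_def normT) (simp add: T_def fg linear_scale[OF linear_matrix_vector_mult_complex])
    have "emeasure (distr \<sigma> borel (\<lambda>x. A *v x)) X = emeasure \<sigma> X" if X: "X \<in> sets borel" for X
    proof -
      define Z where "Z = B \<inter> s -` X"
      have Z: "Z \<in> sets borel"
        unfolding Z_def using measurable_sets[OF s_meas X] by simp
      have bZ: "bounded Z" unfolding Z_def B_def by (rule bounded_subset[OF bounded_ball]) auto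
      have im: "B \<inter> s -` ((\<lambda>x. A *v x) -` X) = T' ` Z"
      proof
        show "B \<inter> s -` ((\<lambda>x. A *v x) -` X) \<subseteq> T' ` Z"
        proof
          fix x assume "x \<in> B \<inter> s -` ((\<lambda>x. A *v x) -` X)"
          then have "T x \<in> Z" by (simp add: Z_def B_def sT normT)
          then show "x \<in> T' ` Z" using inv(2) by (metis imageI)
        qed
        show "T' ` Z \<subseteq> B \<inter> s -` ((\<lambda>x. A *v x) -` X)"
        proof
          fix x assume "x \<in> T' ` Z"
          then obtain y where "y \<in> Z" "x = T' y" by auto
          then show "x \<in> B \<inter> s -` ((\<lambda>x. A *v x) -` X)"
            using sT[of x] normT[of x] inv(1)[of y] by (simp add: Z_def B_def)
        qed
      qed
      have XA: "(\<lambda>x. A *v x) -` X \<in> sets borel"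
        using X by (metis Int_UNIV_right \<open>(\<lambda>x. A *v x) \<in> borel_measurable borel\<close> measurable_sets space_borel)
      have TZ: "T' ` Z \<in> sets borel"
        unfolding im[symmetric] using measurable_sets[OF s_meas XA] by simp
      have lm: "Z \<in> lmeasurable"
        using Z bZ by (intro bounded_set_imp_lmeasurable) auto
      have "emeasure lborel (T' ` Z) = emeasure lebesgue (T' ` Z)" using TZ by simp
      also have "\<dots> = measure lebesgue (T' ` Z)"
        using measurable_orthogonal_image[OF orth lm] by (simp add: emeasure_eq_measure2)
      also have "\<dots> = measure lebesgue Z" by (simp add: measure_orthogonal_image[OF orth lm])
      also have "\<dots> = emeasure lebesgue Z" using lm by (simp add: emeasure_eq_measure2)
      also have "\<dots> = emeasure lborel Z" using Z by simp
      finally have "emeasure \<sigma> ((\<lambda>x. A *v x) -` X) = emeasure \<sigma> X"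
        unfolding em[OF XA] em[OF X] im Z_def[symmetric] by simp
      then show ?thesis using X by (simp add: emeasure_distr)
    qed
    then show "distr \<sigma> borel (\<lambda>x. A *v x) = \<sigma>"
      by (intro measure_eqI) simp_all
  qed
  then show ?thesis by blast
qed

lemma of_real_cmod_square: "(complex_of_real (cmod w))\<^sup>2 = w * cnj w"
  by (metis complex_norm_square of_real_power)

text \<open>The angle \<open>pi / (a - b)\<close> gives the character the value -1.\<close>

lemma cis_separates:
  assumes "a \<noteq> b"
  obtains c where "cmod c = 1" "c ^ a * cnj c ^ b \<noteq> 1"
proof -
  define \<theta> where "\<theta> = pi / (real a - real b)"
  have "cis \<theta> ^ a = cis (real a * \<theta>)" "cis (- \<theta>) ^ b = cis (real b * (- \<theta>))"
    by (rule Complex.DeMoivre)+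
  then have "cis \<theta> ^ a * cnj (cis \<theta>) ^ b = cis (real a * \<theta> - real b * \<theta>)"
    by (simp add: cis_cnj cis_mult)
  also have "real a * \<theta> - real b * \<theta> = pi"
    using assms by (simp add: \<theta>_def flip: left_diff_distrib diff_divide_distrib)
  finally have "cis \<theta> ^ a * cnj (cis \<theta>) ^ b \<noteq> 1" by simp
  then show ?thesis using that[of "cis \<theta>"] by simp
qed

lemma obtain_other_index:
  fixes i :: "'n::finite"
  assumes "CARD('n) \<ge> 2"
  obtains k where "i \<noteq> k"
proof -
  have "UNIV \<noteq> {i}"
  proof
    assume "UNIV = {i}"
    then have "CARD('n) = card {i}" by simp
    then show False using assms by simp
  qed
  then obtain k where "k \<noteq> i" by auto
  then show ?thesis using that[of k] by simp
qed

text \<open>For a unit vector \<open>v\<close> and a phase \<open>c\<close>, the unitary map that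
  multiplies the component along \<open>v\<close> by \<open>c\<close> and fixes the orthogonal
  complement.\<close>

definition rot :: "complex \<Rightarrow> complex^'n \<Rightarrow> complex^'n^'n"
  where "rot c v = rank1_pert (c - 1) v"

lemma rot_unitary:
  assumes "norm v = 1" "cmod c = 1"
  shows "rot c v \<in> unitary_group"
proof -
  have "c * cnj c = 1" using assms(2) complex_norm_square[of c] by simp
  then show ?thesis
    unfolding rot_def by (intro rank1_pert_unitary) (simp add: hip_self assms algebra_simps)
qed

lemma hip_rot: "hip x (rot c v *v y) = hip x y + (c - 1) * hip x v * hip v y"
  by (simp add: rot_def rank1_pert_mult hip_linear)

lemma rot_axis_nth: "(rot c (axis l 1) *v x) $ j = (if j = l then c * x $ l else x $ j)"
  by (simp add: rot_def rank1_pert_mult) (simp add: axis_def algebra_simps)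

section \<open>Spherical integrals determined by invariance\<close>

context unitary_measure
begin

lemma integral_unitary:
  fixes h :: "complex^'n \<Rightarrow> 'b::{banach, second_countable_topology}"
  assumes "A \<in> unitary_group" "continuous_on UNIV h"
  shows "(\<integral>x. h (A *v x) \<partial>\<sigma>) = integral\<^sup>L \<sigma> h"
proof -
  have "(\<lambda>x. A *v x) \<in> measurable \<sigma> borel"
    by (intro measurable_continuous continuous_intros)
  then have "integral\<^sup>L (distr \<sigma> borel (\<lambda>x. A *v x)) h = (\<integral>x. h (A *v x) \<partial>\<sigma>)"
    using assms(2) by (intro integral_distr borel_measurable_continuous_onI)
  then show ?thesis by (simp add: unitary_invariant[OF assms(1)])
qed

text \<open>Invariance under the rotation equates the integral with \<open>c ^ a * cnj c ^ b\<close>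
  times itself, and some phase makes this factor different from 1.\<close>

lemma integral_rot_zero:
  fixes h :: "complex^'n \<Rightarrow> complex"
  assumes "continuous_on UNIV h" "norm v = 1" "a \<noteq> b"
    and "\<And>c x. cmod c = 1 \<Longrightarrow> h (rot c v *v x) = c ^ a * cnj c ^ b * h x"
  shows "integral\<^sup>L \<sigma> h = 0"
proof -
  obtain c where c: "cmod c = 1" "c ^ a * cnj c ^ b \<noteq> 1" by (rule cis_separates[OF assms(3)])
  have "integral\<^sup>L \<sigma> h = (\<integral>x. h (rot c v *v x) \<partial>\<sigma>)"
    by (rule integral_unitary[symmetric, OF rot_unitary[OF assms(2) c(1)] assms(1)])
  also have "\<dots> = c ^ a * cnj c ^ b * integral\<^sup>L \<sigma> h"
    by (simp add: assms(4)[OF c(1)])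
  finally show ?thesis using c(2) by simp
qed

text \<open>Both \<open>u\<close> and \<open>axis k 1\<close> are orthogonal to
  \<open>axis i 1\<close>, so \<open>unitary_move\<close> carries \<open>u\<close> to a multiple of
  \<open>axis k 1\<close> by a map fixing \<open>axis i 1\<close>. The weight is unchanged and the
  phase disappears in the modulus.\<close>

lemma integral_hip_power:
  fixes \<phi> :: "complex \<Rightarrow> real" and u :: "complex^'n"
  assumes \<phi>: "continuous_on UNIV \<phi>" and "i \<noteq> k" "u $ i = 0"
  shows "(\<integral>v. \<phi> (v $ i) * cmod (hip u v) ^ N \<partial>\<sigma>)
    = norm u ^ N * (\<integral>v. \<phi> (v $ i) * cmod (v $ k) ^ N \<partial>\<sigma>)"
proof -
  define w :: "complex^'n" where "w = complex_of_real (norm u) *s axis k 1"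
  have ww: "hip w v = complex_of_real (norm u) * v $ k" for v
    by (simp add: w_def hip_linear)
  have "(norm w)\<^sup>2 = (norm u)\<^sup>2"
    by (simp add: norm_sq_hip ww) (simp add: w_def hip_self power2_eq_square)
  then have "norm u = norm w" by simp
  then obtain A c where A: "A \<in> unitary_group" "cmod c = 1" "A *v u = c *s w"
    "\<And>x. hip u x = 0 \<Longrightarrow> hip w x = 0 \<Longrightarrow> A *v x = x"
    using unitary_move by metis
  have "hip u (axis i 1) = 0" using assms by simp
  moreover have "hip w (axis i 1) = 0" using assms unfolding ww by (simp add: axis_def)
  ultimately have Ai: "A *v axis i 1 = axis i 1" by (rule A(4))
  have cont: "continuous_on UNIV (\<lambda>v :: complex^'n. \<phi> (v $ i))"
    by (rule continuous_on_compose2[OF \<phi>]) (auto intro: continuous_intros)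
  have "(A *v v) $ i = v $ i" for v
    using hip_unitary[OF A(1), of "axis i 1" v] by (simp add: Ai)
  moreover have "hip (c *s w) (A *v v) = hip u v" for v
    using hip_unitary[OF A(1), of u v] by (simp add: A(3))
  ultimately have "(\<integral>v. \<phi> (v $ i) * cmod (hip u v) ^ N \<partial>\<sigma>)
    = (\<integral>v. \<phi> ((A *v v) $ i) * cmod (hip (c *s w) (A *v v)) ^ N \<partial>\<sigma>)"
    by simp
  also have "\<dots> = (\<integral>v. \<phi> (v $ i) * cmod (hip (c *s w) v) ^ N \<partial>\<sigma>)"
    by (rule integral_unitary[OF A(1)]) (intro continuous_intros cont)
  also have "\<dots> = (\<integral>v. norm u ^ N * (\<phi> (v $ i) * cmod (v $ k) ^ N) \<partial>\<sigma>)"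
    by (simp add: hip_scale_left ww norm_mult A(2) power_mult_distrib mult_ac)
  finally show ?thesis by simp
qed

text \<open>Comparing coefficients of \<open>t\<close> in \<open>\<integral> \<phi> |v\<^sub>k + t v\<^sub>l|\<^bsup>2n\<^esup>\<close>.\<close>

lemma integral_plane_moment:
  fixes \<phi> :: "complex \<Rightarrow> real"
  assumes \<phi>: "continuous_on UNIV \<phi>" and ne: "i \<noteq> k" "i \<noteq> l" "k \<noteq> (l :: 'n)"
  shows "real (Suc N) * (\<integral>v. \<phi> (v $ i) * (cmod (v $ k) ^ (2 * N) * (cmod (v $ l))\<^sup>2) \<partial>\<sigma>)
    = (\<integral>v. \<phi> (v $ i) * cmod (v $ k) ^ (2 * Suc N) \<partial>\<sigma>)"
proof -
  define n where "n = Suc N"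
  define E where "E a = (\<integral>v. \<phi> (v $ i) * (cmod (v $ k) ^ (2 * (n - a)) * cmod (v $ l) ^ (2 * a)) \<partial>\<sigma>)" for a
  have cont: "continuous_on UNIV (\<lambda>v :: complex^'n. \<phi> (v $ i))"
    by (rule continuous_on_compose2[OF \<phi>]) (auto intro: continuous_intros)
  have cmod_pow: "complex_of_real (cmod z ^ (2 * j)) = z ^ j * cnj z ^ j" for z j
    by (simp only: power_mult of_real_power complex_norm_square[symmetric] power_mult_distrib[symmetric])
  \<comment> \<open>Two evaluations of one integral: rotating the \<open>l\<close>-th phase leaves
    only the diagonal terms of the double binomial expansion, while
    \<open>integral_hip_power\<close> gives the power of \<open>1 + t\<^sup>2\<close>, the squared
    norm of \<open>u\<close>.\<close>
  have main: "(\<Sum>a\<le>n. real (n choose a) ^ 2 * E a * (t\<^sup>2) ^ a) = (1 + t\<^sup>2) ^ n * E 0" for t :: real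
  proof -
    define u :: "complex^'n" where "u = axis k 1 + complex_of_real t *s axis l 1"
    have hu: "hip u v = v $ k + t * v $ l" for v by (simp add: u_def hip_linear)
    have "(norm u)\<^sup>2 = 1 + t\<^sup>2"
      using ne by (simp add: norm_sq_hip hu) (simp add: u_def axis_def power2_eq_square)
    then have nu: "norm u ^ (2 * n) = (1 + t\<^sup>2) ^ n" by (simp add: power_mult)
    have ui: "u $ i = 0" using ne by (simp add: u_def axis_def)
    define T where "T a b v = complex_of_real (\<phi> (v $ i)) * (of_nat (n choose a) * of_nat (n choose b)
        * of_real t ^ (a + b) * (v $ l ^ a * v $ k ^ (n - a) * cnj (v $ l ^ b * v $ k ^ (n - b))))"
      for a b and v :: "complex^'n"
    have contT: "continuous_on UNIV (T a b)" for a b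
      unfolding T_def by (intro continuous_intros cont)
    have T0: "integral\<^sup>L \<sigma> (T a b) = 0" if "a \<noteq> b" for a b
    proof (rule integral_rot_zero[OF contT _ that])
      show "norm (axis l 1 :: complex^'n) = 1" by (simp add: norm_axis_1)
      fix c and x :: "complex^'n"
      have "(rot c (axis l 1) *v x) $ i = x $ i" "(rot c (axis l 1) *v x) $ k = x $ k"
        "(rot c (axis l 1) *v x) $ l = c * x $ l"
        using ne by (simp_all add: rot_axis_nth)
      then show "T a b (rot c (axis l 1) *v x) = c ^ a * cnj c ^ b * T a b x"
        by (simp add: T_def power_mult_distrib)
    qed
    have Taa: "integral\<^sup>L \<sigma> (T a a) = complex_of_real (real (n choose a) ^ 2 * E a * (t\<^sup>2) ^ a)" for a
    proof -
      have "T a a = (\<lambda>v. complex_of_real (real (n choose a) ^ 2 * (t\<^sup>2) ^ a *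
        (\<phi> (v $ i) * (cmod (v $ k) ^ (2 * (n - a)) * cmod (v $ l) ^ (2 * a)))))"
        unfolding T_def of_real_mult cmod_pow
        by (simp add: power2_eq_square power_mult_distrib power_add mult_ac)
      then show ?thesis 
        by (simp only: integral_complex_of_real integral_mult_right_zero E_def) (simp only: mult_ac)
    qed
    have "complex_of_real ((1 + t\<^sup>2) ^ n * E 0)
      = complex_of_real (\<integral>v. \<phi> (v $ i) * cmod (hip u v) ^ (2 * n) \<partial>\<sigma>)"
      using integral_hip_power[OF \<phi> ne(1) ui, of "2 * n"] by (simp add: nu E_def)
    also have "\<dots> = (\<integral>v. complex_of_real (\<phi> (v $ i) * cmod (hip u v) ^ (2 * n)) \<partial>\<sigma>)"
      by (rule integral_complex_of_real[symmetric])
    also have "\<dots> = (\<integral>v. (\<Sum>a\<le>n. \<Sum>b\<le>n. T a b v) \<partial>\<sigma>)"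
    proof (rule Bochner_Integration.integral_cong[OF refl])
      fix v :: "complex^'n"
      have p: "(v $ k + t * v $ l) ^ n = (\<Sum>a\<le>n. of_nat (n choose a) * (of_real t * v $ l) ^ a * v $ k ^ (n - a))"
        unfolding add.commute[of "v $ k"] by (rule binomial_ring)
      have "complex_of_real (\<phi> (v $ i) * cmod (hip u v) ^ (2 * n))
        = of_real (\<phi> (v $ i)) * ((v $ k + t * v $ l) ^ n * cnj ((v $ k + t * v $ l) ^ n))"
        unfolding of_real_mult cmod_pow hu by simp
      also have "\<dots> = (\<Sum>a\<le>n. \<Sum>b\<le>n. T a b v)"
        unfolding p cnj_sum sum_product unfolding sum_distrib_left T_def
        by (intro sum.cong refl) (simp add: power_mult_distrib power_add mult_ac)
      finally show "complex_of_real (\<phi> (v $ i) * cmod (hip u v) ^ (2 * n)) = (\<Sum>a\<le>n. \<Sum>b\<le>n. T a b v)" .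
    qed
    also have "\<dots> = (\<Sum>a\<le>n. \<Sum>b\<le>n. integral\<^sup>L \<sigma> (T a b))"
      using contT by (simp add: Bochner_Integration.integral_sum integrable_continuous)
    also have "\<dots> = (\<Sum>a\<le>n. \<Sum>b\<le>n. if b = a then integral\<^sup>L \<sigma> (T a a) else 0)"
      using T0 by (intro sum.cong) auto
    also have "\<dots> = (\<Sum>a\<le>n. integral\<^sup>L \<sigma> (T a a))" by simp
    also have "\<dots> = complex_of_real (\<Sum>a\<le>n. real (n choose a) ^ 2 * E a * (t\<^sup>2) ^ a)"
      by (simp only: Taa of_real_sum)
    finally show ?thesis by (simp only: of_real_eq_iff)
  qed
  define c where "c a = real (n choose a) ^ 2 * E a - real (n choose a) * E 0" for a
  have "(\<Sum>a\<le>n. c a * x ^ a) = 0" if "x \<ge> 0" for x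
  proof -
    have "(1 + x) ^ n = (\<Sum>a\<le>n. real (n choose a) * x ^ a)"
      using binomial_ring[of x 1 n] by (simp add: add.commute)
    moreover have "(\<Sum>a\<le>n. c a * x ^ a) = (\<Sum>a\<le>n. real (n choose a) ^ 2 * E a * x ^ a)
        - (\<Sum>a\<le>n. real (n choose a) * x ^ a) * E 0"
      unfolding sum_distrib_right sum_subtractf[symmetric]
      by (rule sum.cong) (simp_all add: c_def algebra_simps)
    ultimately show ?thesis
      using main[of "sqrt x"] that by simp
  qed
  then have "{0..} \<subseteq> {x. (\<Sum>a\<le>n. c a * x ^ a) = 0}" by auto
  then have "infinite {x :: real. (\<Sum>a\<le>n. c a * x ^ a) = 0}"
    using infinite_Ici infinite_super by blast
  \<comment> \<open>A polynomial with infinitely many roots has only zero coefficients; the linear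
    one says that \<open>n\<^sup>2 * E 1 = n * E 0\<close>.\<close>
  then have "c 1 = 0"
    using polyfun_finite_roots[of c n] by (auto simp: n_def)
  then have "real n * E 1 = E 0"
    by (simp add: c_def n_def power2_eq_square)
  then show ?thesis by (simp add: E_def n_def)
qed

text \<open>On the sphere \<open>1 - |v_i|^2\<close> is the sum of \<open>|v_l|^2\<close> over
  \<open>l \<noteq> i\<close>. Absorbing one such factor into the weight yields the next moment
  \<open>I\<close> once for \<open>l = k\<close>, and \<open>I / (s + 1)\<close> for each of the
  \<open>CARD('n) - 2\<close> other indices by \<open>integral_plane_moment\<close>. The resulting
  factor is the recursion of the binomial coefficient. The induction therefore has to vary the
  weight.\<close>

lemma integral_fibre_moment:
  fixes \<phi> :: "complex \<Rightarrow> real"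
  assumes "continuous_on UNIV \<phi>" "i \<noteq> (k :: 'n)"
  shows "(\<integral>v. \<phi> (v $ i) * cmod (v $ k) ^ (2 * s) \<partial>\<sigma>) * real ((CARD('n) - 2 + s) choose s)
    = (\<integral>v. \<phi> (v $ i) * (1 - (cmod (v $ i))\<^sup>2) ^ s \<partial>\<sigma>)"
  using assms(1)
proof (induction s arbitrary: \<phi>)
  case 0
  then show ?case by simp
next
  case (Suc s)
  define \<alpha> where "\<alpha> = CARD('n) - 2"
  define \<psi> where "\<psi> z = \<phi> z * (1 - (cmod z)\<^sup>2)" for z
  define I where "I = (\<integral>v. \<phi> (v $ i) * cmod (v $ k) ^ (2 * Suc s) \<partial>\<sigma>)"
  have \<psi>: "continuous_on UNIV \<psi>" unfolding \<psi>_def by (intro continuous_intros Suc.prems)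
  have cont: "continuous_on UNIV (\<lambda>v :: complex^'n. \<phi> (v $ i))"
    by (rule continuous_on_compose2[OF Suc.prems]) (auto intro: continuous_intros)
  have sph: "1 - (cmod (v $ i))\<^sup>2 = (\<Sum>l\<in>UNIV - {i}. (cmod (v $ l))\<^sup>2)"
    if "norm v = 1" for v :: "complex^'n"
  proof -
    have "(\<Sum>l\<in>UNIV. (cmod (v $ l))\<^sup>2) = 1" by (simp add: sum_cmod_sq that)
    then show ?thesis by (subst (asm) sum.remove[of _ i]) auto
  qed
  have "(\<integral>v. \<psi> (v $ i) * cmod (v $ k) ^ (2 * s) \<partial>\<sigma>)
    = (\<integral>v. (\<Sum>l\<in>UNIV - {i}. \<phi> (v $ i) * (cmod (v $ k) ^ (2 * s) * (cmod (v $ l))\<^sup>2)) \<partial>\<sigma>)"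
  proof (rule integral_cong_C)
    show "continuous_on UNIV (\<lambda>v :: complex^'n. \<psi> (v $ i) * cmod (v $ k) ^ (2 * s))"
      unfolding \<psi>_def by (intro continuous_intros cont)
    show "continuous_on UNIV (\<lambda>v :: complex^'n.
        \<Sum>l\<in>UNIV - {i}. \<phi> (v $ i) * (cmod (v $ k) ^ (2 * s) * (cmod (v $ l))\<^sup>2))"
      by (intro continuous_intros cont)
    fix v :: "complex^'n" assume "v \<in> sphere 0 1"
    then show "\<psi> (v $ i) * cmod (v $ k) ^ (2 * s)
      = (\<Sum>l\<in>UNIV - {i}. \<phi> (v $ i) * (cmod (v $ k) ^ (2 * s) * (cmod (v $ l))\<^sup>2))"
      by (simp add: \<psi>_def sph sum_distrib_left sum_distrib_right mult_ac)
  qed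
  also have "\<dots> = (\<Sum>l\<in>UNIV - {i}. \<integral>v. \<phi> (v $ i) * (cmod (v $ k) ^ (2 * s) * (cmod (v $ l))\<^sup>2) \<partial>\<sigma>)"
    by (intro Bochner_Integration.integral_sum integrable_continuous continuous_intros cont)
  also have "\<dots> = (\<integral>v. \<phi> (v $ i) * (cmod (v $ k) ^ (2 * s) * (cmod (v $ k))\<^sup>2) \<partial>\<sigma>)
    + (\<Sum>l\<in>UNIV - {i} - {k}. \<integral>v. \<phi> (v $ i) * (cmod (v $ k) ^ (2 * s) * (cmod (v $ l))\<^sup>2) \<partial>\<sigma>)"
    using assms(2) by (subst sum.remove[of _ k]) auto
  also have "\<dots> = I + (\<Sum>l\<in>UNIV - {i} - {k}. I / real (Suc s))"
  proof -
    have "(\<integral>v. \<phi> (v $ i) * (cmod (v $ k) ^ (2 * s) * (cmod (v $ l))\<^sup>2) \<partial>\<sigma>) = I / real (Suc s)"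
      if "l \<in> UNIV - {i} - {k}" for l
      using integral_plane_moment[OF Suc.prems assms(2), of l s] that
      by (auto simp: I_def field_simps)
    then show ?thesis by (simp add: I_def power_add[symmetric] mult_2 flip: power2_eq_square)
  qed
  also have "\<dots> = I * real (Suc (\<alpha> + s)) / real (Suc s)"
  proof -
    have "card (UNIV - {i} - {k}) = \<alpha>" using assms(2) by (simp add: \<alpha>_def card_Diff_singleton)
    then show ?thesis by (simp add: field_simps)
  qed
  finally have 1: "(\<integral>v. \<psi> (v $ i) * cmod (v $ k) ^ (2 * s) \<partial>\<sigma>) = I * real (Suc (\<alpha> + s)) / real (Suc s)" .
  have "real (Suc s) * real ((\<alpha> + Suc s) choose Suc s) = real (Suc (\<alpha> + s)) * real ((\<alpha> + s) choose s)"
    using Suc_times_binomial[of s "\<alpha> + s"] by (metis add_Suc_right of_nat_mult)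
  then have "I * real ((\<alpha> + Suc s) choose Suc s)
    = I * real (Suc (\<alpha> + s)) / real (Suc s) * real ((\<alpha> + s) choose s)"
    by (simp add: field_simps)
  also have "\<dots> = (\<integral>v. \<psi> (v $ i) * (1 - (cmod (v $ i))\<^sup>2) ^ s \<partial>\<sigma>)"
    using Suc.IH[OF \<psi>] by (simp add: 1 \<alpha>_def)
  finally show ?case by (simp add: I_def \<alpha>_def \<psi>_def mult_ac)
qed

end

section \<open>Zonal kernels and their identification with the disc polynomials\<close>

context unitary_measure
begin

text \<open>Average over \<open>v\<close> of the kernels attached to the highest weight vectors
  \<open>\<langle>x, u\<rangle>\<^sup>m \<langle>v, x\<rangle>\<^sup>n\<close>, \<open>u \<bottom> v\<close>; the average over \<open>u\<close> has been replaced by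
  the projection to the orthogonal complement of \<open>v\<close>.\<close>

definition zonal :: "nat \<Rightarrow> nat \<Rightarrow> complex^'n \<Rightarrow> complex^'n \<Rightarrow> complex"
  where "zonal m n x y =
    (\<integral>v. (hip x y - hip x v * hip v y) ^ m * cnj (hip x v * hip v y) ^ n \<partial>\<sigma>)"

text \<open>The value of \<open>zonal m n\<close> at \<open>x = y = axis i 1\<close>.\<close>

definition zonal_const :: "'n \<Rightarrow> nat \<Rightarrow> nat \<Rightarrow> real"
  where "zonal_const i m n = (\<integral>v. (1 - (cmod (v $ i))\<^sup>2) ^ m * cmod (v $ i) ^ (2 * n) \<partial>\<sigma>)"

lemma zonal_unitary:
  assumes A: "A \<in> unitary_group"
  shows "zonal m n (A *v x) (A *v y) = zonal m n x y"
proof -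
  have "zonal m n (A *v x) (A *v y) = (\<integral>v. (hip (A *v x) (A *v y) - hip (A *v x) (A *v v)
      * hip (A *v v) (A *v y)) ^ m * cnj (hip (A *v x) (A *v v) * hip (A *v v) (A *v y)) ^ n \<partial>\<sigma>)"
    unfolding zonal_def by (rule integral_unitary[OF A, symmetric]) (intro continuous_intros)
  then show ?thesis by (simp add: hip_unitary[OF A] zonal_def)
qed

text \<open>Split \<open>y\<close> into \<open>z *s axis i 1\<close> and a part \<open>y'\<close>
  orthogonal to it, and expand both powers in the integrand. Phase rotation removes the mixed terms.
  In the diagonal ones \<open>integral_hip_power\<close> produces \<open>(1 - |z|^2) ^ s\<close> as
  a power of the norm of \<open>y'\<close>, and \<open>integral_fibre_moment\<close> produces the
  denominator \<open>(\<alpha> + s) choose s\<close>.\<close>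

lemma zonal_axis:
  assumes card: "CARD('n) \<ge> 2" and y: "norm (y :: complex^'n) = 1"
  shows "zonal m n (axis i 1) y = zonal_const i m n * zpoly (CARD('n) - 2) m n (y $ i)"
proof -
  define \<alpha> where "\<alpha> = CARD('n) - 2"
  obtain k :: 'n where ki: "i \<noteq> k"
    by (rule obtain_other_index[OF card])
  define z where "z = y $ i"
  define y' where "y' = y - z *s axis i 1"
  have y'i: "y' $ i = 0" by (simp add: y'_def z_def axis_def)
  have hy: "hip v y = z * cnj (v $ i) + cnj (hip y' v)" for v
    by (simp add: y'_def hip_linear hip_commute[of v y])
  have "(norm y')\<^sup>2 = 1 - (cmod z)\<^sup>2"
  proof -
    have "hip y' y' = hip y y - z * cnj z"
      by (simp add: y'_def hip_linear z_def)
    also have "\<dots> = complex_of_real (1 - (cmod z)\<^sup>2)"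
      by (simp add: hip_self y flip: complex_norm_square)
    finally show ?thesis by (simp only: hip_self of_real_eq_iff)
  qed
  then have ny': "norm y' ^ (2 * s) = (1 - (cmod z)\<^sup>2) ^ s" for s by (simp add: power_mult)
  define \<rho> where "\<rho> v = v $ i * cnj (v $ i)" for v :: "complex^'n"
  \<comment> \<open>\<open>a\<close> and \<open>b\<close> count the factors taken from
    \<open>y'\<close> in the two powers. Rotating the \<open>i\<close>-th phase multiplies the term
    by \<open>c ^ (a + (n - b)) * cnj c ^ n\<close>, which is trivial only for
    \<open>a = b\<close>.\<close>
  define T where "T a b v = of_nat (m choose a) * of_nat (n choose b) * z ^ (m - a) * cnj z ^ (n - b) * (-1) ^ a
      * ((1 - \<rho> v) ^ (m - a) * (v $ i ^ (a + (n - b)) * cnj (v $ i) ^ n)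
        * (cnj (hip y' v) ^ a * hip y' v ^ b))" for a b and v :: "complex^'n"
  have contT: "continuous_on UNIV (T a b)" for a b
    unfolding T_def \<rho>_def by (intro continuous_intros)
  have T0: "integral\<^sup>L \<sigma> (T a b) = 0" if "a \<noteq> b" "b \<le> n" for a b
  proof (rule integral_rot_zero[OF contT])
    show "norm (axis i 1 :: complex^'n) = 1" by (simp add: norm_axis_1)
    show "a + (n - b) \<noteq> n" using that by simp
    fix c and x :: "complex^'n" assume c: "cmod c = 1"
    have cc: "c * cnj c = 1" using c complex_norm_square[of c] by simp
    have 1: "(rot c (axis i 1) *v x) $ i = c * x $ i" by (simp add: rot_axis_nth)
    have 2: "hip y' (rot c (axis i 1) *v x) = hip y' x" by (simp add: hip_rot y'i)
    have "\<rho> (rot c (axis i 1) *v x) = (c * cnj c) * \<rho> x" by (simp add: \<rho>_def 1)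
    then have 3: "\<rho> (rot c (axis i 1) *v x) = \<rho> x" by (simp add: cc)
    show "T a b (rot c (axis i 1) *v x) = c ^ (a + (n - b)) * cnj c ^ n * T a b x"
      unfolding T_def 1 2 3 by (simp only: power_mult_distrib complex_cnj_mult mult_ac)
  qed
  have Tss: "integral\<^sup>L \<sigma> (T s s) = zonal_const i m n *
      (complex_of_real ((-1) ^ s * real (m choose s) * real (n choose s) / real ((\<alpha> + s) choose s))
       * (1 - z * cnj z) ^ s * z ^ (m - s) * cnj z ^ (n - s))" if "s \<le> min m n" for s
  proof -
    define \<phi> where "\<phi> w = (1 - (cmod w)\<^sup>2) ^ (m - s) * cmod w ^ (2 * n)" for w
    have cphi: "continuous_on UNIV \<phi>" unfolding \<phi>_def by (intro continuous_intros)
    define K where "K = of_nat (m choose s) * of_nat (n choose s) * z ^ (m - s) * cnj z ^ (n - s) * (-1) ^ s"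
    have cmod_pow: "complex_of_real (cmod w ^ (2 * j)) = w ^ j * cnj w ^ j" for w j
      by (simp only: power_mult of_real_power complex_norm_square[symmetric] power_mult_distrib[symmetric])
    have "T s s = (\<lambda>v. K * complex_of_real (\<phi> (v $ i) * cmod (hip y' v) ^ (2 * s)))"
    proof
      fix v :: "complex^'n"
      have "complex_of_real (\<phi> (v $ i)) = (1 - \<rho> v) ^ (m - s) * (v $ i ^ n * cnj (v $ i) ^ n)"
        unfolding \<phi>_def of_real_mult cmod_pow by (simp add: \<rho>_def of_real_cmod_square)
      then show "T s s v = K * complex_of_real (\<phi> (v $ i) * cmod (hip y' v) ^ (2 * s))"
        unfolding of_real_mult cmod_pow T_def K_def using that by (simp add: mult_ac)
    qed
    then have "integral\<^sup>L \<sigma> (T s s)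
      = K * complex_of_real (\<integral>v. \<phi> (v $ i) * cmod (hip y' v) ^ (2 * s) \<partial>\<sigma>)"
      by (simp only: integral_mult_right_zero integral_complex_of_real)
    also have "(\<integral>v. \<phi> (v $ i) * cmod (hip y' v) ^ (2 * s) \<partial>\<sigma>)
      = (1 - (cmod z)\<^sup>2) ^ s * (\<integral>v. \<phi> (v $ i) * cmod (v $ k) ^ (2 * s) \<partial>\<sigma>)"
      unfolding integral_hip_power[OF cphi ki y'i] ny' ..
    also have "(\<integral>v. \<phi> (v $ i) * cmod (v $ k) ^ (2 * s) \<partial>\<sigma>)
      = (\<integral>v. \<phi> (v $ i) * (1 - (cmod (v $ i))\<^sup>2) ^ s \<partial>\<sigma>) / real ((\<alpha> + s) choose s)"
      using integral_fibre_moment[OF cphi ki, of s] by (simp add: \<alpha>_def eq_divide_eq)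
    \<comment> \<open>The fibre moment restores the factors missing from \<open>\<phi>\<close>, so
      the same constant comes out for every \<open>s\<close>.\<close>
    also have "(\<integral>v. \<phi> (v $ i) * (1 - (cmod (v $ i))\<^sup>2) ^ s \<partial>\<sigma>) = zonal_const i m n"
    proof -
      have "\<phi> w * (1 - (cmod w)\<^sup>2) ^ s = (1 - (cmod w)\<^sup>2) ^ m * cmod w ^ (2 * n)" for w
        using that by (simp add: \<phi>_def power_add[symmetric] mult_ac)
      then show ?thesis by (simp add: zonal_const_def)
    qed
    finally show ?thesis
      by (simp add: K_def of_real_cmod_square mult_ac)
  qed
  have "zonal m n (axis i 1) y = (\<integral>v. (\<Sum>a\<le>m. \<Sum>b\<le>n. T a b v) \<partial>\<sigma>)"
    unfolding zonal_def
  proof (rule Bochner_Integration.integral_cong[OF refl])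
    fix v :: "complex^'n"
    define W where "W = hip y' v"
    have e1: "z - v $ i * (z * cnj (v $ i) + cnj W) = (- (v $ i * cnj W)) + z * (1 - \<rho> v)"
      by (simp add: \<rho>_def algebra_simps)
    have e2: "cnj (v $ i * (z * cnj (v $ i) + cnj W)) = cnj (v $ i) * (W + cnj z * v $ i)"
      by (simp add: algebra_simps)
    have "(hip (axis i 1) y - hip (axis i 1) v * hip v y) ^ m * cnj (hip (axis i 1) v * hip v y) ^ n
      = ((- (v $ i * cnj W)) + z * (1 - \<rho> v)) ^ m * (cnj (v $ i) ^ n * (W + cnj z * v $ i) ^ n)"
      unfolding hip_axis_left hy[of v] z_def[symmetric] W_def[symmetric] e1 e2 power_mult_distrib ..
    also have "\<dots> = (\<Sum>a\<le>m. \<Sum>b\<le>n. T a b v)"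
      unfolding binomial_ring[of "- (v $ i * cnj W)"] binomial_ring[of W]
        sum_distrib_left[of "cnj (v $ i) ^ n"] sum_product
    proof (intro sum.cong refl)
      fix a b
      have m1: "(- (v $ i * cnj W)) ^ a = (-1) ^ a * (v $ i ^ a * cnj W ^ a)"
        unfolding power_minus[of "v $ i * cnj W"] power_mult_distrib ..
      show "of_nat (m choose a) * (- (v $ i * cnj W)) ^ a * (z * (1 - \<rho> v)) ^ (m - a)
          * (cnj (v $ i) ^ n * (of_nat (n choose b) * W ^ b * (cnj z * v $ i) ^ (n - b))) = T a b v"
        unfolding m1 T_def W_def[symmetric] power_mult_distrib power_add by (simp only: mult_ac)
    qed
    finally show "(hip (axis i 1) y - hip (axis i 1) v * hip v y) ^ m
        * cnj (hip (axis i 1) v * hip v y) ^ n = (\<Sum>a\<le>m. \<Sum>b\<le>n. T a b v)" .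
  qed
  also have "\<dots> = (\<Sum>a\<le>m. \<Sum>b\<le>n. integral\<^sup>L \<sigma> (T a b))"
    using contT by (simp add: Bochner_Integration.integral_sum integrable_continuous)
  also have "\<dots> = (\<Sum>a\<le>m. \<Sum>b\<le>n. if b = a then integral\<^sup>L \<sigma> (T a a) else 0)"
    using T0 by (intro sum.cong) auto
  also have "\<dots> = (\<Sum>a\<le>m. if a \<le> n then integral\<^sup>L \<sigma> (T a a) else 0)"
    by (intro sum.cong) auto
  also have "\<dots> = (\<Sum>s\<le>min m n. integral\<^sup>L \<sigma> (T s s))"
    by (intro sum.mono_neutral_cong_right) auto
  also have "(\<Sum>s\<le>min m n. integral\<^sup>L \<sigma> (T s s)) = zonal_const i m n * zpoly \<alpha> m n z"
    unfolding zpoly_def sum_distrib_left by (intro sum.cong refl Tss) simp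
  finally show ?thesis by (simp add: z_def \<alpha>_def)
qed

lemma zonal_eq:
  assumes card: "CARD('n) \<ge> 2" and "norm x = 1" "norm (y :: complex^'n) = 1"
  shows "zonal m n x y = zonal_const i m n * zpoly (CARD('n) - 2) m n (hip x y)"
proof -
  obtain A where A: "A \<in> unitary_group" "A *v x = axis i 1"
    by (rule unitary_transitive[of x "axis i 1"]) (simp add: assms norm_axis_1)
  have "zonal m n x y = zonal m n (axis i 1) (A *v y)"
    using zonal_unitary[OF A(1), of m n x y] by (simp add: A(2))
  also have "\<dots> = zonal_const i m n * zpoly (CARD('n) - 2) m n ((A *v y) $ i)"
    by (rule zonal_axis[OF card]) (simp add: norm_unitary[OF A(1)] assms)
  also have "(A *v y) $ i = hip x y"
    using hip_unitary[OF A(1), of x y] by (simp add: A(2))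
  finally show ?thesis .
qed

lemma zonal_const_pos:
  assumes card: "CARD('n) \<ge> 2"
  shows "zonal_const i m n > 0"
proof -
  obtain k :: 'n where ki: "i \<noteq> k"
    by (rule obtain_other_index[OF card])
  \<comment> \<open>A unit vector with \<open>0 < |u_i| < 1\<close>, where the integrand is
    positive; the Pythagorean triple 3, 4, 5 keeps its entries rational.\<close>
  define u :: "complex^'n" where "u = (3/5) *s axis i 1 + (4/5) *s axis k 1"
  have ui: "u $ i = 3/5" and uk: "u $ k = 4/5" using ki by (simp_all add: u_def axis_def)
  have "(norm u)\<^sup>2 = 1"
    unfolding norm_sq_hip u_def hip_linear using ki
    by (simp add: hip_linear) (simp add: axis_def)
  then have "norm u = 1" using power2_eq_imp_eq[of "norm u" 1] by simp
  show ?thesis unfolding zonal_const_def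
  proof (rule integral_pos)
    show "continuous_on UNIV (\<lambda>v :: complex^'n. (1 - (cmod (v $ i))\<^sup>2) ^ m * cmod (v $ i) ^ (2 * n))"
      by (intro continuous_intros)
    show "u \<in> sphere 0 1" using \<open>norm u = 1\<close> by simp
    show "0 < (1 - (cmod (u $ i))\<^sup>2) ^ m * cmod (u $ i) ^ (2 * n)"
      unfolding ui by (simp add: power2_eq_square)
    fix v :: "complex^'n" assume "v \<in> sphere 0 1"
    then have "cmod (v $ i) \<le> 1" using Finite_Cartesian_Product.norm_nth_le[of v i] by simp
    then have "(cmod (v $ i))\<^sup>2 \<le> 1" by (simp add: power_le_one)
    then show "0 \<le> (1 - (cmod (v $ i))\<^sup>2) ^ m * cmod (v $ i) ^ (2 * n)" by simp
  qed
qed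

end

section \<open>Positive definite kernels\<close>

definition pdk :: "'a set \<Rightarrow> ('a \<Rightarrow> 'a \<Rightarrow> complex) \<Rightarrow> bool" where
  "pdk S K \<longleftrightarrow> (\<forall>n (x :: nat \<Rightarrow> 'a) c. (\<forall>j<n. x j \<in> S) \<longrightarrow>
     (\<Sum>j<n. \<Sum>k<n. K (x j) (x k) * c j * cnj (c k)) \<in> nonneg_Reals)"

text \<open>Multipliers of the cone of positive definite kernels.  All kernels below are visibly of this
  kind, so that the Schur product theorem is not needed.\<close>

definition pd_mult :: "'a set \<Rightarrow> ('a \<Rightarrow> 'a \<Rightarrow> complex) \<Rightarrow> bool" where
  "pd_mult S M \<longleftrightarrow> (\<forall>K. pdk S K \<longrightarrow> pdk S (\<lambda>x y. M x y * K x y))"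

lemma pdkD:
  fixes n :: nat
  assumes "pdk S K" "\<And>j. j < n \<Longrightarrow> x j \<in> S"
  shows "(\<Sum>j<n. \<Sum>k<n. K (x j) (x k) * c j * cnj (c k)) \<in> nonneg_Reals"
  using assms unfolding pdk_def by blast

lemma pdk_cong:
  fixes S :: "'a set"
  assumes "\<And>x y. x \<in> S \<Longrightarrow> y \<in> S \<Longrightarrow> K x y = L x y"
  shows "pdk S K \<longleftrightarrow> pdk S L"
proof -
  have "(\<Sum>j<n. \<Sum>k<n. K (x j) (x k) * c j * cnj (c k)) = (\<Sum>j<n. \<Sum>k<n. L (x j) (x k) * c j * cnj (c k))"
    if "\<forall>j<n. x j \<in> S" for n :: nat and x :: "nat \<Rightarrow> 'a" and c
    using that assms by (intro sum.cong) auto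
  then show ?thesis by (auto simp: pdk_def)
qed

lemma pd_mult_cong:
  assumes "\<And>x y. x \<in> S \<Longrightarrow> y \<in> S \<Longrightarrow> M x y = N x y"
  shows "pd_mult S M \<longleftrightarrow> pd_mult S N"
proof -
  have "pdk S (\<lambda>x y. M x y * K x y) \<longleftrightarrow> pdk S (\<lambda>x y. N x y * K x y)" for K
    using assms by (intro pdk_cong) simp
  then show ?thesis by (simp add: pd_mult_def)
qed

lemma pdk_one: "pdk S (\<lambda>_ _. 1)"
  unfolding pdk_def
proof (intro allI impI)
  fix n :: nat and c :: "nat \<Rightarrow> complex"
  have "(\<Sum>j<n. \<Sum>k<n. 1 * c j * cnj (c k)) = (\<Sum>j<n. c j) * cnj (\<Sum>j<n. c j)"
    by (simp add: sum_product)
  also have "\<dots> = complex_of_real ((cmod (\<Sum>j<n. c j))\<^sup>2)" by (rule complex_norm_square[symmetric])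
  finally show "(\<Sum>j<n. \<Sum>k<n. 1 * c j * cnj (c k)) \<in> nonneg_Reals" by simp
qed

lemma pd_mult_imp_pdk: "pd_mult S M \<Longrightarrow> pdk S M"
  using pdk_one[of S] by (auto simp: pd_mult_def)

lemma pd_mult_pdk: "pd_mult S M \<Longrightarrow> pdk S K \<Longrightarrow> pdk S (\<lambda>x y. M x y * K x y)"
  by (simp add: pd_mult_def)

lemma pd_mult_const:
  fixes S :: "'a set"
  shows "a \<ge> 0 \<Longrightarrow> pd_mult S (\<lambda>_ _. complex_of_real a)"
  unfolding pd_mult_def pdk_def
proof (intro allI impI)
  fix K n and x :: "nat \<Rightarrow> 'a" and c
  assume a: "a \<ge> 0" and K: "\<forall>(n :: nat) x c. (\<forall>j<n. x j \<in> S) \<longrightarrow>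
      (\<Sum>j<n. \<Sum>k<n. K (x j) (x k) * c j * cnj (c k)) \<in> nonneg_Reals" and x: "\<forall>j<n. x j \<in> S"
  have "(\<Sum>j<n. \<Sum>k<n. complex_of_real a * K (x j) (x k) * c j * cnj (c k))
    = complex_of_real a * (\<Sum>j<n. \<Sum>k<n. K (x j) (x k) * c j * cnj (c k))"
    by (simp add: sum_distrib_left mult.assoc)
  then show "(\<Sum>j<n. \<Sum>k<n. complex_of_real a * K (x j) (x k) * c j * cnj (c k)) \<in> nonneg_Reals"
    using K[rule_format, of n x c] x a by (simp add: nonneg_Reals_mult_I)
qed

text \<open>The factor is absorbed into the coefficients by replacing \<open>c j\<close> with
  \<open>g (x j) * c j\<close>.\<close>

lemma pd_mult_rank1:
  fixes S :: "'a set"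
  shows "pd_mult S (\<lambda>x y. g x * cnj (g y))"
  unfolding pd_mult_def pdk_def
proof (intro allI impI)
  fix K n and x :: "nat \<Rightarrow> 'a" and c
  assume K: "\<forall>(n :: nat) x c. (\<forall>j<n. x j \<in> S) \<longrightarrow>
      (\<Sum>j<n. \<Sum>k<n. K (x j) (x k) * c j * cnj (c k)) \<in> nonneg_Reals" and x: "\<forall>j<n. x j \<in> S"
  have "(\<Sum>j<n. \<Sum>k<n. K (x j) (x k) * (g (x j) * c j) * cnj (g (x k) * c k)) \<in> nonneg_Reals"
    using K[rule_format, of n x "\<lambda>j. g (x j) * c j"] x by simp
  then show "(\<Sum>j<n. \<Sum>k<n. g (x j) * cnj (g (x k)) * K (x j) (x k) * c j * cnj (c k)) \<in> nonneg_Reals"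
    by (simp add: mult_ac)
qed

lemma pd_mult_mult: "pd_mult S M \<Longrightarrow> pd_mult S N \<Longrightarrow> pd_mult S (\<lambda>x y. M x y * N x y)"
  unfolding pd_mult_def by (simp add: mult.assoc)

lemma pd_mult_power: "pd_mult S M \<Longrightarrow> pd_mult S (\<lambda>x y. M x y ^ n)"
proof (induction n)
  case 0
  then show ?case using pd_mult_const[of 1 S] by simp
next
  case (Suc n)
  then show ?case using pd_mult_mult[of S M "\<lambda>x y. M x y ^ n"] by simp
qed

lemma pdk_add:
  fixes S :: "'a set"
  assumes "pdk S K" "pdk S L"
  shows "pdk S (\<lambda>x y. K x y + L x y)"
  unfolding pdk_def
proof (intro allI impI)
  fix n and x :: "nat \<Rightarrow> 'a" and c
  assume x: "\<forall>j<n. x j \<in> S"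
  have "(\<Sum>j<n. \<Sum>k<n. (K (x j) (x k) + L (x j) (x k)) * c j * cnj (c k))
    = (\<Sum>j<n. \<Sum>k<n. K (x j) (x k) * c j * cnj (c k)) + (\<Sum>j<n. \<Sum>k<n. L (x j) (x k) * c j * cnj (c k))"
    by (simp add: sum.distrib distrib_right)
  also have "\<dots> \<in> nonneg_Reals"
    using x by (intro nonneg_Reals_add_I pdkD[OF assms(1), of n x c] pdkD[OF assms(2), of n x c]) auto
  finally show "(\<Sum>j<n. \<Sum>k<n. (K (x j) (x k) + L (x j) (x k)) * c j * cnj (c k)) \<in> nonneg_Reals" .
qed

lemma pd_mult_add: "pd_mult S M \<Longrightarrow> pd_mult S N \<Longrightarrow> pd_mult S (\<lambda>x y. M x y + N x y)"
  unfolding pd_mult_def by (simp add: distrib_right pdk_add)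

lemma pd_mult_sum:
  "finite I \<Longrightarrow> (\<And>i. i \<in> I \<Longrightarrow> pd_mult S (M i)) \<Longrightarrow> pd_mult S (\<lambda>x y. \<Sum>i\<in>I. M i x y)"
proof (induction I rule: finite_induct)
  case empty
  then show ?case using pd_mult_const[of 0 S] by simp
next
  case (insert i I)
  then show ?case using pd_mult_add[of S "M i" "\<lambda>x y. \<Sum>i\<in>I. M i x y"] by simp
qed

lemma pd_mult_hip: "pd_mult S (\<lambda>x y. hip (g x) (g y))"
proof -
  have "pd_mult S (\<lambda>x y. \<Sum>i\<in>UNIV. cnj (g x $ i) * cnj (cnj (g y $ i)))"
    by (intro pd_mult_sum pd_mult_rank1) simp
  then show ?thesis by (simp add: hip_def)
qed

lemma has_sum_finite_sum:
  fixes f :: "'t \<Rightarrow> 'i \<Rightarrow> 'b::{comm_monoid_add, topological_comm_monoid_add}"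
  assumes "\<And>i. i \<in> I \<Longrightarrow> ((\<lambda>t. f t i) has_sum s i) A"
  shows "((\<lambda>t. \<Sum>i\<in>I. f t i) has_sum (\<Sum>i\<in>I. s i)) A"
  using assms by (induction I rule: infinite_finite_induct) (auto intro: has_sum_add has_sum_0)

lemma pdk_has_sum:
  fixes S :: "'a set"
  assumes "\<And>t. pdk S (K t)" and L: "\<And>x y. x \<in> S \<Longrightarrow> y \<in> S \<Longrightarrow> ((\<lambda>t. K t x y) has_sum L x y) UNIV"
  shows "pdk S L"
  unfolding pdk_def
proof (intro allI impI)
  fix n and x :: "nat \<Rightarrow> 'a" and c
  assume x: "\<forall>j<n. x j \<in> S"
  have "((\<lambda>t. \<Sum>j<n. \<Sum>k<n. K t (x j) (x k) * c j * cnj (c k)) has_sum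
      (\<Sum>j<n. \<Sum>k<n. L (x j) (x k) * c j * cnj (c k))) UNIV"
    using x L by (intro has_sum_finite_sum has_sum_cmult_left) auto
  then have lim: "(sum (\<lambda>t. \<Sum>j<n. \<Sum>k<n. K t (x j) (x k) * c j * cnj (c k)) \<longlongrightarrow>
      (\<Sum>j<n. \<Sum>k<n. L (x j) (x k) * c j * cnj (c k))) (finite_subsets_at_top UNIV)"
    by (simp add: has_sum_def)
  have "sum (\<lambda>t. \<Sum>j<n. \<Sum>k<n. K t (x j) (x k) * c j * cnj (c k)) X \<in> nonneg_Reals" for X
    using x by (induction X rule: infinite_finite_induct)
      (auto intro!: nonneg_Reals_add_I pdkD[OF assms(1), of n x _ c])
  then show "(\<Sum>j<n. \<Sum>k<n. L (x j) (x k) * c j * cnj (c k)) \<in> nonneg_Reals"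
    by (intro Lim_in_closed_set[OF closed_nonneg_Reals_complex _ _ lim]) auto
qed

lemma pdk_bound:
  assumes "pdk S K" "x \<in> S" "y \<in> S" "K x x = 1" "K y y = 1" "K y x = cnj (K x y)"
  shows "cmod (K x y) \<le> 1"
proof (cases "K x y = 0")
  case False
  \<comment> \<open>With coefficients 1 at \<open>x\<close> and \<open>w\<close> at \<open>y\<close>
    the quadratic form equals \<open>2 - 2 * cmod (K x y)\<close>.\<close>
  define w where "w = - K x y / cmod (K x y)"
  have w: "cmod w = 1" using False by (simp add: w_def norm_divide)
  have "(\<Sum>j<2. \<Sum>k<2. K ([x, y] ! j) ([x, y] ! k) * ([1, w] ! j) * cnj ([1, w] ! k)) \<in> nonneg_Reals"
    by (rule pdkD[OF assms(1)]) (use assms in \<open>auto simp: less_2_cases_iff\<close>)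
  moreover have "(\<Sum>j<2. \<Sum>k<2. K ([x, y] ! j) ([x, y] ! k) * ([1, w] ! j) * cnj ([1, w] ! k))
    = 1 + K x y * cnj w + (cnj (K x y) * w + w * cnj w)"
    using assms by (simp add: numeral_2_eq_2)
  moreover have "w * cnj w = 1" using w complex_norm_square[of w] by simp
  moreover have "K x y * cnj w = - cmod (K x y)"
  proof -
    have "K x y * cnj w = - (K x y * cnj (K x y)) / cmod (K x y)" by (simp add: w_def)
    also have "\<dots> = - cmod (K x y)"
      using False by (simp add: complex_norm_square[symmetric] power2_eq_square del: of_real_power)
    finally show ?thesis .
  qed
  moreover have "cnj (K x y) * w = cnj (K x y * cnj w)" by simp
  ultimately have "complex_of_real (2 - 2 * cmod (K x y)) \<in> nonneg_Reals" by simp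
  then show ?thesis by (simp only: nonneg_Reals_of_real_iff)
qed simp

section \<open>Averages of positive definite kernels\<close>

context supported_prob
begin

lemma integral_nonneg_Reals:
  fixes h :: "'a \<Rightarrow> complex"
  assumes "continuous_on UNIV h" "\<And>x. x \<in> C \<Longrightarrow> h x \<in> nonneg_Reals"
  shows "integral\<^sup>L M h \<in> nonneg_Reals"
proof -
  have "integral\<^sup>L M h = (\<integral>x. complex_of_real (Re (h x)) \<partial>M)"
    using assms by (intro integral_cong_C continuous_intros)
      (auto simp: complex_nonneg_Reals_iff complex_eq_iff)
  also have "\<dots> = complex_of_real (\<integral>x. Re (h x) \<partial>M)" by simp
  finally have "integral\<^sup>L M h = complex_of_real (\<integral>x. Re (h x) \<partial>M)" .
  moreover have "0 \<le> (\<integral>x. Re (h x) \<partial>M)"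
    using AE_C assms(2) by (intro integral_nonneg_AE) (auto simp: complex_nonneg_Reals_iff)
  ultimately show ?thesis by simp
qed

lemma pd_mult_integral:
  fixes S :: "'b set"
  assumes "\<And>v. v \<in> C \<Longrightarrow> pd_mult S (N v)" "\<And>x y. x \<in> S \<Longrightarrow> y \<in> S \<Longrightarrow> continuous_on UNIV (\<lambda>v. N v x y)"
  shows "pd_mult S (\<lambda>x y. \<integral>v. N v x y \<partial>M)"
  unfolding pd_mult_def
proof (intro allI impI)
  fix K assume K: "pdk S K"
  show "pdk S (\<lambda>x y. (\<integral>v. N v x y \<partial>M) * K x y)"
    unfolding pdk_def
  proof (intro allI impI)
    fix n and x :: "nat \<Rightarrow> 'b" and c
    assume x: "\<forall>j<n. x j \<in> S"
    have "(\<Sum>j<n. \<Sum>k<n. (\<integral>v. N v (x j) (x k) \<partial>M) * K (x j) (x k) * c j * cnj (c k))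
      = (\<integral>v. (\<Sum>j<n. \<Sum>k<n. N v (x j) (x k) * K (x j) (x k) * c j * cnj (c k)) \<partial>M)"
    proof -
      have "integrable M (\<lambda>v. N v (x j) (x k) * K (x j) (x k) * c j * cnj (c k))" if "j < n" "k < n" for j k
        using x assms(2) that by (intro integrable_continuous continuous_intros) auto
      note int = this
      have "(\<Sum>j<n. \<Sum>k<n. (\<integral>v. N v (x j) (x k) \<partial>M) * K (x j) (x k) * c j * cnj (c k))
        = (\<Sum>j<n. \<Sum>k<n. \<integral>v. N v (x j) (x k) * K (x j) (x k) * c j * cnj (c k) \<partial>M)"
        by simp
      also have "\<dots> = (\<Sum>j<n. \<integral>v. (\<Sum>k<n. N v (x j) (x k) * K (x j) (x k) * c j * cnj (c k)) \<partial>M)"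
        using int by (intro sum.cong refl Bochner_Integration.integral_sum[symmetric]) auto
      also have "\<dots> = (\<integral>v. (\<Sum>j<n. \<Sum>k<n. N v (x j) (x k) * K (x j) (x k) * c j * cnj (c k)) \<partial>M)"
        using int by (intro Bochner_Integration.integral_sum[symmetric] integrable_sum) auto
      finally show ?thesis .
    qed
    also have "\<dots> \<in> nonneg_Reals"
    proof (rule integral_nonneg_Reals)
      show "continuous_on UNIV (\<lambda>v. \<Sum>j<n. \<Sum>k<n. N v (x j) (x k) * K (x j) (x k) * c j * cnj (c k))"
        using x assms(2) by (intro continuous_intros) auto
      show "(\<Sum>j<n. \<Sum>k<n. N v (x j) (x k) * K (x j) (x k) * c j * cnj (c k)) \<in> nonneg_Reals"
        if "v \<in> C" for v
        using pdkD[OF pd_mult_pdk[OF assms(1)[OF that] K]] x by simp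
    qed
    finally show "(\<Sum>j<n. \<Sum>k<n. (\<integral>v. N v (x j) (x k) \<partial>M) * K (x j) (x k) * c j * cnj (c k))
      \<in> nonneg_Reals" .
  qed
qed

end

text \<open>The map \<open>g\<close> serves both factors of a product of spheres, as
  \<open>fst\<close> or \<open>snd\<close>; the multiplier form allows two such kernels to be
  multiplied with each other and with \<open>f\<close>.\<close>

lemma pd_mult_zpoly:
  fixes g :: "'a \<Rightarrow> complex^'n"
  assumes card: "CARD('n) \<ge> 2" and g: "\<And>x. x \<in> S \<Longrightarrow> norm (g x) = 1"
  shows "pd_mult S (\<lambda>x y. zpoly (CARD('n) - 2) m n (hip (g x) (g y)))"
proof -
  obtain \<sigma> :: "(complex^'n) measure" where "unitary_measure \<sigma>" using unitary_measure_exists by blast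
  then interpret unitary_measure \<sigma> .
  define i where "i = (undefined :: 'n)"
  have "pd_mult S (\<lambda>x y. zonal m n (g x) (g y))"
    unfolding zonal_def
  proof (rule pd_mult_integral)
    fix v :: "complex^'n" assume "v \<in> sphere 0 1"
    then have "hip v v = 1" by (simp add: hip_self)
    \<comment> \<open>The projection of \<open>g x\<close> to the orthogonal complement of
      \<open>v\<close>; its Gram kernel is the difference that \<open>zonal\<close> raises to the
      power \<open>m\<close>.\<close>
    define P where "P x = g x - hip v (g x) *s v" for x
    have "hip (P x) (P y) = hip (g x) (g y) - hip (g x) v * hip v (g y)" for x y
      unfolding P_def hip_linear \<open>hip v v = 1\<close> hip_commute[of "g x" v] by simp
    moreover have "cnj (hip (g x) v * hip v (g y)) = hip v (g x) * cnj (hip v (g y))" for x y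
      unfolding complex_cnj_mult hip_commute[of v "g x", symmetric] ..
    ultimately show "pd_mult S (\<lambda>x y. (hip (g x) (g y) - hip (g x) v * hip v (g y)) ^ m
        * cnj (hip (g x) v * hip v (g y)) ^ n)"
      using pd_mult_mult[OF pd_mult_power[OF pd_mult_hip[of S P], of m]
        pd_mult_power[OF pd_mult_rank1[of S "\<lambda>x. hip v (g x)"], of n]]
      by (simp only:)
  qed (intro continuous_intros)
  from pd_mult_mult[OF pd_mult_const[of "1 / zonal_const i m n" S] this]
  have "pd_mult S (\<lambda>x y. complex_of_real (1 / zonal_const i m n) * zonal m n (g x) (g y))"
    using zonal_const_pos[OF card, of i m n] by simp
  then show ?thesis
    using zonal_const_pos[OF card, of i m n] g
    by (subst (asm) pd_mult_cong) (auto simp: zonal_eq[OF card, of _ _ m n i])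
qed

lemma hip_surj:
  assumes card: "CARD('n) \<ge> 2" and z: "cmod z \<le> 1"
  obtains y :: "complex^'n" where "norm y = 1" "y $ i = z"
proof -
  obtain k :: 'n where ki: "i \<noteq> k"
    by (rule obtain_other_index[OF card])
  define r where "r = sqrt (1 - (cmod z)\<^sup>2)"
  define y :: "complex^'n" where "y = z *s axis i 1 + complex_of_real r *s axis k 1"
  have r: "r\<^sup>2 = 1 - (cmod z)\<^sup>2" using z by (simp add: r_def power_le_one)
  have yi: "y $ i = z" and yk: "y $ k = r" using ki by (simp_all add: y_def axis_def)
  have "hip y y = cnj z * y $ i + r * y $ k"
    by (subst (1) y_def) (simp add: hip_linear)
  also have "\<dots> = complex_of_real ((cmod z)\<^sup>2 + r\<^sup>2)"
    by (simp add: yi yk of_real_cmod_square power2_eq_square[of "complex_of_real r"] mult.commute)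
  finally have "(norm y)\<^sup>2 = 1" by (simp add: norm_sq_hip r)
  then have "norm y = 1" using power2_eq_imp_eq[of "norm y" 1] by simp
  then show ?thesis using that yi by blast
qed

text \<open>\<open>pdk_bound\<close> for the kernel on the sphere, at \<open>axis i 1\<close> and a
  unit vector whose \<open>i\<close>-th coordinate is \<open>z\<close>; the diagonal values are
  1.\<close>

lemma norm_zpoly_le:
  assumes card: "CARD('n::finite) \<ge> 2" and z: "cmod z \<le> 1"
  shows "cmod (zpoly (CARD('n) - 2) m n z) \<le> 1"
proof -
  define i where "i = (undefined :: 'n)"
  obtain y :: "complex^'n" where y: "norm y = 1" "y $ i = z" by (rule hip_surj[OF card z])
  define K where "K x y = zpoly (CARD('n) - 2) m n (hip x (y :: complex^'n))" for x y
  have "cmod (K (axis i 1) y) \<le> 1"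
  proof (rule pdk_bound[of "sphere 0 1" K])
    show "pdk (sphere 0 1) K"
      unfolding K_def by (rule pd_mult_imp_pdk, rule pd_mult_zpoly[OF card]) simp
    show "K y (axis i 1) = cnj (K (axis i 1) y)"
      unfolding K_def zpoly_cnj[symmetric] by simp
  qed (simp_all add: y norm_axis_1 K_def hip_self)
  then show ?thesis by (simp add: K_def y)
qed

section \<open>Orthogonality\<close>

context unitary_measure
begin

lemma supported_prob_square: "supported_prob (\<sigma> \<Otimes>\<^sub>M \<sigma>) (sphere 0 1 \<times> sphere 0 1)"
  by (intro supported_prob_pair supported_prob_axioms)

text \<open>Rotating the phase of the \<open>v\<close>-component of \<open>y\<close> multiplies each monomial of the integrand by a
  nontrivial character.\<close>

lemma integral_highest_weight:
  assumes v: "norm v = 1" and b: "b < n"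
  shows "(\<integral>y. (hip x y - hip x v * hip v y) ^ m * cnj (hip x v * hip v y) ^ n
      * (cnj (hip x y) ^ a * hip x y ^ b) \<partial>\<sigma>) = 0"
proof -
  define A where "A y = hip x v * hip v y" for y
  define B where "B y = hip x y - A y" for y
  have contA: "continuous_on UNIV A" and contB: "continuous_on UNIV B"
    unfolding A_def B_def by (intro continuous_intros)+
  define T where "T j k y = of_nat (a choose j) * of_nat (b choose k)
      * (B y ^ m * cnj (B y) ^ (a - j) * B y ^ (b - k) * (cnj (A y) ^ (n + j) * A y ^ k))" for j k y
  have contT: "continuous_on UNIV (T j k)" for j k
    unfolding T_def by (intro continuous_intros contA contB)
  have T0: "integral\<^sup>L \<sigma> (T j k) = 0" if "k \<le> b" for j k
  proof (rule integral_rot_zero[OF contT v])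
    show "k \<noteq> n + j" using that b by simp
    fix c and y :: "complex^'n"
    have A: "A (rot c v *v y) = c * A y"
      by (simp add: A_def hip_rot hip_self v algebra_simps)
    have B: "B (rot c v *v y) = B y"
      by (simp add: B_def A) (simp add: A_def hip_rot algebra_simps)
    show "T j k (rot c v *v y) = c ^ k * cnj c ^ (n + j) * T j k y"
      unfolding T_def A B complex_cnj_mult power_mult_distrib by (simp only: mult_ac)
  qed
  have "(\<integral>y. (hip x y - hip x v * hip v y) ^ m * cnj (hip x v * hip v y) ^ n
      * (cnj (hip x y) ^ a * hip x y ^ b) \<partial>\<sigma>) = (\<integral>y. (\<Sum>j\<le>a. \<Sum>k\<le>b. T j k y) \<partial>\<sigma>)"
  proof (rule Bochner_Integration.integral_cong[OF refl])
    fix y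
    have x: "hip x y = A y + B y" by (simp add: B_def)
    have "(hip x y - hip x v * hip v y) ^ m * cnj (hip x v * hip v y) ^ n * (cnj (hip x y) ^ a * hip x y ^ b)
      = B y ^ m * cnj (A y) ^ n * ((cnj (A y) + cnj (B y)) ^ a * (A y + B y) ^ b)"
      unfolding A_def[symmetric] B_def[symmetric] x by simp
    also have "\<dots> = (\<Sum>j\<le>a. \<Sum>k\<le>b. T j k y)"
      unfolding binomial_ring sum_product unfolding sum_distrib_left T_def
      by (intro sum.cong refl) (simp only: power_add mult_ac)
    finally show "(hip x y - hip x v * hip v y) ^ m * cnj (hip x v * hip v y) ^ n
      * (cnj (hip x y) ^ a * hip x y ^ b) = (\<Sum>j\<le>a. \<Sum>k\<le>b. T j k y)" .
  qed
  also have "\<dots> = (\<Sum>j\<le>a. \<Sum>k\<le>b. integral\<^sup>L \<sigma> (T j k))"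
    using contT by (simp add: Bochner_Integration.integral_sum integrable_continuous)
  also have "\<dots> = 0" using T0 by (intro sum.neutral ballI) auto
  finally show ?thesis .
qed

text \<open>Replace the polynomial by its average over \<open>v\<close>, valid for unit
  \<open>y\<close> and hence almost everywhere, and exchange the integrals; the inner one vanishes
  by \<open>integral_highest_weight\<close>. Only the exponent of the unconjugated coordinate has to
  be small.\<close>

lemma integral_zpoly_monomial:
  assumes card: "CARD('n) \<ge> 2" and b: "b < n"
  shows "(\<integral>y. zpoly (CARD('n) - 2) m n (y $ i) * (cnj (y $ i) ^ a * (y $ i) ^ b) \<partial>\<sigma>) = 0"
proof -
  interpret P: supported_prob "\<sigma> \<Otimes>\<^sub>M \<sigma>" "sphere 0 1 \<times> sphere 0 1" by (rule supported_prob_square)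
  interpret PP: pair_prob_space \<sigma> \<sigma> ..
  define e :: "complex^'n" where "e = axis i 1"
  define \<kappa> where "\<kappa> = complex_of_real (zonal_const i m n)"
  have \<kappa>: "\<kappa> \<noteq> 0" using zonal_const_pos[OF card, of i m n] by (simp add: \<kappa>_def)
  define g where "g y v = (hip e y - hip e v * hip v y) ^ m * cnj (hip e v * hip v y) ^ n
      * (cnj (hip e y) ^ a * hip e y ^ b)" for y v
  have g_int: "integrable (\<sigma> \<Otimes>\<^sub>M \<sigma>) (\<lambda>(y, v). g y v)"
    unfolding case_prod_unfold g_def by (intro P.integrable_continuous continuous_intros)
  have "\<kappa> * (\<integral>y. zpoly (CARD('n) - 2) m n (y $ i) * (cnj (y $ i) ^ a * (y $ i) ^ b) \<partial>\<sigma>)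
    = (\<integral>y. \<kappa> * zpoly (CARD('n) - 2) m n (y $ i) * (cnj (y $ i) ^ a * (y $ i) ^ b) \<partial>\<sigma>)"
    by (simp add: mult.assoc)
  also have "\<dots> = (\<integral>y. (\<integral>v. g y v \<partial>\<sigma>) \<partial>\<sigma>)"
  proof (rule integral_cong_AE)
    show "(\<lambda>y. \<kappa> * zpoly (CARD('n) - 2) m n (y $ i) * (cnj (y $ i) ^ a * (y $ i) ^ b)) \<in> borel_measurable \<sigma>"
      by (intro measurable_continuous continuous_intros)
    show "(\<lambda>y. \<integral>v. g y v \<partial>\<sigma>) \<in> borel_measurable \<sigma>"
      using PP.integrable_fst[OF g_int] by (rule borel_measurable_integrable)
    have "\<kappa> * zpoly (CARD('n) - 2) m n (y $ i) * (cnj (y $ i) ^ a * (y $ i) ^ b) = (\<integral>v. g y v \<partial>\<sigma>)"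
      if "norm y = 1" for y
      using zonal_axis[OF card that, of m n i]
      by (simp add: g_def \<kappa>_def e_def zonal_def)
    then show "AE y in \<sigma>. \<kappa> * zpoly (CARD('n) - 2) m n (y $ i) * (cnj (y $ i) ^ a * (y $ i) ^ b)
        = (\<integral>v. g y v \<partial>\<sigma>)"
      using AE_C by auto
  qed
  also have "\<dots> = (\<integral>v. (\<integral>y. g y v \<partial>\<sigma>) \<partial>\<sigma>)"
    by (rule PP.Fubini_integral[OF g_int, symmetric])
  also have "\<dots> = 0"
  proof (rule integral_eq_zero_AE)
    show "AE v in \<sigma>. (\<integral>y. g y v \<partial>\<sigma>) = 0"
      using AE_C unfolding g_def
      by eventually_elim (rule integral_highest_weight[OF _ b], simp)
  qed
  finally show ?thesis using \<kappa> by simp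
qed

text \<open>Each factor \<open>1 - y $ i * cnj (y $ i)\<close> splits the integral into one with
  exponents \<open>a\<close>, \<open>b\<close> and one with both raised by 1, so
  \<open>b + s\<close> is the largest exponent that can occur.\<close>

lemma integral_zpoly_lower:
  assumes card: "CARD('n) \<ge> 2" and "b + s < n"
  shows "(\<integral>y. zpoly (CARD('n) - 2) m n (y $ i)
      * ((1 - y $ i * cnj (y $ i)) ^ s * (cnj (y $ i) ^ a * (y $ i) ^ b)) \<partial>\<sigma>) = 0"
  using assms(2)
proof (induction s arbitrary: a b)
  case 0
  then show ?case using integral_zpoly_monomial[OF card, of b n m i a] by simp
next
  case (Suc s)
  define g where "g a b y = zpoly (CARD('n) - 2) m n (y $ i)
      * ((1 - y $ i * cnj (y $ i)) ^ s * (cnj (y $ i) ^ a * (y $ i) ^ b))" for a b y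
  have gi: "integrable \<sigma> (g a b)" for a b
    unfolding g_def by (intro integrable_continuous continuous_intros)
  have "zpoly (CARD('n) - 2) m n (y $ i)
      * ((1 - y $ i * cnj (y $ i)) ^ Suc s * (cnj (y $ i) ^ a * (y $ i) ^ b))
    = g a b y - g (Suc a) (Suc b) y" for y
    by (simp add: g_def algebra_simps)
  then have "(\<integral>y. zpoly (CARD('n) - 2) m n (y $ i)
      * ((1 - y $ i * cnj (y $ i)) ^ Suc s * (cnj (y $ i) ^ a * (y $ i) ^ b)) \<partial>\<sigma>)
    = integral\<^sup>L \<sigma> (g a b) - integral\<^sup>L \<sigma> (g (Suc a) (Suc b))"
    using gi by (simp only: Bochner_Integration.integral_diff)
  also have "\<dots> = 0"
    using Suc.IH[of b a] Suc.IH[of "Suc b" "Suc a"] Suc.prems by (simp add: g_def[abs_def])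
  finally show ?case .
qed

text \<open>In the conjugated polynomial the summand \<open>s\<close> has unconjugated degree at
  most \<open>(n' - s) + s = n'\<close>, which is below \<open>n\<close>.\<close>

lemma integral_zpoly_orthogonal_less:
  assumes card: "CARD('n) \<ge> 2" and "n' < n"
  shows "(\<integral>y. zpoly (CARD('n) - 2) m n (y $ i) * cnj (zpoly (CARD('n) - 2) m' n' (y $ i)) \<partial>\<sigma>) = 0"
proof -
  define \<alpha> where "\<alpha> = CARD('n) - 2"
  define \<gamma> where "\<gamma> s = complex_of_real ((-1) ^ s * real (m' choose s) * real (n' choose s) / real ((\<alpha> + s) choose s))" for s
  define g where "g s y = zpoly \<alpha> m n (y $ i)
      * ((1 - y $ i * cnj (y $ i)) ^ s * (cnj (y $ i) ^ (m' - s) * (y $ i) ^ (n' - s)))" for s y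
  have gi: "integrable \<sigma> (g s)" for s
    unfolding g_def by (intro integrable_continuous continuous_intros)
  have g0: "integral\<^sup>L \<sigma> (g s) = 0" if "s \<le> n'" for s
    using integral_zpoly_lower[OF card, of "n' - s" s n m i "m' - s"] that assms(2)
    by (simp add: g_def[abs_def] \<alpha>_def)
  have "zpoly \<alpha> m n z * cnj (zpoly \<alpha> m' n' z) = (\<Sum>s\<le>min m' n'. \<gamma> s * (zpoly \<alpha> m n z
      * ((1 - z * cnj z) ^ s * (cnj z ^ (m' - s) * z ^ (n' - s)))))" for z
    unfolding zpoly_def[of _ m' n'] cnj_sum sum_distrib_left \<gamma>_def complex_cnj_mult complex_cnj_power
      complex_cnj_diff complex_cnj_one complex_cnj_cnj complex_cnj_complex_of_real
    by (intro sum.cong refl) (simp only: mult_ac)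
  then have "(\<integral>y. zpoly \<alpha> m n (y $ i) * cnj (zpoly \<alpha> m' n' (y $ i)) \<partial>\<sigma>)
    = (\<integral>y. (\<Sum>s\<le>min m' n'. \<gamma> s * g s y) \<partial>\<sigma>)"
    by (simp only: g_def)
  also have "\<dots> = (\<Sum>s\<le>min m' n'. \<integral>y. \<gamma> s * g s y \<partial>\<sigma>)"
    using gi by (intro Bochner_Integration.integral_sum integrable_mult_right) simp
  also have "\<dots> = 0" using g0 by (intro sum.neutral ballI) simp
  finally show ?thesis by (simp add: \<alpha>_def)
qed

text \<open>Conjugation swaps the two indices of a disc polynomial. This turns a difference between
  \<open>m\<close> and \<open>m'\<close> into one between second indices, and conjugating the
  integral reverses the inequality.\<close>

lemma integral_zpoly_orthogonal:
  assumes card: "CARD('n) \<ge> 2" and "(m, n) \<noteq> (m', n')"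
  shows "(\<integral>y. zpoly (CARD('n) - 2) m n (y $ i) * cnj (zpoly (CARD('n) - 2) m' n' (y $ i)) \<partial>\<sigma>) = 0"
proof -
  define I where "I m n m' n' = (\<integral>y. zpoly (CARD('n) - 2) m n (y $ i)
      * cnj (zpoly (CARD('n) - 2) m' n' (y $ i)) \<partial>\<sigma>)" for m n m' n'
  have less: "I m n m' n' = 0" if "n' < n" for m n m' n'
    unfolding I_def by (rule integral_zpoly_orthogonal_less[OF card that])
  have sym: "I m n m' n' = I n' m' n m" for m n m' n'
    unfolding I_def cnj_zpoly by (simp only: mult.commute)
  have cnj: "I m n m' n' = cnj (I m' n' m n)" for m n m' n'
    unfolding I_def by (simp add: mult.commute flip: Bochner_Integration.integral_cnj)
  from assms(2) consider "n' < n" | "n < n'" | "m < m'" | "m' < m" by force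
  then have "I m n m' n' = 0"
    by cases (use less sym cnj in \<open>metis complex_cnj_zero\<close>)+
  then show ?thesis by (simp add: I_def)
qed

end

section \<open>Integration of positive definite kernels\<close>

lemma continuous_on_uncurried:
  assumes "continuous_on UNIV (\<lambda>p. G (fst p) (snd p))" "continuous_on S a" "continuous_on S b"
  shows "continuous_on S (\<lambda>x. G (a x) (b x))"
  using continuous_on_compose2[OF assms(1) continuous_on_Pair[OF assms(2,3)]] by simp

context supported_prob
begin

text \<open>The double integral is a limit of Riemann sums over products of small pieces of
  \<open>C\<close>. Each sum is a quadratic form of \<open>K\<close> whose coefficients are the
  measures of the pieces, so it is nonnegative, and the nonnegative reals are closed.\<close>

lemma integral_pdk_nonneg:
  assumes K: "continuous_on UNIV (\<lambda>p. K (fst p) (snd p))" and pd: "pdk C K"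
  shows "(\<integral>p. K (fst p) (snd p) \<partial>(M \<Otimes>\<^sub>M M)) \<in> nonneg_Reals"
proof -
  interpret P: supported_prob "M \<Otimes>\<^sub>M M" "C \<times> C"
    by (intro supported_prob_pair supported_prob_axioms)
  interpret PP: pair_prob_space M M ..
  define I where "I = (\<integral>p. K (fst p) (snd p) \<partial>(M \<Otimes>\<^sub>M M))"
  have "\<exists>J\<in>nonneg_Reals. dist J I < \<epsilon>" if "\<epsilon> > 0" for \<epsilon>
  proof -
    have "uniformly_continuous_on (C \<times> C) (\<lambda>p. K (fst p) (snd p))"
      using K by (intro compact_uniformly_continuous P.compact_C) (auto intro: continuous_on_subset)
    then obtain \<delta> where \<delta>: "\<delta> > 0" "\<And>p q. p \<in> C \<times> C \<Longrightarrow> q \<in> C \<times> C \<Longrightarrow> dist p q < \<delta> \<Longrightarrow>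
        dist (K (fst p) (snd p)) (K (fst q) (snd q)) < \<epsilon> / 2"
      unfolding uniformly_continuous_on_def using \<open>\<epsilon> > 0\<close> by (metis half_gt_zero)
    have "C \<subseteq> (\<Union>y\<in>C. ball y (\<delta> / 2))" using \<delta>(1) by auto
    then obtain Y where Y: "finite Y" "Y \<subseteq> C" "C \<subseteq> (\<Union>y\<in>Y. ball y (\<delta> / 2))"
      by (rule compactE_image[OF compact_C open_ball])
    obtain n and y :: "nat \<Rightarrow> 'a" where y: "Y = y ` {..<n}"
      using Y(1) by (metis finite_imp_nat_seg_image_inj_on lessThan_def)
    \<comment> \<open>The covering balls made disjoint. The sample point \<open>y i\<close> need not
      lie in \<open>X i\<close>; it suffices that it is in \<open>C\<close> and within
      \<open>\<delta> / 2\<close> of every point of \<open>X i\<close>.\<close>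
    define X where "X i = (C \<inter> ball (y i) (\<delta> / 2)) - (\<Union>j<i. ball (y j) (\<delta> / 2))" for i
    have CB: "C \<in> sets borel" using compact_C by (rule borel_compact)
    have X_meas: "X i \<in> sets M" for i unfolding X_def using CB by auto
    have yC: "y i \<in> C" if "i < n" for i using Y(2) y that by auto
    have ex: "\<exists>i<n. x \<in> X i \<and> (\<forall>j<n. x \<in> X j \<longrightarrow> j = i)" if "x \<in> C" for x
    proof -
      define i where "i = (LEAST i. x \<in> ball (y i) (\<delta> / 2))"
      obtain i' where i': "i' < n" "x \<in> ball (y i') (\<delta> / 2)" using Y(3) y \<open>x \<in> C\<close> by auto
      have "x \<in> ball (y i) (\<delta> / 2)" unfolding i_def by (rule LeastI[of "\<lambda>i. x \<in> ball (y i) (\<delta> / 2)" i', OF i'(2)])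
      moreover have "x \<notin> ball (y j) (\<delta> / 2)" if "j < i" for j
        using not_less_Least[of j "\<lambda>i. x \<in> ball (y i) (\<delta> / 2)"] that by (simp add: i_def)
      ultimately have xi: "x \<in> X i" using \<open>x \<in> C\<close> by (auto simp: X_def)
      moreover have "i < n"
        unfolding i_def using i' by (meson Least_le le_less_trans)
      moreover have "j = i" if "x \<in> X j" for j
        using that xi by (cases j i rule: linorder_cases) (auto simp: X_def)
      ultimately show ?thesis by blast
    qed
    define G where "G p = (\<Sum>i<n. \<Sum>j<n. indicat_real (X i \<times> X j) p *\<^sub>R K (y i) (y j))" for p
    define J where "J = (\<Sum>i<n. \<Sum>j<n. K (y i) (y j) * of_real (measure M (X i)) * cnj (of_real (measure M (X j))))"
    have J: "J \<in> nonneg_Reals"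
      unfolding J_def by (rule pdkD[OF pd]) (rule yC)
    have XX: "X i \<times> X j \<in> sets (M \<Otimes>\<^sub>M M)" for i j using X_meas by simp
    have int1: "integrable (M \<Otimes>\<^sub>M M) (\<lambda>p. indicat_real (X i \<times> X j) p *\<^sub>R K (y i) (y j))" for i j
      using XX by (intro integrable_scaleR_left integrable_real_indicator) (auto simp: less_top[symmetric])
    have Gint: "integrable (M \<Otimes>\<^sub>M M) G"
      unfolding G_def by (intro Bochner_Integration.integrable_sum int1)
    have m: "measure (M \<Otimes>\<^sub>M M) (X i \<times> X j) = measure M (X i) * measure M (X j)" for i j
      using X_meas by (simp add: measure_def emeasure_pair_measure_Times enn2real_mult)
    have GJ: "integral\<^sup>L (M \<Otimes>\<^sub>M M) G = J"
    proof -
      have "integral\<^sup>L (M \<Otimes>\<^sub>M M) G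
        = (\<Sum>i<n. \<Sum>j<n. \<integral>p. indicat_real (X i \<times> X j) p *\<^sub>R K (y i) (y j) \<partial>(M \<Otimes>\<^sub>M M))"
        unfolding G_def
        by (simp only: Bochner_Integration.integral_sum Bochner_Integration.integrable_sum int1)
      also have "\<dots> = J"
        unfolding J_def using XX
        by (intro sum.cong refl) (simp add: m scaleR_conv_of_real mult_ac del: space_M P.space_M)
      finally show ?thesis .
    qed
    have Kint: "integrable (M \<Otimes>\<^sub>M M) (\<lambda>p. K (fst p) (snd p))"
      by (rule P.integrable_continuous[OF K])
    have close: "norm (K (fst p) (snd p) - G p) \<le> \<epsilon> / 2" if pC: "p \<in> C \<times> C" for p
    proof -
      obtain x x' where p: "p = (x, x')" "x \<in> C" "x' \<in> C" using pC by auto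
      obtain i where i: "i < n" "x \<in> X i" "\<And>k. k < n \<Longrightarrow> x \<in> X k \<Longrightarrow> k = i" using ex[OF p(2)] by blast
      obtain j where j: "j < n" "x' \<in> X j" "\<And>k. k < n \<Longrightarrow> x' \<in> X k \<Longrightarrow> k = j" using ex[OF p(3)] by blast
      have "G p = (\<Sum>k<n. if k = i then K (y i) (y j) else 0)"
        unfolding G_def
      proof (rule sum.cong[OF refl])
        fix k assume k: "k \<in> {..<n}"
        have xk: "x \<in> X k \<longleftrightarrow> k = i" using i(2) i(3)[of k] k by auto
        have xl: "x' \<in> X l \<longleftrightarrow> l = j" if "l < n" for l using j(2) j(3)[of l] that by auto
        have "(\<Sum>l<n. indicat_real (X k \<times> X l) p *\<^sub>R K (y k) (y l))
          = (\<Sum>l<n. if l = j then (if k = i then K (y i) (y j) else 0) else 0)"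
          by (intro sum.cong refl) (auto simp: indicator_def p(1) xk xl)
        then show "(\<Sum>l<n. indicat_real (X k \<times> X l) p *\<^sub>R K (y k) (y l)) = (if k = i then K (y i) (y j) else 0)"
          using j(1) by simp
      qed
      then have G: "G p = K (y i) (y j)" using i(1) by simp
      have "dist x (y i) < \<delta> / 2" "dist x' (y j) < \<delta> / 2"
        using i(2) j(2) by (auto simp: X_def dist_commute)
      then have "dist p (y i, y j) < \<delta>"
        unfolding p dist_Pair_Pair using sqrt_sum_squares_le_sum[of "dist x (y i)" "dist x' (y j)"] by simp
      then have "dist (K (fst p) (snd p)) (K (fst (y i, y j)) (snd (y i, y j))) < \<epsilon> / 2"
        using pC yC[OF i(1)] yC[OF j(1)] by (intro \<delta>(2)) auto
      then show ?thesis by (simp add: G dist_norm)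
    qed
    have "norm (I - J) = norm (\<integral>p. K (fst p) (snd p) - G p \<partial>(M \<Otimes>\<^sub>M M))"
      unfolding I_def GJ[symmetric] by (simp add: Bochner_Integration.integral_diff[OF Kint Gint])
    also have "\<dots> \<le> (\<integral>p. norm (K (fst p) (snd p) - G p) \<partial>(M \<Otimes>\<^sub>M M))" by (rule integral_norm_bound)
    also have "\<dots> \<le> (\<integral>p. \<epsilon> / 2 \<partial>(M \<Otimes>\<^sub>M M))"
      using P.AE_C close Kint Gint by (intro integral_mono_AE integrable_norm Bochner_Integration.integrable_diff) auto
    also have "\<dots> = \<epsilon> / 2" using P.prob_space by simp
    finally have "dist J I < \<epsilon>" using \<open>\<epsilon> > 0\<close> by (simp add: dist_norm norm_minus_commute)
    then show ?thesis using J by blast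
  qed
  then have "I \<in> closure nonneg_Reals" unfolding closure_approachable by blast
  then show ?thesis by (simp add: I_def closure_closed)
qed

end

text \<open>The measure on the bidisc for which the products of disc polynomials are orthogonal.
  Taking it as an image measure lets all integrals be computed on the spheres, without a
  density.\<close>

definition disc_measure :: "(complex^'q) measure \<Rightarrow> (complex^'p) measure \<Rightarrow> 'q \<Rightarrow> 'p \<Rightarrow> (complex \<times> complex) measure"
  where "disc_measure \<sigma> \<tau> i j = distr (\<sigma> \<Otimes>\<^sub>M \<tau>) borel (\<lambda>(x, y). (x $ i, y $ j))"

locale unitary_pair = Q: unitary_measure \<sigma> + P: unitary_measure \<tau>
  for \<sigma> :: "(complex^'q) measure" and \<tau> :: "(complex^'p) measure" +
  fixes i :: 'q and j :: 'p
  assumes card_q: "CARD('q) \<ge> 2" and card_p: "CARD('p) \<ge> 2"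
begin

definition \<mu> where "\<mu> = disc_measure \<sigma> \<tau> i j"

sublocale N: supported_prob "\<sigma> \<Otimes>\<^sub>M \<tau>" "sphere 0 1 \<times> sphere 0 1"
  by (intro supported_prob_pair Q.supported_prob_axioms P.supported_prob_axioms)

sublocale QP: pair_prob_space \<sigma> \<tau> ..

lemma proj_measurable: "(\<lambda>(x, y). (x $ i, y $ j)) \<in> measurable (\<sigma> \<Otimes>\<^sub>M \<tau>) borel"
  unfolding case_prod_unfold by (intro N.measurable_continuous continuous_intros)

text \<open>Full support passes from the spheres to the bidisc because the coordinate map is onto
  it, by \<open>hip_surj\<close> with \<open>card_q\<close> and \<open>card_p\<close>.\<close>

sublocale D: supported_prob \<mu> "cball 0 1 \<times> cball 0 1"
proof -
  interpret D: prob_space \<mu>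
    unfolding \<mu>_def disc_measure_def by (rule N.prob_space_distr[OF proj_measurable])
  show "supported_prob \<mu> (cball 0 1 \<times> cball 0 1)"
  proof
    show "sets \<mu> = sets borel" by (simp add: \<mu>_def disc_measure_def)
    show "compact (cball 0 1 \<times> cball 0 1 :: (complex \<times> complex) set)" by (intro compact_Times) auto
    have "(case p of (x, y) \<Rightarrow> (x $ i, y $ j)) \<in> cball 0 1 \<times> cball 0 1" if "p \<in> sphere 0 1 \<times> sphere 0 1"
      for p :: "(complex^'q) \<times> (complex^'p)"
      using that Finite_Cartesian_Product.norm_nth_le[of "fst p" i]
        Finite_Cartesian_Product.norm_nth_le[of "snd p" j] by auto
    then have "AE p in \<sigma> \<Otimes>\<^sub>M \<tau>. (case p of (x, y) \<Rightarrow> (x $ i, y $ j)) \<in> cball 0 1 \<times> cball 0 1"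
      using N.AE_C by auto
    moreover have "{p \<in> space borel. p \<in> cball 0 1 \<times> cball 0 1} \<in> sets (borel :: (complex \<times> complex) measure)"
      by (simp add: borel_closed closed_Times)
    ultimately show "AE p in \<mu>. p \<in> cball 0 1 \<times> cball 0 1"
      unfolding \<mu>_def disc_measure_def by (subst AE_distr_iff[OF proj_measurable]) auto
    fix W :: "(complex \<times> complex) set" and p assume W: "open W" "p \<in> W" "p \<in> cball 0 1 \<times> cball 0 1"
    have p: "cmod (fst p) \<le> 1" "cmod (snd p) \<le> 1" using W(3) by auto
    obtain x :: "complex^'q" where x: "norm x = 1" "x $ i = fst p" by (rule hip_surj[OF card_q p(1)])
    obtain y :: "complex^'p" where y: "norm y = 1" "y $ j = snd p" by (rule hip_surj[OF card_p p(2)])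
    have op: "open ((\<lambda>(x, y). (x $ i, y $ j)) -` W :: ((complex^'q) \<times> (complex^'p)) set)"
      unfolding case_prod_unfold by (intro open_vimage W(1) continuous_intros)
    have "0 < measure (\<sigma> \<Otimes>\<^sub>M \<tau>) ((\<lambda>(x, y). (x $ i, y $ j)) -` W)"
      by (rule N.full_support[OF op, of "(x, y)"]) (use x y W in auto)
    also have "\<dots> = measure \<mu> W"
      unfolding \<mu>_def disc_measure_def using W(1) by (subst measure_distr[OF proj_measurable]) auto
    finally show "measure \<mu> W > 0" .
  qed
qed

lemma integral_\<mu>:
  assumes "continuous_on UNIV (\<lambda>p. g (fst p) (snd p) :: complex)"
  shows "(\<integral>p. g (fst p) (snd p) \<partial>\<mu>) = (\<integral>p. g (fst p $ i) (snd p $ j) \<partial>(\<sigma> \<Otimes>\<^sub>M \<tau>))"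
    and "(\<integral>p. g (fst p) (snd p) \<partial>\<mu>) = (\<integral>x. \<integral>y. g (x $ i) (y $ j) \<partial>\<tau> \<partial>\<sigma>)"
proof -
  show 1: "(\<integral>p. g (fst p) (snd p) \<partial>\<mu>) = (\<integral>p. g (fst p $ i) (snd p $ j) \<partial>(\<sigma> \<Otimes>\<^sub>M \<tau>))"
    unfolding \<mu>_def disc_measure_def
    by (subst integral_distr[OF proj_measurable])
      (auto intro!: borel_measurable_continuous_onI assms simp: case_prod_unfold)
  have c: "continuous_on UNIV (\<lambda>p :: (complex^'q) \<times> (complex^'p). g (fst p $ i) (snd p $ j))"
    by (intro continuous_on_uncurried[OF assms] continuous_intros)
  show "(\<integral>p. g (fst p) (snd p) \<partial>\<mu>) = (\<integral>x. \<integral>y. g (x $ i) (y $ j) \<partial>\<tau> \<partial>\<sigma>)"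
    unfolding 1 using QP.integral_fst'[OF N.integrable_continuous[OF c]] by simp
qed

lemma integral_\<mu>_prod:
  fixes g h :: "complex \<Rightarrow> complex"
  assumes "continuous_on UNIV g" "continuous_on UNIV h"
  shows "(\<integral>p. g (fst p) * h (snd p) \<partial>\<mu>) = (\<integral>x. g (x $ i) \<partial>\<sigma>) * (\<integral>y. h (y $ j) \<partial>\<tau>)"
proof -
  have "continuous_on UNIV (\<lambda>p. g (fst p) * h (snd p) :: complex)"
    by (intro continuous_intros continuous_on_compose2[OF assms(1)] continuous_on_compose2[OF assms(2)]) auto
  from integral_\<mu>(2)[OF this] show ?thesis by simp
qed

text \<open>By unitary invariance the double integral of the kernel collapses to a single integral.\<close>

lemma integral_\<mu>_nonneg:
  assumes G: "continuous_on UNIV (\<lambda>p. G (fst p) (snd p) :: complex)"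
    and pd: "pdk (sphere 0 1 \<times> sphere 0 1)
      (\<lambda>x y :: (complex^'q) \<times> (complex^'p). G (hip (fst x) (fst y)) (hip (snd x) (snd y)))"
  shows "(\<integral>p. G (fst p) (snd p) \<partial>\<mu>) \<in> nonneg_Reals"
proof -
  define K where "K x y = G (hip (fst x) (fst y)) (hip (snd x) (snd y))" for x y :: "(complex^'q) \<times> (complex^'p)"
  note contG = continuous_on_uncurried[OF G]
  have contK: "continuous_on UNIV (\<lambda>p. K (fst p) (snd p))"
    unfolding K_def by (intro contG continuous_intros)
  define \<Lambda> where "\<Lambda> = (\<integral>p. G (fst p) (snd p) \<partial>\<mu>)"
  have inner: "(\<integral>y. K x y \<partial>(\<sigma> \<Otimes>\<^sub>M \<tau>)) = \<Lambda>" if x: "x \<in> sphere 0 1 \<times> sphere 0 1" for x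
  proof -
    obtain A where A: "A \<in> unitary_group" "A *v fst x = axis i 1"
      by (rule unitary_transitive[of "fst x" "axis i 1"]) (use x in \<open>auto simp: norm_axis_1\<close>)
    obtain B where B: "B \<in> unitary_group" "B *v snd x = axis j 1"
      by (rule unitary_transitive[of "snd x" "axis j 1"]) (use x in \<open>auto simp: norm_axis_1\<close>)
    have hA: "hip (fst x) y = (A *v y) $ i" for y
      using hip_unitary[OF A(1), of "fst x" y] by (simp add: A(2))
    have hB: "hip (snd x) y = (B *v y) $ j" for y
      using hip_unitary[OF B(1), of "snd x" y] by (simp add: B(2))
    \<comment> \<open>The intermediate integrand with \<open>B\<close> already removed and
      \<open>A\<close> still present: invariance is used in one variable at a time, with Fubini in
      between.\<close>
    define H where "H y z = G ((A *v y) $ i) (z $ j)" for y :: "complex^'q" and z :: "complex^'p"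
    have i1: "integrable (\<sigma> \<Otimes>\<^sub>M \<tau>) (\<lambda>(y, z). H y z)"
      unfolding H_def case_prod_unfold by (intro N.integrable_continuous contG continuous_intros)
    have i2: "integrable (\<sigma> \<Otimes>\<^sub>M \<tau>) (\<lambda>(y, z). G (y $ i) (z $ j))"
      unfolding case_prod_unfold by (intro N.integrable_continuous contG continuous_intros)
    have "continuous_on UNIV (K x)" unfolding K_def by (intro contG continuous_intros)
    then have "(\<integral>y. K x y \<partial>(\<sigma> \<Otimes>\<^sub>M \<tau>)) = (\<integral>y. \<integral>z. K x (y, z) \<partial>\<tau> \<partial>\<sigma>)"
      by (intro QP.integral_fst'[symmetric] N.integrable_continuous)
    also have "\<dots> = (\<integral>y. \<integral>z. G ((A *v y) $ i) ((B *v z) $ j) \<partial>\<tau> \<partial>\<sigma>)"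
      by (simp add: K_def hA hB)
    also have "\<dots> = (\<integral>y. \<integral>z. H y z \<partial>\<tau> \<partial>\<sigma>)"
      unfolding H_def
      by (intro Bochner_Integration.integral_cong refl P.integral_unitary[OF B(1)] contG continuous_intros)
    also have "\<dots> = (\<integral>z. \<integral>y. H y z \<partial>\<sigma> \<partial>\<tau>)"
      by (rule QP.Fubini_integral[OF i1, symmetric])
    also have "\<dots> = (\<integral>z. \<integral>y. G (y $ i) (z $ j) \<partial>\<sigma> \<partial>\<tau>)"
      unfolding H_def
      by (intro Bochner_Integration.integral_cong refl Q.integral_unitary[OF A(1)] contG continuous_intros)
    also have "\<dots> = (\<integral>y. \<integral>z. G (y $ i) (z $ j) \<partial>\<tau> \<partial>\<sigma>)"
      by (rule QP.Fubini_integral[OF i2])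
    also have "\<dots> = \<Lambda>" unfolding \<Lambda>_def by (rule integral_\<mu>(2)[OF G, symmetric])
    finally show ?thesis .
  qed
  interpret NN: supported_prob "(\<sigma> \<Otimes>\<^sub>M \<tau>) \<Otimes>\<^sub>M (\<sigma> \<Otimes>\<^sub>M \<tau>)"
    "(sphere 0 1 \<times> sphere 0 1) \<times> (sphere 0 1 \<times> sphere 0 1)"
    by (intro supported_prob_pair N.supported_prob_axioms)
  interpret NP: pair_prob_space "\<sigma> \<Otimes>\<^sub>M \<tau>" "\<sigma> \<Otimes>\<^sub>M \<tau>" ..
  have Kint: "integrable ((\<sigma> \<Otimes>\<^sub>M \<tau>) \<Otimes>\<^sub>M (\<sigma> \<Otimes>\<^sub>M \<tau>)) (\<lambda>(x, y). K x y)"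
    unfolding case_prod_unfold by (rule NN.integrable_continuous[OF contK])
  have "(\<integral>p. K (fst p) (snd p) \<partial>((\<sigma> \<Otimes>\<^sub>M \<tau>) \<Otimes>\<^sub>M (\<sigma> \<Otimes>\<^sub>M \<tau>)))
    = (\<integral>x. (\<integral>y. K x y \<partial>(\<sigma> \<Otimes>\<^sub>M \<tau>)) \<partial>(\<sigma> \<Otimes>\<^sub>M \<tau>))"
    using NP.integral_fst[OF Kint] by (simp add: case_prod_unfold)
  also have "\<dots> = (\<integral>x. \<Lambda> \<partial>(\<sigma> \<Otimes>\<^sub>M \<tau>))"
  proof (rule integral_cong_AE)
    show "(\<lambda>x. \<integral>y. K x y \<partial>(\<sigma> \<Otimes>\<^sub>M \<tau>)) \<in> borel_measurable (\<sigma> \<Otimes>\<^sub>M \<tau>)"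
      using NP.integrable_fst[OF Kint] by (rule borel_measurable_integrable)
    show "AE x in \<sigma> \<Otimes>\<^sub>M \<tau>. (\<integral>y. K x y \<partial>(\<sigma> \<Otimes>\<^sub>M \<tau>)) = \<Lambda>"
      using N.AE_C by eventually_elim (rule inner)
  qed simp
  also have "\<dots> = \<Lambda>" using N.prob_space by simp
  finally show ?thesis
    using N.integral_pdk_nonneg[OF contK pd[folded K_def[abs_def]]] by (simp add: \<Lambda>_def)
qed

end

section \<open>Fourier expansion\<close>

context supported_prob
begin

text \<open>If \<open>g x0 < 0\<close>, then \<open>g < - e\<close> on a neighbourhood
  \<open>U\<close> of \<open>x0\<close>, and \<open>\<psi> \<le> \<rho> < 1\<close> on the rest of
  \<open>C\<close>. The rest contributes at most \<open>B * \<rho> ^ N\<close>, but near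
  \<open>x0\<close> there is a negative contribution of larger exponential order, so the integral is
  negative for large \<open>N\<close>.\<close>

lemma peak_nonneg:
  fixes g \<psi> :: "'a \<Rightarrow> real"
  assumes g: "continuous_on UNIV g" and \<psi>: "continuous_on UNIV \<psi>"
    and bd: "\<And>x. x \<in> C \<Longrightarrow> 0 \<le> \<psi> x" "\<And>x. x \<in> C \<Longrightarrow> \<psi> x \<le> 1"
    and x0: "x0 \<in> C" "\<psi> x0 = 1" "\<And>x. x \<in> C \<Longrightarrow> \<psi> x = 1 \<Longrightarrow> x = x0"
    and int: "\<And>N. 0 \<le> (\<integral>x. g x * \<psi> x ^ N \<partial>M)"
  shows "0 \<le> g x0"
proof (rule ccontr)
  assume neg: "\<not> 0 \<le> g x0"
  define e where "e = - g x0 / 2"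
  have e: "e > 0" using neg by (simp add: e_def)
  define U where "U = {x. g x < - e}"
  have U: "open U" unfolding U_def using g by (intro open_Collect_less continuous_intros)
  have x0U: "x0 \<in> U" using neg by (simp add: U_def e_def)
  obtain \<rho> where \<rho>: "0 \<le> \<rho>" "\<rho> < 1" "\<And>x. x \<in> C - U \<Longrightarrow> \<psi> x \<le> \<rho>"
  proof (cases "C - U = {}")
    case True
    then show ?thesis using that[of 0] by auto
  next
    case False
    have "compact (C - U)" using compact_C U by (rule compact_diff)
    then obtain x where x: "x \<in> C - U" "\<And>y. y \<in> C - U \<Longrightarrow> \<psi> y \<le> \<psi> x"
      using continuous_attains_sup[of "C - U" \<psi>] False continuous_on_subset[OF \<psi>] by blast
    have "\<psi> x \<noteq> 1" using x(1) x0(3)[of x] x0U by auto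
    then have "\<psi> x < 1" using bd(2)[of x] x(1) by auto
    then show ?thesis using that[of "\<psi> x"] x bd(1)[of x] by auto
  qed
  \<comment> \<open>Strictly between \<open>\<rho>\<close> and 1: the open set \<open>V\<close>
    where \<open>\<psi>\<close> exceeds it inside \<open>U\<close> contains \<open>x0\<close>, so it
    has positive measure \<open>m\<close> and contributes at most
    \<open>- e * m * \<rho>' ^ N\<close>.\<close>
  define \<rho>' where "\<rho>' = (1 + \<rho>) / 2"
  have \<rho>': "\<rho> < \<rho>'" "\<rho>' < 1" "0 < \<rho>'" using \<rho> by (simp_all add: \<rho>'_def)
  define V where "V = U \<inter> {x. \<rho>' < \<psi> x}"
  have V: "open V" unfolding V_def using U \<psi> by (intro open_Int open_Collect_less continuous_intros)
  define m where "m = measure M V"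
  have m: "m > 0" unfolding m_def by (rule full_support[OF V _ x0(1)]) (use x0U x0(2) \<rho>' in \<open>simp add: V_def\<close>)
  have "bounded (g ` C)"
    using g compact_C by (intro compact_imp_bounded compact_continuous_image) (auto intro: continuous_on_subset)
  then obtain B where B: "B > 0" "\<And>x. x \<in> C \<Longrightarrow> \<bar>g x\<bar> \<le> B" by (auto simp: bounded_pos)
  have V_meas: "V \<in> sets M" using V by simp
  have le: "g x * \<psi> x ^ N \<le> B * \<rho> ^ N - e * \<rho>' ^ N * indicat_real V x" if x: "x \<in> C" for x N
  proof (cases "x \<in> U")
    case True
    then have gx: "g x < - e" by (simp add: U_def)
    show ?thesis
    proof (cases "\<rho>' < \<psi> x")
      case True
      then have "\<rho>' ^ N \<le> \<psi> x ^ N" using \<rho>' by (intro power_mono) auto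
      then have "e * \<rho>' ^ N \<le> (- g x) * \<psi> x ^ N" using gx e \<rho>' by (intro mult_mono) auto
      moreover have "x \<in> V" using True \<open>x \<in> U\<close> by (simp add: V_def)
      moreover have "0 \<le> B * \<rho> ^ N" using B \<rho> by simp
      ultimately show ?thesis by simp
    next
      case False
      have "0 \<le> (- g x) * \<psi> x ^ N" using gx e bd(1)[OF x] by (intro mult_nonneg_nonneg) auto
      moreover have "0 \<le> B * \<rho> ^ N" using B \<rho> by simp
      ultimately show ?thesis using False by (simp add: V_def)
    qed
  next
    case False
    have "g x * \<psi> x ^ N \<le> B * \<rho> ^ N"
      using \<rho>(3)[of x] x False B(2)[OF x] bd(1)[OF x] B(1) by (intro mult_mono power_mono) auto
    then show ?thesis using False by (simp add: V_def)
  qed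
  have ineq: "e * m * \<rho>' ^ N \<le> B * \<rho> ^ N" for N
  proof -
    have ind: "integrable M (indicat_real V)"
      using V_meas by (intro integrable_real_indicator) (auto simp: less_top[symmetric])
    have "0 \<le> (\<integral>x. g x * \<psi> x ^ N \<partial>M)" by (rule int)
    also have "\<dots> \<le> (\<integral>x. B * \<rho> ^ N - e * \<rho>' ^ N * indicat_real V x \<partial>M)"
    proof (rule integral_mono_AE)
      show "integrable M (\<lambda>x. g x * \<psi> x ^ N)"
        by (intro integrable_continuous continuous_intros g \<psi>)
      show "integrable M (\<lambda>x. B * \<rho> ^ N - e * \<rho>' ^ N * indicat_real V x)"
        using ind by (intro Bochner_Integration.integrable_diff integrable_const integrable_mult_right)
    qed (use AE_C le in auto)
    also have "\<dots> = B * \<rho> ^ N - e * \<rho>' ^ N * m"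
      using V_meas ind by (simp add: m_def prob_space[unfolded space_M])
    finally show ?thesis by (simp add: mult_ac)
  qed
  have "e * m \<le> B * (\<rho> / \<rho>') ^ N" for N
    using ineq[of N] \<rho>' by (simp add: power_divide field_simps)
  moreover have "(\<lambda>N. B * (\<rho> / \<rho>') ^ N) \<longlonglongrightarrow> B * 0"
    using \<rho> \<rho>' by (intro tendsto_intros LIMSEQ_power_zero) (simp add: field_simps)
  ultimately have "e * m \<le> B * 0"
    by (intro LIMSEQ_le_const) auto
  then show False using e m mult_pos_pos[OF e m] by simp
qed

text \<open>Stated for any orthogonal, not normalised, family that is bounded by 1 and equals 1 at
  \<open>x0\<close>. Because of this, a bound on sums of coefficients comes from one value at
  \<open>x0\<close> and gives absolute convergence on all of \<open>C\<close>.\<close>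

lemma fourier_series_nonneg:
  fixes R :: "'i \<Rightarrow> 'a \<Rightarrow> complex" and f :: "'a \<Rightarrow> complex" and \<psi> :: "'a \<Rightarrow> real"
  assumes R: "\<And>t. continuous_on UNIV (R t)" "\<And>t x. x \<in> C \<Longrightarrow> cmod (R t x) \<le> 1"
    and x0: "x0 \<in> C" "\<And>t. R t x0 = 1"
    and orth: "\<And>s t. s \<noteq> t \<Longrightarrow> (\<integral>x. R s x * cnj (R t x) \<partial>M) = 0"
    and f: "continuous_on UNIV f" "\<And>t. (\<integral>x. f x * cnj (R t x) \<partial>M) \<in> nonneg_Reals"
    and \<psi>: "continuous_on UNIV \<psi>" "\<And>x. x \<in> C \<Longrightarrow> 0 \<le> \<psi> x" "\<And>x. x \<in> C \<Longrightarrow> \<psi> x \<le> 1"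
      "\<psi> x0 = 1" "\<And>x. x \<in> C \<Longrightarrow> \<psi> x = 1 \<Longrightarrow> x = x0"
      "\<And>N t. (\<integral>x. of_real (\<psi> x) ^ N * cnj (R t x) \<partial>M) \<in> nonneg_Reals"
      "\<And>N. \<exists>X a. finite X \<and> (\<forall>x\<in>C. of_real (\<psi> x) ^ N = (\<Sum>t\<in>X. a t * R t x))"
    and dense: "\<And>\<epsilon>. \<epsilon> > 0 \<Longrightarrow> \<exists>X a. finite X \<and> (\<forall>x\<in>C. cmod (f x - (\<Sum>t\<in>X. a t * R t x)) < \<epsilon>)"
  shows "\<exists>c :: 'i \<Rightarrow> real. (\<forall>t. 0 \<le> c t) \<and> c summable_on UNIV \<and>
    (\<forall>x\<in>C. ((\<lambda>t. of_real (c t) * R t x) has_sum f x) UNIV)"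
proof -
  define h where "h t = (\<integral>x. (cmod (R t x))\<^sup>2 \<partial>M)" for t
  have h: "h t > 0" for t
    unfolding h_def by (rule integral_pos[of _ x0]) (auto intro!: continuous_intros R simp: x0)
  have hh: "(\<integral>x. R t x * cnj (R t x) \<partial>M) = of_real (h t)" for t
    unfolding h_def integral_complex_of_real[symmetric] complex_norm_square ..
  define c where "c t = Re (\<integral>x. f x * cnj (R t x) \<partial>M) / h t" for t
  have c: "0 \<le> c t" for t
    using f(2)[of t] h[of t] by (simp add: c_def complex_nonneg_Reals_iff)
  have fc: "(\<integral>x. f x * cnj (R t x) \<partial>M) = of_real (c t * h t)" for t
    using f(2)[of t] h[of t] by (auto simp: c_def complex_nonneg_Reals_iff complex_eq_iff)
  define d where "d X x = f x - (\<Sum>t\<in>X. of_real (c t) * R t x)" for X x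
  have contd: "continuous_on UNIV (d X)" for X
    unfolding d_def by (intro continuous_intros f R)
  have coef_sum: "(\<integral>x. (\<Sum>s\<in>X. a s * R s x) * cnj (R t x) \<partial>M) = (if t \<in> X then a t * of_real (h t) else 0)"
    if "finite X" for X a t
  proof -
    have "(\<integral>x. (\<Sum>s\<in>X. a s * R s x) * cnj (R t x) \<partial>M) = (\<integral>x. (\<Sum>s\<in>X. a s * (R s x * cnj (R t x))) \<partial>M)"
      by (simp add: sum_distrib_right mult.assoc)
    also have "\<dots> = (\<Sum>s\<in>X. \<integral>x. a s * (R s x * cnj (R t x)) \<partial>M)"
      by (intro Bochner_Integration.integral_sum integrable_continuous continuous_intros R)
    also have "\<dots> = (\<Sum>s\<in>X. if s = t then a t * of_real (h t) else 0)"
      using orth hh by (intro sum.cong) auto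
    finally show ?thesis using that by simp
  qed
  have coef_d: "(\<integral>x. d X x * cnj (R t x) \<partial>M) = (if t \<in> X then 0 else of_real (c t * h t))"
    if "finite X" for X t
  proof -
    have "(\<integral>x. d X x * cnj (R t x) \<partial>M) = (\<integral>x. f x * cnj (R t x) \<partial>M)
        - (\<integral>x. (\<Sum>s\<in>X. of_real (c s) * R s x) * cnj (R t x) \<partial>M)"
      unfolding d_def left_diff_distrib
      by (intro Bochner_Integration.integral_diff integrable_continuous continuous_intros f R)
    then show ?thesis using coef_sum[OF that, of "\<lambda>s. of_real (c s)" t] by (simp add: fc)
  qed
  \<comment> \<open>The remainder \<open>d X\<close> has coefficients 0 on \<open>X\<close> and
    those of \<open>f\<close> elsewhere, so its integral against a power of \<open>\<psi>\<close> is
    a sum of nonnegative terms. \<open>peak_nonneg\<close> then gives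
    \<open>Re (d X x0) \<ge> 0\<close>, and at \<open>x0\<close> every \<open>R t\<close> is
    1.\<close>
  have partial: "(\<Sum>t\<in>X. c t) \<le> Re (f x0)" if X: "finite X" for X
  proof -
    have "0 \<le> (\<integral>x. Re (d X x) * \<psi> x ^ N \<partial>M)" for N
    proof -
      obtain Y a where Y: "finite Y" "\<And>x. x \<in> C \<Longrightarrow> of_real (\<psi> x) ^ N = (\<Sum>t\<in>Y. a t * R t x)"
        using \<psi>(7)[of N] by auto
      \<comment> \<open>By orthogonality, integrating the expansion of the power against
        \<open>cnj (R t)\<close> returns \<open>a t\<close> times the positive number
        \<open>h t\<close>.\<close>
      have a: "a t \<in> nonneg_Reals" if "t \<in> Y" for t
      proof -
        have "(\<integral>x. of_real (\<psi> x) ^ N * cnj (R t x) \<partial>M) = (\<integral>x. (\<Sum>s\<in>Y. a s * R s x) * cnj (R t x) \<partial>M)"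
          using Y(2) by (intro integral_cong_C continuous_intros \<psi> R) auto
        also have "\<dots> = a t * of_real (h t)" using coef_sum[OF Y(1)] that by simp
        finally have "a t * of_real (h t) \<in> nonneg_Reals" using \<psi>(6)[of N t] by simp
        then show ?thesis
          using h[of t] by (auto simp: complex_nonneg_Reals_iff zero_le_mult_iff)
      qed
      have "(\<integral>x. d X x * of_real (\<psi> x) ^ N \<partial>M) = (\<integral>x. (\<Sum>t\<in>Y. cnj (a t) * (d X x * cnj (R t x))) \<partial>M)"
      proof (rule integral_cong_C)
        fix x assume "x \<in> C"
        then have "cnj (of_real (\<psi> x) ^ N) = cnj (\<Sum>t\<in>Y. a t * R t x)" by (simp only: Y(2))
        then show "d X x * of_real (\<psi> x) ^ N = (\<Sum>t\<in>Y. cnj (a t) * (d X x * cnj (R t x)))"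
          by (simp add: sum_distrib_left mult_ac)
      qed (intro continuous_intros contd \<psi> R)+
      also have "\<dots> = (\<Sum>t\<in>Y. \<integral>x. cnj (a t) * (d X x * cnj (R t x)) \<partial>M)"
        by (intro Bochner_Integration.integral_sum integrable_continuous continuous_intros contd R)
      also have "\<dots> = (\<Sum>t\<in>Y. cnj (a t) * (if t \<in> X then 0 else of_real (c t * h t)))"
        by (simp add: coef_d[OF X])
      finally have eq: "(\<integral>x. d X x * of_real (\<psi> x) ^ N \<partial>M)
        = (\<Sum>t\<in>Y. cnj (a t) * (if t \<in> X then 0 else of_real (c t * h t)))" .
      have "(\<integral>x. Re (d X x) * \<psi> x ^ N \<partial>M) = (\<integral>x. Re (d X x * of_real (\<psi> x) ^ N) \<partial>M)"
        by (simp flip: of_real_power)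
      also have "\<dots> = Re (\<integral>x. d X x * of_real (\<psi> x) ^ N \<partial>M)"
        by (intro integral_Re integrable_continuous continuous_intros contd \<psi>)
      also have "\<dots> = (\<Sum>t\<in>Y. Re (cnj (a t) * (if t \<in> X then 0 else of_real (c t * h t))))"
        unfolding eq by (rule Re_sum)
      also have "\<dots> \<ge> 0"
        using a c h by (intro sum_nonneg) (auto simp: complex_nonneg_Reals_iff less_imp_le)
      finally show ?thesis .
    qed
    then have "0 \<le> Re (d X x0)"
      by (intro peak_nonneg[where \<psi> = \<psi> and g = "\<lambda>x. Re (d X x)", OF _ \<psi>(1,2,3) x0(1) \<psi>(4,5)]
          continuous_intros contd)
    then show ?thesis by (simp add: d_def x0)
  qed
  have summ: "c summable_on UNIV"
    by (rule nonneg_bdd_above_summable_on) (use c partial in \<open>auto intro!: bdd_aboveI[of _ "Re (f x0)"]\<close>)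
  have Rsumm: "(\<lambda>t. of_real (c t) * R t x) summable_on UNIV" if "x \<in> C" for x
  proof (rule abs_summable_summable, rule summable_on_comparison_test[OF summ])
    show "norm (of_real (c t) * R t x) \<le> c t" for t
      using c[of t] R(2)[OF that, of t] by (simp add: norm_mult mult_left_le)
  qed simp
  define F where "F x = (\<Sum>\<^sub>\<infinity>t. of_real (c t) * R t x)" for x
  have F: "((\<lambda>t. of_real (c t) * R t x) has_sum F x) UNIV" if "x \<in> C" for x
    unfolding F_def by (rule has_sum_infsum[OF Rsumm[OF that]])
  define S where "S = (\<Sum>\<^sub>\<infinity>t. c t)"
  have S: "(c has_sum S) UNIV" unfolding S_def by (rule has_sum_infsum[OF summ])
  have "bounded (f ` C)"
    using f(1) compact_C by (intro compact_imp_bounded compact_continuous_image) (auto intro: continuous_on_subset)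
  then obtain B where B: "B > 0" "\<And>x. x \<in> C \<Longrightarrow> cmod (f x) \<le> B" by (auto simp: bounded_pos)
  have norm_part: "cmod (\<Sum>t\<in>X. of_real (c t) * R t x) \<le> (\<Sum>t\<in>X. c t)" if "x \<in> C" for X x
    by (rule sum_norm_le) (use c R(2)[OF that] in \<open>simp add: norm_mult mult_left_le\<close>)
  have sumS: "(\<Sum>t\<in>X. c t) \<le> S" if "finite X" for X
    using that c S unfolding S_def by (intro finite_sum_le_infsum summ) auto
  have S0: "0 \<le> S" using sumS[of "{}"] by simp
  \<comment> \<open>Best approximation without completeness: \<open>d X\<close> is orthogonal to
    every \<open>R t\<close> with \<open>t\<close> in \<open>X\<close>, so its mean square equals
    its inner product with the error \<open>r\<close> of a uniform approximation using terms in
    \<open>X\<close>. The bound \<open>B + S\<close> on \<open>d X\<close> does not depend on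
    \<open>X\<close>.\<close>
  have small: "\<exists>X. finite X \<and> Y \<subseteq> X \<and> (\<integral>x. (cmod (d X x))\<^sup>2 \<partial>M) \<le> \<epsilon>" if "finite Y" "\<epsilon> > 0" for Y \<epsilon>
  proof -
    define \<epsilon>' where "\<epsilon>' = \<epsilon> / (B + S)"
    have \<epsilon>': "\<epsilon>' > 0" using that B S0 by (simp add: \<epsilon>'_def)
    obtain Z a where Z: "finite Z" "\<And>x. x \<in> C \<Longrightarrow> cmod (f x - (\<Sum>t\<in>Z. a t * R t x)) < \<epsilon>'"
      using dense[OF \<epsilon>'] by auto
    define X where "X = Y \<union> Z"
    have X: "finite X" using that Z by (simp add: X_def)
    define b where "b t = (if t \<in> Z then a t else 0) - of_real (c t)" for t
    define r where "r x = f x - (\<Sum>t\<in>Z. a t * R t x)" for x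
    have contr: "continuous_on UNIV r" unfolding r_def by (intro continuous_intros f R)
    have dr: "d X x = r x + (\<Sum>t\<in>X. b t * R t x)" for x
    proof -
      have "(\<Sum>t\<in>Z. a t * R t x) = (\<Sum>t\<in>X. (if t \<in> Z then a t else 0) * R t x)"
        using X by (intro sum.mono_neutral_cong_left) (auto simp: X_def)
      then show ?thesis
        by (simp add: d_def r_def b_def left_diff_distrib sum_subtractf)
    qed
    have "(\<integral>x. d X x * cnj (d X x) \<partial>M)
      = (\<integral>x. d X x * cnj (r x) + (\<Sum>t\<in>X. cnj (b t) * (d X x * cnj (R t x))) \<partial>M)"
    proof (rule Bochner_Integration.integral_cong[OF refl])
      fix x
      have "d X x * cnj (d X x) = d X x * (cnj (r x) + (\<Sum>t\<in>X. cnj (b t) * cnj (R t x)))"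
        using dr[of x] by simp
      then show "d X x * cnj (d X x) = d X x * cnj (r x) + (\<Sum>t\<in>X. cnj (b t) * (d X x * cnj (R t x)))"
        by (simp add: distrib_left sum_distrib_left mult_ac)
    qed
    also have "\<dots> = (\<integral>x. d X x * cnj (r x) \<partial>M) + (\<integral>x. (\<Sum>t\<in>X. cnj (b t) * (d X x * cnj (R t x))) \<partial>M)"
      by (intro Bochner_Integration.integral_add integrable_continuous continuous_intros contd contr R)
    also have "(\<integral>x. (\<Sum>t\<in>X. cnj (b t) * (d X x * cnj (R t x))) \<partial>M)
      = (\<Sum>t\<in>X. \<integral>x. cnj (b t) * (d X x * cnj (R t x)) \<partial>M)"
      by (intro Bochner_Integration.integral_sum integrable_continuous continuous_intros contd R)
    also have "\<dots> = 0" by (intro sum.neutral) (simp add: coef_d[OF X])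
    finally have eq: "(\<integral>x. d X x * cnj (d X x) \<partial>M) = (\<integral>x. d X x * cnj (r x) \<partial>M)" by simp
    have "complex_of_real (\<integral>x. (cmod (d X x))\<^sup>2 \<partial>M) = (\<integral>x. d X x * cnj (d X x) \<partial>M)"
      unfolding integral_complex_of_real[symmetric] complex_norm_square ..
    then have "\<bar>\<integral>x. (cmod (d X x))\<^sup>2 \<partial>M\<bar> = cmod (\<integral>x. d X x * cnj (r x) \<partial>M)"
      unfolding eq by (metis norm_of_real)
    also have "\<dots> \<le> (B + S) * \<epsilon>'"
    proof (rule norm_integral_le)
      fix x assume x: "x \<in> C"
      have "cmod (d X x) \<le> cmod (f x) + cmod (\<Sum>t\<in>X. of_real (c t) * R t x)"
        unfolding d_def by (rule norm_triangle_ineq4)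
      also have "\<dots> \<le> B + S" using B(2)[OF x] norm_part[OF x, of X] sumS[OF X] by simp
      finally have "cmod (d X x) \<le> B + S" .
      moreover have "cmod (r x) \<le> \<epsilon>'" using Z(2)[OF x] by (simp add: r_def)
      ultimately show "cmod (d X x * cnj (r x)) \<le> (B + S) * \<epsilon>'"
        unfolding norm_mult complex_mod_cnj using B(1) S0 by (intro mult_mono) auto
    qed (intro continuous_intros contd contr)
    also have "\<dots> = \<epsilon>" using B S0 by (simp add: \<epsilon>'_def)
    finally show ?thesis using X by (intro exI[of _ X]) (auto simp: X_def)
  qed
  have "F x1 = f x1" if x1: "x1 \<in> C" for x1
  proof (rule ccontr)
    assume ne: "F x1 \<noteq> f x1"
    \<comment> \<open>The fifths are spent as follows: \<open>Y\<close> is within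
      \<open>\<eta>\<close> of \<open>F x1\<close>, so \<open>d Y\<close> exceeds
      \<open>3 * \<eta>\<close> at \<open>x1\<close> and on the open set \<open>W\<close>; enlarging
      \<open>Y\<close> costs at most \<open>\<eta>\<close> uniformly, so \<open>d X\<close> stays at
      least \<open>2 * \<eta>\<close> on \<open>W\<close>, against the smallness of its mean
      square.\<close>
    define \<eta> where "\<eta> = cmod (f x1 - F x1) / 5"
    have \<eta>: "\<eta> > 0" using ne by (simp add: \<eta>_def)
    have "eventually (\<lambda>X. dist (sum c X) S < \<eta>) (finite_subsets_at_top UNIV)"
      using S \<eta> unfolding has_sum_def by (rule tendstoD)
    moreover have "eventually (\<lambda>X. dist (\<Sum>t\<in>X. of_real (c t) * R t x1) (F x1) < \<eta>) (finite_subsets_at_top UNIV)"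
      using F[OF x1] \<eta> unfolding has_sum_def by (rule tendstoD)
    ultimately have "eventually (\<lambda>X. finite X \<and> dist (sum c X) S < \<eta> \<and>
        dist (\<Sum>t\<in>X. of_real (c t) * R t x1) (F x1) < \<eta>) (finite_subsets_at_top UNIV)"
      using eventually_finite_subsets_at_top_weakI[of UNIV finite] by (auto intro: eventually_conj)
    then obtain Y where Y: "finite Y" "dist (sum c Y) S < \<eta>"
      "dist (\<Sum>t\<in>Y. of_real (c t) * R t x1) (F x1) < \<eta>"
      using eventually_happens' finite_subsets_at_top_neq_bot by blast
    have dY: "cmod (d Y x1) > 3 * \<eta>"
    proof -
      have "f x1 - F x1 = d Y x1 + ((\<Sum>t\<in>Y. of_real (c t) * R t x1) - F x1)" by (simp add: d_def)
      then have "5 * \<eta> \<le> cmod (d Y x1) + cmod ((\<Sum>t\<in>Y. of_real (c t) * R t x1) - F x1)"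
        unfolding \<eta>_def by (metis (no_types, lifting) norm_triangle_ineq nonzero_mult_div_cancel_left times_divide_eq_right zero_neq_numeral)
      then show ?thesis using Y(3) \<eta> by (simp add: dist_norm)
    qed
    define W where "W = {x. 3 * \<eta> < cmod (d Y x)}"
    have W: "open W" unfolding W_def by (intro open_Collect_less continuous_intros contd)
    define m where "m = measure M W"
    have m: "m > 0" unfolding m_def by (rule full_support[OF W _ x1]) (simp add: W_def dY)
    have W_meas: "W \<in> sets M" using W by simp
    obtain X where X: "finite X" "Y \<subseteq> X" "(\<integral>x. (cmod (d X x))\<^sup>2 \<partial>M) \<le> (2 * \<eta>)\<^sup>2 * m / 2"
      using small[OF Y(1), of "(2 * \<eta>)\<^sup>2 * m / 2"] \<eta> m by auto
    have lower: "(2 * \<eta>)\<^sup>2 * indicat_real W x \<le> (cmod (d X x))\<^sup>2" if x: "x \<in> C" for x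
    proof (cases "x \<in> W")
      case True
      have "sum c X = sum c Y + sum c (X - Y)"
        using X(1,2) by (simp add: sum.subset_diff add.commute)
      \<comment> \<open>The partial sum over \<open>Y\<close> is within \<open>\<eta>\<close> of
        \<open>S\<close>, and no finite partial sum exceeds \<open>S\<close>.\<close>
      then have "sum c (X - Y) \<le> \<eta>" using sumS[OF X(1)] Y(2) by (simp add: dist_real_def)
      then have tail: "cmod (\<Sum>t\<in>X - Y. of_real (c t) * R t x) \<le> \<eta>"
        using norm_part[OF x, of "X - Y"] by simp
      have "(\<Sum>t\<in>X. of_real (c t) * R t x) = (\<Sum>t\<in>Y. of_real (c t) * R t x) + (\<Sum>t\<in>X - Y. of_real (c t) * R t x)"
        using X(1,2) by (simp add: sum.subset_diff add.commute)
      then have "d Y x = d X x + (\<Sum>t\<in>X - Y. of_real (c t) * R t x)" by (simp add: d_def)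
      then have "cmod (d Y x) \<le> cmod (d X x) + \<eta>"
        using tail norm_triangle_ineq[of "d X x" "\<Sum>t\<in>X - Y. of_real (c t) * R t x"] by simp
      then have "2 * \<eta> \<le> cmod (d X x)" using True by (simp add: W_def)
      then show ?thesis using power_mono[of "2 * \<eta>" "cmod (d X x)" 2] \<eta> True by simp
    qed simp
    have "(2 * \<eta>)\<^sup>2 * m = (\<integral>x. (2 * \<eta>)\<^sup>2 * indicat_real W x \<partial>M)"
      using W_meas by (simp add: m_def)
    also have "\<dots> \<le> (\<integral>x. (cmod (d X x))\<^sup>2 \<partial>M)"
      using AE_C lower W_meas
      by (intro integral_mono_AE integrable_continuous integrable_mult_right integrable_real_indicator continuous_intros contd)
        (auto simp: less_top[symmetric])
    finally have "(2 * \<eta>)\<^sup>2 * m \<le> (2 * \<eta>)\<^sup>2 * m / 2" using X(3) by (rule order_trans)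
    moreover have "(2 * \<eta>)\<^sup>2 * m > 0" using \<eta> m by simp
    ultimately show False by linarith
  qed
  then have "\<forall>x\<in>C. ((\<lambda>t. of_real (c t) * R t x) has_sum f x) UNIV" using F by metis
  then show ?thesis using c summ by blast
qed

end

section \<open>Density of disc polynomials\<close>

definition fspan :: "('i \<Rightarrow> 'a \<Rightarrow> complex) \<Rightarrow> ('a \<Rightarrow> complex) set" where
  "fspan R = {p. \<exists>X a. finite X \<and> p = (\<lambda>x. \<Sum>t\<in>X. a t * R t x)}"

lemma fspan_base: "R t \<in> fspan R"
  unfolding fspan_def by (intro CollectI exI[of _ "{t}"] exI[of _ "\<lambda>_. 1"]) simp

lemma fspan_zero: "(\<lambda>x. 0) \<in> fspan R"
  unfolding fspan_def by (intro CollectI exI[of _ "{}"]) simp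

lemma fspan_scale: "p \<in> fspan R \<Longrightarrow> (\<lambda>x. c * p x) \<in> fspan R"
proof -
  assume "p \<in> fspan R"
  then obtain X a where "finite X" "p = (\<lambda>x. \<Sum>t\<in>X. a t * R t x)" by (auto simp: fspan_def)
  then show "(\<lambda>x. c * p x) \<in> fspan R"
    unfolding fspan_def
    by (intro CollectI exI[of _ X] exI[of _ "\<lambda>t. c * a t"]) (simp add: sum_distrib_left mult.assoc)
qed

lemma fspan_add:
  assumes "p \<in> fspan R" "q \<in> fspan R"
  shows "(\<lambda>x. p x + q x) \<in> fspan R"
proof -
  obtain X a where p: "finite X" "p = (\<lambda>x. \<Sum>t\<in>X. a t * R t x)" using assms by (auto simp: fspan_def)
  obtain Y b where q: "finite Y" "q = (\<lambda>x. \<Sum>t\<in>Y. b t * R t x)" using assms by (auto simp: fspan_def)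
  define c where "c t = (if t \<in> X then a t else 0) + (if t \<in> Y then b t else 0)" for t
  have "p x = (\<Sum>t\<in>X \<union> Y. (if t \<in> X then a t else 0) * R t x)" for x
    unfolding p using p(1) q(1) by (intro sum.mono_neutral_cong_left) auto
  moreover have "q x = (\<Sum>t\<in>X \<union> Y. (if t \<in> Y then b t else 0) * R t x)" for x
    unfolding q using p(1) q(1) by (intro sum.mono_neutral_cong_left) auto
  ultimately have "p x + q x = (\<Sum>t\<in>X \<union> Y. c t * R t x)" for x
    by (simp add: c_def distrib_right sum.distrib)
  then show ?thesis
    unfolding fspan_def using p(1) q(1) by (intro CollectI exI[of _ "X \<union> Y"] exI[of _ c]) auto
qed

lemma fspan_sum: "(\<And>i. i \<in> I \<Longrightarrow> p i \<in> fspan R) \<Longrightarrow> (\<lambda>x. \<Sum>i\<in>I. p i x) \<in> fspan R"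
  by (induction I rule: infinite_finite_induct) (auto intro: fspan_zero fspan_add)

lemma fspan_trans:
  assumes "p \<in> fspan S" "\<And>s. S s \<in> fspan R"
  shows "p \<in> fspan R"
proof -
  obtain X a where p: "finite X" "p = (\<lambda>x. \<Sum>t\<in>X. a t * S t x)" using assms by (auto simp: fspan_def)
  show ?thesis unfolding p(2) by (intro fspan_sum fspan_scale assms(2))
qed

text \<open>Used with \<open>f = fst\<close>, \<open>g = snd\<close> for products in separate
  variables, and with both maps the identity for products of monomials.\<close>

lemma fspan_bilinear:
  assumes "p \<in> fspan S" "q \<in> fspan T" "\<And>s t. (\<lambda>x. S s (f x) * T t (g x)) \<in> fspan R"
  shows "(\<lambda>x. p (f x) * q (g x)) \<in> fspan R"
proof -
  obtain X a where p: "finite X" "p = (\<lambda>x. \<Sum>t\<in>X. a t * S t x)" using assms by (auto simp: fspan_def)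
  obtain Y b where q: "finite Y" "q = (\<lambda>x. \<Sum>t\<in>Y. b t * T t x)" using assms by (auto simp: fspan_def)
  have "(\<lambda>x. p (f x) * q (g x)) = (\<lambda>x. \<Sum>s\<in>X. \<Sum>t\<in>Y. (a s * b t) * (S s (f x) * T t (g x)))"
    unfolding p q sum_product by (intro ext sum.cong refl) (simp only: mult_ac)
  also have "\<dots> \<in> fspan R" by (intro fspan_sum fspan_scale assms(3))
  finally show ?thesis .
qed

definition monom2 :: "nat \<times> nat \<Rightarrow> complex \<Rightarrow> complex"
  where "monom2 = (\<lambda>(m, n) z. z ^ m * cnj z ^ n)"

definition zpoly2 :: "nat \<Rightarrow> nat \<times> nat \<Rightarrow> complex \<Rightarrow> complex"
  where "zpoly2 \<alpha> = (\<lambda>(m, n). zpoly \<alpha> m n)"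

definition monom4 :: "nat \<times> nat \<times> nat \<times> nat \<Rightarrow> complex \<times> complex \<Rightarrow> complex"
  where "monom4 = (\<lambda>(m, n, k, l) x. monom2 (m, n) (fst x) * monom2 (k, l) (snd x))"

definition zpoly4 :: "nat \<Rightarrow> nat \<Rightarrow> nat \<times> nat \<times> nat \<times> nat \<Rightarrow> complex \<times> complex \<Rightarrow> complex"
  where "zpoly4 \<alpha> \<beta> = (\<lambda>(m, n, k, l) x. zpoly \<alpha> m n (fst x) * zpoly \<beta> k l (snd x))"

text \<open>Expanding \<open>(1 - z * cnj z) ^ s\<close>, the top term carries the sign
  \<open>(-1) ^ s\<close>, which cancels the sign in \<open>zpoly\<close>. So the coefficients
  \<open>\<gamma> s\<close> of the top monomial add up without cancellation to
  \<open>\<kappa> \<ge> \<gamma> 0 = 1\<close>. All other monomials have a smaller exponent of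
  \<open>cnj z\<close>, which is the induction variable; \<open>m\<close> drops as well and must be
  arbitrary.\<close>

lemma monom2_in_fspan: "monom2 (m, n) \<in> fspan (zpoly2 \<alpha>)"
proof (induction n arbitrary: m rule: less_induct)
  case (less n)
  define \<gamma> where "\<gamma> s = real (m choose s) * real (n choose s) / real ((\<alpha> + s) choose s)" for s
  define \<kappa> where "\<kappa> = (\<Sum>s\<le>min m n. \<gamma> s)"
  have "0 \<le> \<gamma> s" for s by (simp add: \<gamma>_def)
  then have "\<gamma> 0 \<le> \<kappa>" unfolding \<kappa>_def by (intro member_le_sum) auto
  then have \<kappa>: "\<kappa> > 0" by (simp add: \<gamma>_def)
  define L where "L s j z = complex_of_real ((-1) ^ s * \<gamma> s) * of_nat (s choose j) * (-1) ^ j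
      * monom2 (m - (s - j), n - (s - j)) z" for s j z
  have eq: "complex_of_real ((-1) ^ s * \<gamma> s) * (1 - z * cnj z) ^ s * z ^ (m - s) * cnj z ^ (n - s)
    = of_real (\<gamma> s) * monom2 (m, n) z + (\<Sum>j<s. L s j z)" if s: "s \<le> min m n" for s z
  proof -
    have pw: "(1 - z * cnj z) ^ s = (\<Sum>j\<le>s. of_nat (s choose j) * ((-1) ^ j * (z ^ j * cnj z ^ j)))"
      using binomial_ring[of "- (z * cnj z)" 1 s]
      by (simp add: power_minus[of "z * cnj z"] power_mult_distrib)
    have "complex_of_real ((-1) ^ s * \<gamma> s) * (1 - z * cnj z) ^ s * z ^ (m - s) * cnj z ^ (n - s)
      = (\<Sum>j\<le>s. L s j z)"
      unfolding pw sum_distrib_left sum_distrib_right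
    proof (rule sum.cong[OF refl])
      fix j assume "j \<in> {..s}"
      then have 1: "m - (s - j) = j + (m - s)" and 2: "n - (s - j) = j + (n - s)" using s by auto
      show "complex_of_real ((-1) ^ s * \<gamma> s) * (of_nat (s choose j) * ((-1) ^ j * (z ^ j * cnj z ^ j)))
          * z ^ (m - s) * cnj z ^ (n - s) = L s j z"
        unfolding L_def monom2_def split 1 2 power_add by (simp only: mult_ac)
    qed
    also have "\<dots> = L s s z + (\<Sum>j<s. L s j z)"
      by (simp add: lessThan_Suc_atMost[symmetric])
    also have "L s s z = of_real (\<gamma> s) * monom2 (m, n) z"
    proof -
      have "complex_of_real ((-1) ^ s * \<gamma> s) * (-1) ^ s = of_real (\<gamma> s)"
        by (simp flip: power_mult_distrib mult.assoc)
      then show ?thesis by (simp add: L_def)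
    qed
    finally show ?thesis .
  qed
  have coef: "(-1) ^ s * real (m choose s) * real (n choose s) / real ((\<alpha> + s) choose s) = (-1) ^ s * \<gamma> s" for s
    by (simp add: \<gamma>_def)
  have z: "zpoly \<alpha> m n z = of_real \<kappa> * monom2 (m, n) z + (\<Sum>s\<le>min m n. \<Sum>j<s. L s j z)" for z
    unfolding zpoly_def coef \<kappa>_def of_real_sum sum_distrib_right sum.distrib[symmetric]
    by (intro sum.cong refl eq) simp
  have "monom2 (m, n) = (\<lambda>z. (1 / of_real \<kappa>) * (zpoly2 \<alpha> (m, n) z + (-1) * (\<Sum>s\<le>min m n. \<Sum>j<s. L s j z)))"
    using \<kappa> by (simp add: zpoly2_def z)
  also have "\<dots> \<in> fspan (zpoly2 \<alpha>)"
  proof (intro fspan_scale fspan_add fspan_base fspan_sum)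
    fix s j assume "s \<in> {..min m n}" "j \<in> {..<s}"
    then have "n - (s - j) < n" by auto
    then show "L s j \<in> fspan (zpoly2 \<alpha>)" unfolding L_def by (intro fspan_scale less.IH)
  qed
  finally show ?case .
qed

lemma monom4_in_fspan: "monom4 t \<in> fspan (zpoly4 \<alpha> \<beta>)"
proof -
  obtain m n k l where t: "t = (m, n, k, l)" by (metis prod_cases4)
  have "(\<lambda>x. zpoly2 \<alpha> u (fst x) * zpoly2 \<beta> v (snd x)) \<in> fspan (zpoly4 \<alpha> \<beta>)" for u v
    using fspan_base[of "zpoly4 \<alpha> \<beta>" "(fst u, snd u, fst v, snd v)"]
    by (simp add: zpoly4_def zpoly2_def case_prod_unfold)
  from fspan_bilinear[where f = fst and g = snd, OF monom2_in_fspan[of m n \<alpha>] monom2_in_fspan[of k l \<beta>] this]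
  show ?thesis by (simp add: t monom4_def)
qed

lemma monom4_mult: "p \<in> fspan monom4 \<Longrightarrow> q \<in> fspan monom4 \<Longrightarrow> (\<lambda>x. p x * q x) \<in> fspan monom4"
proof (rule fspan_bilinear[where f = "\<lambda>x. x" and g = "\<lambda>x. x"])
  fix s t :: "nat \<times> nat \<times> nat \<times> nat"
  obtain m n k l where s: "s = (m, n, k, l)" by (metis prod_cases4)
  obtain m' n' k' l' where t: "t = (m', n', k', l')" by (metis prod_cases4)
  have "(\<lambda>x. monom4 s x * monom4 t x) = monom4 (m + m', n + n', k + k', l + l')"
    by (auto simp: s t monom4_def monom2_def power_add)
  then show "(\<lambda>x. monom4 s x * monom4 t x) \<in> fspan monom4" by (simp add: fspan_base)
qed

lemma real_polynomial_in_fspan: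
  fixes p :: "complex \<times> complex \<Rightarrow> real"
  assumes "real_polynomial_function p"
  shows "(\<lambda>x. complex_of_real (p x)) \<in> fspan monom4"
  using assms
proof (induction p rule: real_polynomial_function.induct)
  case (linear h)
  interpret bounded_linear h by fact
  define m where "m = (\<lambda>(a, b, c, d) x. a * monom4 (1, 0, 0, 0) x + (b * monom4 (0, 1, 0, 0) x
    + (c * monom4 (0, 0, 1, 0) x + d * monom4 (0, 0, 0, 1) x)))"
  have mem: "m t \<in> fspan monom4" for t
    unfolding m_def case_prod_unfold by (intro fspan_add fspan_scale fspan_base)
  define A B C D where "A = complex_of_real (h (1, 0))" and "B = complex_of_real (h (\<i>, 0))"
    and "C = complex_of_real (h (0, 1))" and "D = complex_of_real (h (0, \<i>))"
  \<comment> \<open>\<open>A * Re z + B * Im z\<close> rewritten in \<open>z\<close> and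
    \<open>cnj z\<close>, for each of the two variables.\<close>
  have "complex_of_real (h x) = m ((A - \<i> * B) / 2, (A + \<i> * B) / 2, (C - \<i> * D) / 2, (C + \<i> * D) / 2) x" for x
  proof -
    have "x = Re (fst x) *\<^sub>R (1, 0) + Im (fst x) *\<^sub>R (\<i>, 0) + Re (snd x) *\<^sub>R (0, 1) + Im (snd x) *\<^sub>R (0, \<i>)"
      by (simp add: prod_eq_iff complex_eq_iff)
    then have "h x = Re (fst x) * h (1, 0) + Im (fst x) * h (\<i>, 0) + Re (snd x) * h (0, 1) + Im (snd x) * h (0, \<i>)"
      by (metis add scale real_scaleR_def)
    then show ?thesis
      by (simp add: m_def monom4_def monom2_def A_def B_def C_def D_def complex_eq_iff field_simps)
  qed
  then show ?case using mem by simp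
next
  case (const c)
  have "(\<lambda>x. complex_of_real c) = (\<lambda>x. complex_of_real c * monom4 (0, 0, 0, 0) x)"
    by (simp add: monom4_def monom2_def)
  then show ?case by (simp add: fspan_scale fspan_base)
next
  case (add p q)
  then show ?case by (simp add: fspan_add)
next
  case (mult p q)
  then show ?case by (simp add: monom4_mult)
qed

lemma zpoly4_dense:
  fixes f :: "complex \<times> complex \<Rightarrow> complex"
  assumes "compact C" "continuous_on C f" "\<epsilon> > 0"
  shows "\<exists>X a. finite X \<and> (\<forall>x\<in>C. cmod (f x - (\<Sum>t\<in>X. a t * zpoly4 \<alpha> \<beta> t x)) < \<epsilon>)"
proof -
  obtain g where g: "polynomial_function g" "\<And>x. x \<in> C \<Longrightarrow> cmod (f x - g x) < \<epsilon>"
    using Stone_Weierstrass_polynomial_function[OF assms] by blast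
  have "real_polynomial_function (\<lambda>x. Re (g x))" "real_polynomial_function (\<lambda>x. Im (g x))"
    using g(1) bounded_linear_Re bounded_linear_Im by (auto simp: polynomial_function_def o_def)
  then have "(\<lambda>x. complex_of_real (Re (g x)) + \<i> * complex_of_real (Im (g x))) \<in> fspan monom4"
    by (intro fspan_add fspan_scale real_polynomial_in_fspan)
  then have "g \<in> fspan monom4" by (simp add: complex_eq[symmetric])
  then have "g \<in> fspan (zpoly4 \<alpha> \<beta>)" by (rule fspan_trans[OF _ monom4_in_fspan])
  then obtain X a where "finite X" "g = (\<lambda>x. \<Sum>t\<in>X. a t * zpoly4 \<alpha> \<beta> t x)" by (auto simp: fspan_def)
  then show ?thesis using g(2) by blast
qed

section \<open>The expansion theorem\<close>

lemma continuous_on_zpoly4 [continuous_intros]: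
  "continuous_on S g \<Longrightarrow> continuous_on S (\<lambda>x. zpoly4 \<alpha> \<beta> t (g x))"
  unfolding zpoly4_def case_prod_unfold by (intro continuous_intros)

lemma norm_zpoly4_le:
  assumes "CARD('q::finite) \<ge> 2" "CARD('p::finite) \<ge> 2" "x \<in> cball 0 1 \<times> cball 0 1"
  shows "cmod (zpoly4 (CARD('q) - 2) (CARD('p) - 2) t x) \<le> 1"
  unfolding zpoly4_def case_prod_unfold norm_mult
  by (intro mult_le_one norm_zpoly_le assms(1,2)) (use assms(3) in auto)

lemma pd_mult_zpoly4:
  fixes g :: "'a \<Rightarrow> complex^'q" and h :: "'a \<Rightarrow> complex^'p"
  assumes "CARD('q) \<ge> 2" "CARD('p) \<ge> 2" "\<And>x. x \<in> S \<Longrightarrow> norm (g x) = 1" "\<And>x. x \<in> S \<Longrightarrow> norm (h x) = 1"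
  shows "pd_mult S (\<lambda>x y. zpoly4 (CARD('q) - 2) (CARD('p) - 2) t (hip (g x) (g y), hip (h x) (h y)))"
  unfolding zpoly4_def case_prod_unfold fst_conv snd_conv
  by (intro pd_mult_mult pd_mult_zpoly assms)

lemma cnj_zpoly4: "cnj (zpoly4 \<alpha> \<beta> (m, n, k, l) x) = zpoly4 \<alpha> \<beta> (n, m, l, k) x"
  by (simp add: zpoly4_def cnj_zpoly)

text \<open>One factor of the peak function. Its constant and the two inner product kernels,
  \<open>hip\<close> and its conjugate, all enter with positive coefficients.\<close>

lemma pd_mult_half_plus:
  "pd_mult S (\<lambda>x y. complex_of_real ((1 + Re (hip (g x) (g y))) / 2))"
proof -
  have "pd_mult S (\<lambda>x y. \<Sum>i\<in>UNIV. (g x $ i) * cnj (g y $ i))"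
    by (intro pd_mult_sum pd_mult_rank1) simp
  then have cnj: "pd_mult S (\<lambda>x y. cnj (hip (g x) (g y)))" by (simp add: hip_def)
  have "pd_mult S (\<lambda>x y. of_real (1 / 4) * (of_real 2 + (hip (g x) (g y) + cnj (hip (g x) (g y)))))"
    by (intro pd_mult_mult pd_mult_add pd_mult_const pd_mult_hip cnj) simp_all
  moreover have "of_real (1 / 4) * (of_real 2 + (z + cnj z)) = complex_of_real ((1 + Re z) / 2)" for z
    by (simp add: complex_eq_iff)
  ultimately show ?thesis by (simp only:)
qed

context unitary_pair
begin

lemma integral_zpoly4_orthogonal:
  assumes "s \<noteq> t"
  shows "(\<integral>x. zpoly4 (CARD('q) - 2) (CARD('p) - 2) s x * cnj (zpoly4 (CARD('q) - 2) (CARD('p) - 2) t x) \<partial>\<mu>) = 0"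
proof -
  define Z where "Z = zpoly4 (CARD('q) - 2) (CARD('p) - 2)"
  obtain m n k l where s: "s = (m, n, k, l)" by (metis prod_cases4)
  obtain m' n' k' l' where t: "t = (m', n', k', l')" by (metis prod_cases4)
  define g where "g z = zpoly (CARD('q) - 2) m n z * cnj (zpoly (CARD('q) - 2) m' n' z)" for z
  define h where "h z = zpoly (CARD('p) - 2) k l z * cnj (zpoly (CARD('p) - 2) k' l' z)" for z
  have "(\<integral>x. Z s x * cnj (Z t x) \<partial>\<mu>) = (\<integral>x. g (fst x) * h (snd x) \<partial>\<mu>)"
    by (simp add: Z_def s t zpoly4_def g_def h_def mult_ac)
  also have "\<dots> = (\<integral>x. g (x $ i) \<partial>\<sigma>) * (\<integral>y. h (y $ j) \<partial>\<tau>)"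
    unfolding g_def h_def by (intro integral_\<mu>_prod continuous_intros)
  also have "\<dots> = 0"
  proof (cases "(m, n) = (m', n')")
    case True
    then have "(k, l) \<noteq> (k', l')" using assms by (simp add: s t)
    from P.integral_zpoly_orthogonal[OF card_p this, of j] show ?thesis by (simp add: h_def)
  next
    case False
    from Q.integral_zpoly_orthogonal[OF card_q this, of i] show ?thesis by (simp add: g_def)
  qed
  finally show ?thesis by (simp only: Z_def)
qed

text \<open>Continuity is required on the whole plane in each variable because the integration
  lemmas work on \<open>UNIV\<close>; a function on the closed bidisc is extended before this is
  applied.\<close>

theorem pd_kernel_expansion:
  fixes f :: "complex \<times> complex \<Rightarrow> complex"
  assumes f: "continuous_on UNIV f"
    and pd: "pdk (sphere 0 1 \<times> sphere 0 1)
      (\<lambda>x y :: (complex^'q) \<times> (complex^'p). f (hip (fst x) (fst y), hip (snd x) (snd y)))"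
  shows "\<exists>c. (\<forall>t. 0 \<le> c t) \<and> c summable_on UNIV \<and>
    (\<forall>x\<in>cball 0 1 \<times> cball 0 1. ((\<lambda>t. of_real (c t) * zpoly4 (CARD('q) - 2) (CARD('p) - 2) t x) has_sum f x) UNIV)"
proof -
  define Z where "Z = zpoly4 (CARD('q) - 2) (CARD('p) - 2)"
  define \<psi>1 where "\<psi>1 z = (1 + Re z) / 2" for z
  define \<psi> where "\<psi> x = \<psi>1 (fst x) * \<psi>1 (snd x)" for x
  have \<psi>1: "0 \<le> \<psi>1 z" "\<psi>1 z \<le> 1" "\<psi>1 z = 1 \<Longrightarrow> z = 1" if z: "cmod z \<le> 1" for z
  proof -
    have "\<bar>Re z\<bar> \<le> 1" using abs_Re_le_cmod[of z] z by simp
    then show "0 \<le> \<psi>1 z" "\<psi>1 z \<le> 1" by (simp_all add: \<psi>1_def)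
    assume "\<psi>1 z = 1"
    then have re: "Re z = 1" by (simp add: \<psi>1_def)
    have "(Re z)\<^sup>2 + (Im z)\<^sup>2 \<le> 1" using z by (simp add: cmod_power2[symmetric] power_le_one)
    then show "z = 1" using re by (simp add: complex_eq_iff)
  qed
  have cont\<psi>: "continuous_on UNIV \<psi>" unfolding \<psi>_def \<psi>1_def by (intro continuous_intros) auto
  \<comment> \<open>The conjugate of a disc polynomial is the one with swapped indices, so the
    integrand again defines a positive definite kernel. Applied both to \<open>f\<close> and to the
    powers of the peak function.\<close>
  have pd_int: "(\<integral>x. G x * cnj (Z t x) \<partial>\<mu>) \<in> nonneg_Reals"
    if G: "continuous_on UNIV G" and pdG: "pdk (sphere 0 1 \<times> sphere 0 1)
      (\<lambda>x y :: (complex^'q) \<times> (complex^'p). G (hip (fst x) (fst y), hip (snd x) (snd y)))" for G t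
  proof -
    obtain m n k l where t: "t = (m, n, k, l)" by (metis prod_cases4)
    define H where "H z w = Z (n, m, l, k) (z, w) * G (z, w)" for z w
    have "(\<integral>p. H (fst p) (snd p) \<partial>\<mu>) \<in> nonneg_Reals"
    proof (rule integral_\<mu>_nonneg)
      show "continuous_on UNIV (\<lambda>p. H (fst p) (snd p))"
        unfolding H_def Z_def prod.collapse by (intro continuous_intros G)
      show "pdk (sphere 0 1 \<times> sphere 0 1)
        (\<lambda>x y :: (complex^'q) \<times> (complex^'p). H (hip (fst x) (fst y)) (hip (snd x) (snd y)))"
        unfolding H_def Z_def by (intro pd_mult_pdk pd_mult_zpoly4 card_q card_p pdG) auto
    qed
    then show ?thesis by (simp add: H_def Z_def t cnj_zpoly4 mult.commute)
  qed
  show ?thesis unfolding Z_def[symmetric]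
  proof (rule D.fourier_series_nonneg[where ?x0.0 = "(1, 1)" and \<psi> = \<psi>])
    show "continuous_on UNIV (Z t)" for t unfolding Z_def by (intro continuous_intros)
    show "cmod (Z t x) \<le> 1" if "x \<in> cball 0 1 \<times> cball 0 1" for t x
      unfolding Z_def by (rule norm_zpoly4_le[OF card_q card_p that])
    show "Z t (1, 1) = 1" for t by (simp add: Z_def zpoly4_def case_prod_unfold)
    show "(\<integral>x. Z s x * cnj (Z t x) \<partial>\<mu>) = 0" if "s \<noteq> t" for s t
      unfolding Z_def by (rule integral_zpoly4_orthogonal[OF that])
    show "(\<integral>x. f x * cnj (Z t x) \<partial>\<mu>) \<in> nonneg_Reals" for t by (rule pd_int[OF f pd])
    show "0 \<le> \<psi> x" if "x \<in> cball 0 1 \<times> cball 0 1" for x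
      unfolding \<psi>_def using that by (intro mult_nonneg_nonneg \<psi>1) auto
    show "\<psi> x \<le> 1" if "x \<in> cball 0 1 \<times> cball 0 1" for x
      unfolding \<psi>_def using that by (intro mult_le_one \<psi>1) auto
    show "\<psi> (1, 1) = 1" by (simp add: \<psi>_def \<psi>1_def)
    show "x = (1, 1)" if x: "x \<in> cball 0 1 \<times> cball 0 1" and "\<psi> x = 1" for x
    proof -
      have c: "cmod (fst x) \<le> 1" "cmod (snd x) \<le> 1" using x by auto
      have "\<psi> x \<le> \<psi>1 (fst x)" "\<psi> x \<le> \<psi>1 (snd x)"
        unfolding \<psi>_def using \<psi>1[OF c(1)] \<psi>1[OF c(2)] by (simp_all add: mult_left_le mult_left_le_one_le)
      then have "\<psi>1 (fst x) = 1" "\<psi>1 (snd x) = 1"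
        using \<open>\<psi> x = 1\<close> \<psi>1(2)[OF c(1)] \<psi>1(2)[OF c(2)] by auto
      then show ?thesis using \<psi>1(3)[OF c(1)] \<psi>1(3)[OF c(2)] by (simp add: prod_eq_iff)
    qed
    show "(\<integral>x. of_real (\<psi> x) ^ N * cnj (Z t x) \<partial>\<mu>) \<in> nonneg_Reals" for N t
    proof (rule pd_int)
      show "continuous_on UNIV (\<lambda>x. complex_of_real (\<psi> x) ^ N)" by (intro continuous_intros cont\<psi>)
      show "pdk (sphere 0 1 \<times> sphere 0 1) (\<lambda>x y :: (complex^'q) \<times> (complex^'p).
          complex_of_real (\<psi> (hip (fst x) (fst y), hip (snd x) (snd y))) ^ N)"
        unfolding \<psi>_def \<psi>1_def of_real_mult fst_conv snd_conv
        by (intro pd_mult_imp_pdk pd_mult_power pd_mult_mult pd_mult_half_plus)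
    qed
    show "\<exists>X a. finite X \<and> (\<forall>x\<in>cball 0 1 \<times> cball 0 1. of_real (\<psi> x) ^ N = (\<Sum>t\<in>X. a t * Z t x))" for N
    proof -
      have "bounded_linear (\<lambda>x :: complex \<times> complex. Re (fst x))" "bounded_linear (\<lambda>x :: complex \<times> complex. Re (snd x))"
        by (intro bounded_linear_compose[OF bounded_linear_Re] bounded_linear_fst bounded_linear_snd)+
      then have "real_polynomial_function (\<lambda>x. \<psi> x ^ N)"
        unfolding \<psi>_def \<psi>1_def
        by (intro real_polynomial_function_power real_polynomial_function.intros real_polynomial_function_divide)
      then have "(\<lambda>x. complex_of_real (\<psi> x ^ N)) \<in> fspan Z"
        unfolding Z_def by (intro fspan_trans[OF real_polynomial_in_fspan] monom4_in_fspan)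
      then obtain X a where "finite X" "(\<lambda>x. complex_of_real (\<psi> x ^ N)) = (\<lambda>x. \<Sum>t\<in>X. a t * Z t x)"
        by (auto simp: fspan_def)
      then show ?thesis by (metis of_real_power)
    qed
    show "\<exists>X a. finite X \<and> (\<forall>x\<in>cball 0 1 \<times> cball 0 1. cmod (f x - (\<Sum>t\<in>X. a t * Z t x)) < \<epsilon>)"
      if "\<epsilon> > 0" for \<epsilon>
      unfolding Z_def by (rule zpoly4_dense) (use f that in \<open>auto intro: compact_Times continuous_on_subset\<close>)
  qed (auto intro: f cont\<psi>)
qed

end

section \<open>From kernels on the spheres to functions on the group\<close>

lemma column_nth_norm_le:
  assumes "A \<in> unitary_group"
  shows "cmod (A $ i $ j) \<le> 1"
  using Finite_Cartesian_Product.norm_nth_le[of "column j A" i] norm_column_unitary[OF assms, of j]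
  by (simp add: column_def)

lemma pos_def_prod_iff_pdk:
  fixes f :: "complex \<times> complex \<Rightarrow> complex" and i :: "'q::finite" and j :: "'p::finite"
  shows "pos_def_prod (\<lambda>(A :: complex^'q^'q, B :: complex^'p^'p). f (A $ i $ i, B $ j $ j)) \<longleftrightarrow>
    pdk (sphere 0 1 \<times> sphere 0 1) (\<lambda>x y :: (complex^'q) \<times> (complex^'p). f (hip (fst x) (fst y), hip (snd x) (snd y)))"
    (is "?L \<longleftrightarrow> ?R")
proof -
  have nn: "(let S = s in S \<in> \<real> \<and> 0 \<le> Re S) \<longleftrightarrow> s \<in> nonneg_Reals" for s
    by (auto simp: complex_nonneg_Reals_iff complex_is_Real_iff)
  show ?thesis
  proof
    assume L: ?L
    show ?R
      unfolding pdk_def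
    proof (intro allI impI)
      fix n :: nat and x :: "nat \<Rightarrow> (complex^'q) \<times> (complex^'p)" and c :: "nat \<Rightarrow> complex"
      assume x: "\<forall>k<n. x k \<in> sphere 0 1 \<times> sphere 0 1"
      have "\<exists>U. U \<in> unitary_group \<times> unitary_group \<and> column i (fst U) = fst (x k) \<and> column j (snd U) = snd (x k)"
        if "k < n" for k
      proof -
        have "norm (fst (x k)) = 1" "norm (snd (x k)) = 1" using x that by (auto simp: mem_Times_iff)
        then obtain A B where "A \<in> unitary_group" "column i A = fst (x k)" "B \<in> unitary_group" "column j B = snd (x k)"
          using unitary_column by metis
        then show ?thesis by (intro exI[of _ "(A, B)"]) auto
      qed
      then obtain U where U: "\<And>k. k < n \<Longrightarrow> U k \<in> unitary_group \<times> unitary_group"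
        "\<And>k. k < n \<Longrightarrow> column i (fst (U k)) = fst (x k)" "\<And>k. k < n \<Longrightarrow> column j (snd (U k)) = snd (x k)"
        by metis
      have "(\<Sum>k<n. \<Sum>l<n. f (hip (fst (x k)) (fst (x l)), hip (snd (x k)) (snd (x l))) * c k * cnj (c l))
        = (\<Sum>k<n. \<Sum>l<n. f (hip (column i (fst (U k))) (column i (fst (U l))),
            hip (column j (snd (U k))) (column j (snd (U l)))) * c k * cnj (c l))"
        by (intro sum.cong refl) (simp add: U)
      also have "\<dots> \<in> nonneg_Reals"
        using L U(1) unfolding pos_def_prod_def nn by (auto simp: cadj_matrix_mult_nth)
      finally show "(\<Sum>k<n. \<Sum>l<n. f (hip (fst (x k)) (fst (x l)), hip (snd (x k)) (snd (x l)))
        * c k * cnj (c l)) \<in> nonneg_Reals" .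
    qed
  next
    assume R: ?R
    show ?L
      unfolding pos_def_prod_def nn
    proof (intro allI impI)
      fix n :: nat and U :: "nat \<Rightarrow> (complex^'q^'q) \<times> (complex^'p^'p)" and c :: "nat \<Rightarrow> complex"
      assume U: "\<forall>k<n. U k \<in> unitary_group \<times> unitary_group"
      have "(\<Sum>k<n. \<Sum>l<n. f (hip (fst (column i (fst (U k)), column j (snd (U k)))) (fst (column i (fst (U l)), column j (snd (U l)))),
          hip (snd (column i (fst (U k)), column j (snd (U k)))) (snd (column i (fst (U l)), column j (snd (U l)))))
            * c k * cnj (c l)) \<in> nonneg_Reals"
        by (rule pdkD[OF R, where x = "\<lambda>k. (column i (fst (U k)), column j (snd (U k)))"])
          (use U in \<open>auto simp: mem_Times_iff intro!: norm_column_unitary\<close>)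
      then show "(\<Sum>k<n. \<Sum>l<n. (case (cadj (fst (U k)) ** fst (U l), cadj (snd (U k)) ** snd (U l)) of
          (A, B) \<Rightarrow> f (A $ i $ i, B $ j $ j)) * c k * cnj (c l)) \<in> nonneg_Reals"
        by (simp add: cadj_matrix_mult_nth)
    qed
  qed
qed

text \<open>Row \<open>i\<close> of \<open>K\<close> and column \<open>i\<close> of \<open>L\<close>
  agree with those of the identity matrix.\<close>

lemma stab_group_mult_nth:
  assumes "K \<in> stab_group i" "L \<in> stab_group i"
  shows "(K ** A ** L) $ i $ i = A $ i $ i"
proof -
  have K: "K $ i $ k = (if k = i then 1 else 0)" for k
    using assms(1) by (auto simp: stab_group_def)
  have L: "L $ k $ i = (if k = i then 1 else 0)" for k
    using assms(2) by (auto simp: stab_group_def)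
  have "(K ** A) $ i $ k = A $ i $ k" for k
    by (simp add: matrix_matrix_mult_def K if_distrib[of "\<lambda>x. x * _"] cong: if_cong)
  then show ?thesis
    by (simp add: matrix_matrix_mult_def[of "K ** A"] L if_distrib[of "\<lambda>x. _ * x"] cong: if_cong)
qed

lemma norm_zpoly4_term_le:
  assumes "CARD('q::finite) \<ge> 2" "CARD('p::finite) \<ge> 2" "0 \<le> c" "x \<in> cball 0 1 \<times> cball 0 1"
  shows "cmod (of_real c * zpoly4 (CARD('q) - 2) (CARD('p) - 2) t x) \<le> c"
  using norm_zpoly4_le[OF assms(1,2,4), of t] assms(3) by (simp add: norm_mult mult_left_le)

theorem theorem7p1:
  fixes f :: "complex \<Rightarrow> complex \<Rightarrow> complex"
    and i0 :: "'q::finite" and j0 :: "'p::finite"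
  assumes "CARD('q) \<ge> 2" and "CARD('p) \<ge> 2"
    and "continuous_on (cball 0 1 \<times> cball 0 1) (\<lambda>(z, w). f z w)"
  defines "F \<equiv> (\<lambda>(A :: (complex^'q^'q), B :: (complex^'p^'p)). f (A $ i0 $ i0) (B $ j0 $ j0))"
  shows "((continuous_on (unitary_group \<times> unitary_group) F \<and> pos_def_prod F \<and> biinv_prod i0 j0 F)
          \<longleftrightarrow>
          (\<exists>c :: nat \<times> nat \<times> nat \<times> nat \<Rightarrow> real.
             (\<forall>t. 0 \<le> c t) \<and> c summable_on UNIV \<and>
             (\<forall>z\<in>cball 0 1. \<forall>w\<in>cball 0 1.
               ((\<lambda>(m, n, k, l). complex_of_real (c (m, n, k, l))
                    * disc_poly (real CARD('q) - 2) m n z * disc_poly (real CARD('p) - 2) k l w)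
                 has_sum f z w) UNIV)))
       \<and> (\<forall>c :: nat \<times> nat \<times> nat \<times> nat \<Rightarrow> real.
            (\<forall>t. 0 \<le> c t) \<and> c summable_on UNIV \<longrightarrow>
            uniform_limit (cball 0 1 \<times> cball 0 1)
              (\<lambda>X (z, w). \<Sum>(m, n, k, l)\<in>X. complex_of_real (c (m, n, k, l))
                    * disc_poly (real CARD('q) - 2) m n z * disc_poly (real CARD('p) - 2) k l w)
              (\<lambda>(z, w). \<Sum>\<^sub>\<infinity>(m, n, k, l). complex_of_real (c (m, n, k, l))
                    * disc_poly (real CARD('q) - 2) m n z * disc_poly (real CARD('p) - 2) k l w)
              (finite_subsets_at_top UNIV))"
proof -
  define Z where "Z = zpoly4 (CARD('q) - 2) (CARD('p) - 2)"
  define D where "D = (cball 0 1 \<times> cball 0 1 :: (complex \<times> complex) set)"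
  have card: "real CARD('q) - 2 = real (CARD('q) - 2)" "real CARD('p) - 2 = real (CARD('p) - 2)"
    using assms(1,2) by (simp_all add: of_nat_diff)
  have term_eq: "(\<lambda>(m, n, k, l). complex_of_real (c (m, n, k, l))
      * disc_poly (real CARD('q) - 2) m n z * disc_poly (real CARD('p) - 2) k l w)
    = (\<lambda>t. of_real (c t) * Z t (z, w))" for c z w
    unfolding card disc_poly_eq_zpoly Z_def zpoly4_def by (auto simp: mult.assoc)
  \<comment> \<open>Radial retraction onto the closed disc; composing \<open>f\<close> with it in
    each variable gives a continuous extension \<open>f0\<close> to all of
    \<open>UNIV\<close>.\<close>
  define clip where "clip z = z / complex_of_real (max 1 (cmod z))" for z
  have cont_clip: "continuous_on S g \<Longrightarrow> continuous_on S (\<lambda>x. clip (g x))" for S and g :: "'z::topological_space \<Rightarrow> complex"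
    unfolding clip_def by (intro continuous_intros) auto
  have clip: "cmod (clip z) \<le> 1" "cmod z \<le> 1 \<Longrightarrow> clip z = z" for z
    by (auto simp: clip_def norm_divide max_def)
  define f0 where "f0 x = f (clip (fst x)) (clip (snd x))" for x
  have f0: "f0 x = f (fst x) (snd x)" if "x \<in> D" for x
    using that clip(2) by (auto simp: f0_def D_def)
  have cont_f0: "continuous_on UNIV f0"
  proof -
    have "continuous_on UNIV (\<lambda>x. (case (clip (fst x), clip (snd x)) of (z, w) \<Rightarrow> f z w))"
      by (rule continuous_on_compose2[OF assms(3)])
        (auto intro!: continuous_intros cont_clip simp: clip)
    then show ?thesis by (simp add: f0_def)
  qed
  \<comment> \<open>Cauchy-Schwarz for unit vectors, read off after a unitary map turns
    \<open>x\<close> into a basis vector. It keeps the arguments of \<open>f\<close> inside the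
    bidisc, where \<open>f\<close> and \<open>f0\<close> agree.\<close>
  have hip_le: "cmod (hip x y) \<le> 1" if xy: "norm x = 1" "norm y = 1" for x y :: "complex^'m"
  proof -
    define k where "k = (undefined :: 'm)"
    obtain A where A: "A \<in> unitary_group" "A *v x = axis k 1"
      by (rule unitary_transitive[of x "axis k 1"]) (simp add: xy norm_axis_1)
    have "hip x y = (A *v y) $ k" using hip_unitary[OF A(1), of x y] by (simp add: A(2))
    then show ?thesis
      using Finite_Cartesian_Product.norm_nth_le[of "A *v y" k] by (simp add: norm_unitary[OF A(1)] xy)
  qed
  have F: "F U = (case U of (A, B) \<Rightarrow> f0 (A $ i0 $ i0, B $ j0 $ j0))" if "U \<in> unitary_group \<times> unitary_group" for U
    using that by (auto simp: F_def f0 D_def column_nth_norm_le)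
  have contF: "continuous_on (unitary_group \<times> unitary_group) F"
  proof -
    have "continuous_on (unitary_group \<times> unitary_group) (\<lambda>U. f0 (fst U $ i0 $ i0, snd U $ j0 $ j0))"
      by (rule continuous_on_compose2[OF cont_f0]) (auto intro!: continuous_intros)
    then show ?thesis
      using F by (subst continuous_on_cong[OF refl, where g = "\<lambda>U. f0 (fst U $ i0 $ i0, snd U $ j0 $ j0)"])
        (auto simp: case_prod_unfold)
  qed
  have biinv: "biinv_prod i0 j0 F"
    unfolding biinv_prod_def by (auto simp: F_def stab_group_mult_nth)
  define f1 where "f1 x = f (fst x) (snd x)" for x
  have pdF: "pos_def_prod F \<longleftrightarrow> pdk (sphere 0 1 \<times> sphere 0 1)
      (\<lambda>x y :: (complex^'q) \<times> (complex^'p). f0 (hip (fst x) (fst y), hip (snd x) (snd y)))"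
  proof -
    have "pos_def_prod F \<longleftrightarrow> pdk (sphere 0 1 \<times> sphere 0 1)
      (\<lambda>x y :: (complex^'q) \<times> (complex^'p). f1 (hip (fst x) (fst y), hip (snd x) (snd y)))"
      unfolding pos_def_prod_iff_pdk[symmetric, where i = i0 and j = j0] by (simp add: F_def f1_def)
    also have "\<dots> \<longleftrightarrow> pdk (sphere 0 1 \<times> sphere 0 1)
      (\<lambda>x y :: (complex^'q) \<times> (complex^'p). f0 (hip (fst x) (fst y), hip (snd x) (snd y)))"
      by (rule pdk_cong) (auto simp: f1_def f0 D_def hip_le)
    finally show ?thesis .
  qed
  obtain \<sigma> :: "(complex^'q) measure" where \<sigma>: "unitary_measure \<sigma>" using unitary_measure_exists by blast
  obtain \<tau> :: "(complex^'p) measure" where \<tau>: "unitary_measure \<tau>" using unitary_measure_exists by blast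
  interpret unitary_pair \<sigma> \<tau> i0 j0
    using \<sigma> \<tau> assms(1,2) by (simp add: unitary_pair_def unitary_pair_axioms_def)
  have iff: "pos_def_prod F \<longleftrightarrow> (\<exists>c. (\<forall>t. 0 \<le> c t) \<and> c summable_on UNIV \<and>
      (\<forall>z\<in>cball 0 1. \<forall>w\<in>cball 0 1. ((\<lambda>t. of_real (c t) * Z t (z, w)) has_sum f z w) UNIV))"
  proof
    assume "pos_def_prod F"
    then obtain c where "\<forall>t. 0 \<le> c t" "c summable_on UNIV"
      "\<forall>x\<in>cball 0 1 \<times> cball 0 1. ((\<lambda>t. of_real (c t) * Z t x) has_sum f0 x) UNIV"
      using pd_kernel_expansion[OF cont_f0] pdF unfolding Z_def by blast
    then show "\<exists>c. (\<forall>t. 0 \<le> c t) \<and> c summable_on UNIV \<and>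
      (\<forall>z\<in>cball 0 1. \<forall>w\<in>cball 0 1. ((\<lambda>t. of_real (c t) * Z t (z, w)) has_sum f z w) UNIV)"
      using f0 by (intro exI[of _ c]) (auto simp: D_def)
  next
    assume "\<exists>c. (\<forall>t. 0 \<le> c t) \<and> c summable_on UNIV \<and>
      (\<forall>z\<in>cball 0 1. \<forall>w\<in>cball 0 1. ((\<lambda>t. of_real (c t) * Z t (z, w)) has_sum f z w) UNIV)"
    then obtain c where "\<forall>t. 0 \<le> c t" and has: "\<forall>z\<in>cball 0 1. \<forall>w\<in>cball 0 1.
        ((\<lambda>t. of_real (c t) * Z t (z, w)) has_sum f z w) UNIV" by blast
    then have c: "0 \<le> c t" for t by blast
    have sum: "((\<lambda>t. of_real (c t) * Z t (z, w)) has_sum f z w) UNIV"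
      if "cmod z \<le> 1" "cmod w \<le> 1" for z w
      using has that by simp
    show "pos_def_prod F"
      unfolding pdF
    proof (rule pdk_has_sum)
      show "pdk (sphere 0 1 \<times> sphere 0 1) (\<lambda>x y :: (complex^'q) \<times> (complex^'p).
          of_real (c t) * Z t (hip (fst x) (fst y), hip (snd x) (snd y)))" for t
        unfolding Z_def
        by (intro pd_mult_imp_pdk pd_mult_mult pd_mult_const pd_mult_zpoly4 assms(1,2) c) auto
      fix x y :: "(complex^'q) \<times> (complex^'p)" assume "x \<in> sphere 0 1 \<times> sphere 0 1" "y \<in> sphere 0 1 \<times> sphere 0 1"
      then have "cmod (hip (fst x) (fst y)) \<le> 1" "cmod (hip (snd x) (snd y)) \<le> 1"
        by (auto intro!: hip_le)
      then show "((\<lambda>t. of_real (c t) * Z t (hip (fst x) (fst y), hip (snd x) (snd y)))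
          has_sum f0 (hip (fst x) (fst y), hip (snd x) (snd y))) UNIV"
        using sum by (simp add: f0 D_def)
    qed
  qed
  \<comment> \<open>Weierstrass M-test with majorant \<open>c\<close>, since every disc polynomial
    is bounded by 1 on the disc.\<close>
  have unif: "uniform_limit D (\<lambda>X x. \<Sum>t\<in>X. of_real (c t) * Z t x) (\<lambda>x. \<Sum>\<^sub>\<infinity>t. of_real (c t) * Z t x)
      (finite_subsets_at_top UNIV)" if "\<forall>t. 0 \<le> c t" "c summable_on UNIV" for c
    using that norm_zpoly4_term_le[OF assms(1,2)]
    by (intro Weierstrass_m_test_general[where M = c]) (auto simp: Z_def D_def)
  show ?thesis
    unfolding term_eq
    using iff contF biinv unif by (auto simp: D_def case_prod_unfold)
qed

end
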